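(* Let $\Sigma$ be an orientable $(n-1)$-dimensional compact embedded submanifold of an orientable totally geodesic hypersurface $P^n\subset\overline{M}^{n+1}$. Let $\psi:M^n\to\overline{M}^{n+1}$ be an orientable hypersurface with boundary $\Sigma=\psi(\partial M)$, and let $\nu$ be the outward pointing unit conormal vector field along $\partial M\subset M$. Let $\tau_1,\dots,\tau_{n-1}$ be the principal curvatures of $\Sigma\subset P$ with respect to the (outward pointing) unit normal $\eta$, and at each $p\in\partial M$ let $\{e_1,\dots,e_{n-1}\}$ be an orthonormal basis of $T_p(\partial M)\cong T_p\Sigma$ with $A_\Sigma e_i=\tau_i e_i$. Put $s_0=1$, $s_r=s_r(\tau_1,\dots,\tau_{n-1})$ (the $r$-th elementary symmetric function) for $1\le r\le n-1$, and $s_n=0$. Let $s_{r}(\widehat{\tau_i})$ denote the $r$-th elementary symmetric function of $\tau_1,\dots,\widehat{\tau_i},\dots,\tau_{n-1}$ ($\tau_i$ omitted). Then along $\partial M$: $$S_1=-s_1\langle\xi,\nu\rangle+\langle A\nu,\nu\rangle,$$ $$S_2=s_2\langle\xi,\nu\rangle^2-s_1\langle\xi,\nu\rangle\langle A\nu,\nu\rangle-\sum_{i=1}^{n-1}\langle A\nu,e_i\rangle^2,$$ $$S_r=(-1)^rs_r\langle\xi,\nu\rangle^r+(-1)^{r-1}s_{r-1}\langle\xi,\nu\rangle^{r-1}\langle A\nu,\nu\rangle-(-1)^{r-2}\langle\xi,\nu\rangle^{r-2}\sum_{i=1}^{n-1}s_{r-2}(\widehat{\tau_i})\langle A\nu,e_i\rangle^2$$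 for $3\le r\le n$, and $$\langle T_r\nu,\nu\rangle=(-1)^rs_r\langle\xi,\nu\rangle^r\qquad\text{for every }1\le r\le n.$$
   Context: $\overline{M}^{n+1}$ is a connected oriented Riemannian manifold with metric $\langle\,,\rangle$ and Levi-Civita connection $\overline\nabla$. A hypersurface is an isometric immersion $\psi:M^n\to\overline{M}^{n+1}$ of a connected orientable $n$-manifold with smooth boundary $\partial M$, oriented by a global unit normal ${\bf N}$; its shape operator is $A(V)=-\overline\nabla_V{\bf N}$. $M$ has boundary $\Sigma$ if $\psi|_{\partial M}$ is a diffeomorphism onto $\Sigma$ (so $\partial M$ and $\Sigma$ are identified). With $\kappa_1,\dots,\kappa_n$ the eigenvalues of $A$, $S_r$ is the $r$-th elementary symmetric function of $\kappa_1,\dots,\kappa_n$ ($S_0=1$). The Newton transformations are $T_0=I$, $T_r=S_rI-AT_{r-1}$, $1\le r\le n$. Orientation conventions: $\eta$ is the unit normal to $\Sigma$ in $P$ and $\xi$ the unit normal to $P$ in $\overline{M}$, chosen as follows. On a distinguished connected component $\Sigma_0$ of $\Sigma$, $\eta$ points outward with respect to the domain in $P$ bounded by $\Sigma_0$; then $\xi$ (on $P$) and $\eta$ (on the remaining components of $\Sigma$) are the unique choices such that for each orthonormal basis $\{e_1,\dots,e_{n-1}\}$ of $T_p(\partial M)$ one has $\det(\nu,e_1,\dots,e_{n-1},{\bf N})=1$ if and only if $\det(\eta,e_1,\dots,e_{n-1},\xi)=1$. Equivalently, $\eta=\langle\xi,{\bf N}\rangle\nu-\langle\xi,\nu\rangle{\bf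 N}$ along $\partial M$. $A_\Sigma$ is the shape operator of $\Sigma\subset P$ with respect to $\eta$, i.e. $A_\Sigma(v)=-\nabla^P_v\eta$, and $\tau_1,\dots,\tau_{n-1}$ are its eigenvalues. *)

theory Defs
  imports "HOL-Analysis.Analysis"
begin

section \<open>Smooth maps between Euclidean spaces\<close>

primrec Ck_on :: "nat \<Rightarrow> 'a::real_normed_vector set \<Rightarrow> ('a \<Rightarrow> 'b::real_normed_vector) \<Rightarrow> bool" where
  "Ck_on 0 U f \<longleftrightarrow> continuous_on U f"
| "Ck_on (Suc k) U f \<longleftrightarrow>
     (\<exists>f'. (\<forall>x\<in>U. (f has_derivative f' x) (at x)) \<and> (\<forall>v. Ck_on k U (\<lambda>x. f' x v)))"

text \<open>Smoothness on an arbitrary set means: locally the restriction of a smooth map defined on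
  an open set.  This is the usual convention on half spaces and on embedded submanifolds.\<close>

definition smooth_on :: "'a::real_normed_vector set \<Rightarrow> ('a \<Rightarrow> 'b::real_normed_vector) \<Rightarrow> bool" where
  "smooth_on S f \<longleftrightarrow>
     (\<forall>x\<in>S. \<exists>U h. open U \<and> x \<in> U \<and> (\<forall>k. Ck_on k U h) \<and> (\<forall>y\<in>S \<inter> U. h y = f y))"

section \<open>Manifolds\<close>

text \<open>A chart is a pair of a domain and a coordinate map; the map is only relevant on the domain.
  A manifold is given by an atlas, its set of points being the union of the chart domains.
  The type of points carries no topology of its own: the topology is the one induced by the atlas,
  so that an immersed submanifold may be a subset of the ambient manifold with a finer topology.\<close>

type_synonym ('x, 'n) chart = "'x set \<times> ('x \<Rightarrow> real^'n)"
type_synonym ('x, 'n) atlas = "('x, 'n) chart set"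

definition cinv :: "('x, 'n::finite) chart \<Rightarrow> real^'n \<Rightarrow> 'x" where
  "cinv c = inv_into (fst c) (snd c)"

definition cimg :: "('x, 'n::finite) chart \<Rightarrow> (real^'n) set" where
  "cimg c = snd c ` fst c"

definition carrier :: "('x, 'n::finite) atlas \<Rightarrow> 'x set" where
  "carrier A = (\<Union>c\<in>A. fst c)"

definition bdy_index :: "'n::finite" where
  "bdy_index = (SOME i. True)"

definition half_space :: "(real^'n::finite) set" where
  "half_space = {x. 0 \<le> x $ bdy_index}"

text \<open>The model space \<open>H\<close> is \<open>UNIV\<close> for manifolds without boundary and \<open>half_space\<close> for
  manifolds with (possibly empty) boundary.\<close>

definition smooth_atlas :: "(real^'n::finite) set \<Rightarrow> ('x, 'n) atlas \<Rightarrow> bool" where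
  "smooth_atlas H A \<longleftrightarrow>
     (\<forall>c\<in>A. inj_on (snd c) (fst c) \<and> openin (top_of_set H) (cimg c)) \<and>
     (\<forall>c\<in>A. \<forall>d\<in>A. openin (top_of_set H) (snd c ` (fst c \<inter> fst d)) \<and>
        smooth_on (snd c ` (fst c \<inter> fst d)) (snd d \<circ> cinv c))"

definition mtop :: "('x, 'n::finite) atlas \<Rightarrow> 'x topology" where
  "mtop A = topology (\<lambda>W. W \<subseteq> carrier A \<and>
     (\<forall>c\<in>A. openin (top_of_set (cimg c)) (snd c ` (W \<inter> fst c))))"

lemma openin_mtop:
  assumes "smooth_atlas H A"
  shows "openin (mtop A) W \<longleftrightarrow> W \<subseteq> carrier A \<and>
     (\<forall>c\<in>A. openin (top_of_set (cimg c)) (snd c ` (W \<inter> fst c)))"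
proof -
  let ?L = "\<lambda>W. W \<subseteq> carrier A \<and> (\<forall>c\<in>A. openin (top_of_set (cimg c)) (snd c ` (W \<inter> fst c)))"
  have inj: "inj_on (snd c) (fst c)" if "c \<in> A" for c
    using assms that by (auto simp: smooth_atlas_def)
  have "?L (S \<inter> T)" if "?L S" "?L T" for S T
  proof (intro conjI ballI)
    show "S \<inter> T \<subseteq> carrier A" using that by auto
    fix c assume c: "c \<in> A"
    have "snd c ` (S \<inter> T \<inter> fst c) = snd c ` (S \<inter> fst c) \<inter> snd c ` (T \<inter> fst c)"
      using inj_on_image_Int[OF inj[OF c], of "S \<inter> fst c" "T \<inter> fst c"]
      by (simp add: Int_ac)
    then show "openin (top_of_set (cimg c)) (snd c ` (S \<inter> T \<inter> fst c))"
      using that c by (auto intro: openin_Int)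
  qed
  moreover have "?L (\<Union>K)" if "\<forall>S\<in>K. ?L S" for K
  proof (intro conjI ballI)
    show "\<Union>K \<subseteq> carrier A" using that by auto
    fix c assume c: "c \<in> A"
    have "snd c ` (\<Union>K \<inter> fst c) = \<Union>((\<lambda>S. snd c ` (S \<inter> fst c)) ` K)" by auto
    then show "openin (top_of_set (cimg c)) (snd c ` (\<Union>K \<inter> fst c))"
      using that c by (auto intro!: openin_Union)
  qed
  ultimately have "istopology ?L" unfolding istopology_def by blast
  then show ?thesis unfolding mtop_def by (simp add: topology_inverse')
qed

definition manifold :: "(real^'n::finite) set \<Rightarrow> ('x, 'n) atlas \<Rightarrow> bool" where
  "manifold H A \<longleftrightarrow> smooth_atlas H A \<and> Hausdorff_space (mtop A) \<and> second_countable (mtop A)"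

definition boundary :: "('x, 'n::finite) atlas \<Rightarrow> 'x set" where
  "boundary A = {p. \<exists>c\<in>A. p \<in> fst c \<and> snd c p $ bdy_index = 0}"

definition embedded_submanifold :: "('x, 'n::finite) atlas \<Rightarrow> nat \<Rightarrow> 'x set \<Rightarrow> bool" where
  "embedded_submanifold A k S \<longleftrightarrow> S \<subseteq> carrier A \<and>
     (\<forall>p\<in>S. \<exists>d L. p \<in> fst d \<and> fst d \<subseteq> carrier A \<and> smooth_atlas UNIV (insert d A) \<and>
        subspace L \<and> dim L = k \<and> snd d ` (fst d \<inter> S) = cimg d \<inter> L)"

definition smooth_map_on ::
  "('x, 'n::finite) atlas \<Rightarrow> 'x set \<Rightarrow> ('y, 'm::finite) atlas \<Rightarrow> ('x \<Rightarrow> 'y) \<Rightarrow> bool" where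
  "smooth_map_on A S B f \<longleftrightarrow> f ` S \<subseteq> carrier B \<and>
     (\<forall>c\<in>A. \<forall>d\<in>B.
        openin (subtopology (mtop A) S) {p \<in> S \<inter> fst c. f p \<in> fst d} \<and>
        smooth_on (snd c ` {p \<in> S \<inter> fst c. f p \<in> fst d}) (snd d \<circ> f \<circ> cinv c))"

definition diffeo_on ::
  "('x, 'n::finite) atlas \<Rightarrow> 'x set \<Rightarrow> ('y, 'm::finite) atlas \<Rightarrow> 'y set \<Rightarrow> ('x \<Rightarrow> 'y) \<Rightarrow> bool" where
  "diffeo_on A S B T f \<longleftrightarrow>
     bij_betw f S T \<and> smooth_map_on A S B f \<and> smooth_map_on B T A (inv_into S f)"

section \<open>Tangent vectors\<close>

text \<open>A tangent vector at \<open>p\<close> is represented by its components in the chart \<open>chart_at A p\<close>, an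
  arbitrary but fixed chart around \<open>p\<close>.  Thus every tangent space is a copy of \<open>real^'n\<close>, and
  \<open>vec_in A c p v\<close> are the components in the chart \<open>c\<close> of the tangent vector \<open>v\<close> at \<open>p\<close>.\<close>

definition chart_at :: "('x, 'n::finite) atlas \<Rightarrow> 'x \<Rightarrow> ('x, 'n) chart" where
  "chart_at A p = (SOME c. c \<in> A \<and> p \<in> fst c)"

definition chart_change ::
  "('x, 'n::finite) chart \<Rightarrow> ('x, 'n) chart \<Rightarrow> 'x \<Rightarrow> real^'n \<Rightarrow> real^'n" where
  "chart_change c d p =
     frechet_derivative (snd d \<circ> cinv c) (at (snd c p) within snd c ` (fst c \<inter> fst d))"

definition vec_in ::
  "('x, 'n::finite) atlas \<Rightarrow> ('x, 'n) chart \<Rightarrow> 'x \<Rightarrow> real^'n \<Rightarrow> real^'n" where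
  "vec_in A c p = chart_change (chart_at A p) c p"

definition mdiff ::
  "('x, 'n::finite) atlas \<Rightarrow> ('y, 'm::finite) atlas \<Rightarrow> ('x \<Rightarrow> 'y) \<Rightarrow> 'x \<Rightarrow> real^'n \<Rightarrow> real^'m" where
  "mdiff A B f p = (let c = chart_at A p; d = chart_at B (f p) in
     frechet_derivative (snd d \<circ> f \<circ> cinv c)
       (at (snd c p) within snd c ` {x \<in> fst c. f x \<in> fst d}))"

definition immersion ::
  "('x, 'n::finite) atlas \<Rightarrow> ('y, 'm::finite) atlas \<Rightarrow> ('x \<Rightarrow> 'y) \<Rightarrow> bool" where
  "immersion A B f \<longleftrightarrow>
     smooth_map_on A (carrier A) B f \<and> (\<forall>p\<in>carrier A. inj (mdiff A B f p))"

text \<open>\<open>velocity A \<gamma> \<epsilon> p v\<close>: \<open>\<gamma>\<close> is a smooth curve on the open interval from \<open>-\<epsilon>\<close> to \<open>\<epsilon>\<close>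
  with \<open>\<gamma> 0 = p\<close> and initial velocity \<open>v\<close>.\<close>

definition velocity ::
  "('x, 'n::finite) atlas \<Rightarrow> (real \<Rightarrow> 'x) \<Rightarrow> real \<Rightarrow> 'x \<Rightarrow> real^'n \<Rightarrow> bool" where
  "velocity A \<gamma> \<epsilon> p v \<longleftrightarrow> (let c = chart_at A p in
     0 < \<epsilon> \<and> \<gamma> 0 = p \<and> \<gamma> ` {-\<epsilon><..<\<epsilon>} \<subseteq> fst c \<and>
     smooth_on {-\<epsilon><..<\<epsilon>} (snd c \<circ> \<gamma>) \<and>
     ((snd c \<circ> \<gamma>) has_vector_derivative v) (at 0))"

definition tangent_to :: "('x, 'n::finite) atlas \<Rightarrow> 'x set \<Rightarrow> 'x \<Rightarrow> (real^'n) set" where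
  "tangent_to A S p = {v. \<exists>\<gamma> \<epsilon>. velocity A \<gamma> \<epsilon> p v \<and> \<gamma> ` {-\<epsilon><..<\<epsilon>} \<subseteq> S}"

definition points_outward :: "('x, 'n::finite) atlas \<Rightarrow> 'x set \<Rightarrow> 'x \<Rightarrow> real^'n \<Rightarrow> bool" where
  "points_outward A D p v \<longleftrightarrow> (\<exists>\<gamma> \<epsilon>. velocity A \<gamma> \<epsilon> p v \<and>
     \<gamma> ` {-\<epsilon><..<0} \<subseteq> D \<and> \<gamma> ` {0<..<\<epsilon>} \<inter> (mtop A closure_of D) = {})"

section \<open>Riemannian metrics and the Levi-Civita connection\<close>

type_synonym ('x, 'n) metric = "'x \<Rightarrow> real^'n \<Rightarrow> real^'n \<Rightarrow> real"

definition metric_in :: "('x, 'n::finite) atlas \<Rightarrow> ('x, 'n) metric \<Rightarrow> ('x, 'n) chart \<Rightarrow>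
    real^'n \<Rightarrow> real^'n \<Rightarrow> real^'n \<Rightarrow> real" where
  "metric_in A g c x u v = (let p = cinv c x; T = chart_change c (chart_at A p) p in g p (T u) (T v))"

definition riemannian_metric :: "('x, 'n::finite) atlas \<Rightarrow> ('x, 'n) metric \<Rightarrow> bool" where
  "riemannian_metric A g \<longleftrightarrow>
     (\<forall>p\<in>carrier A. bilinear (g p) \<and> (\<forall>u v. g p u v = g p v u) \<and> (\<forall>u. u \<noteq> 0 \<longrightarrow> 0 < g p u u)) \<and>
     (\<forall>c\<in>A. \<forall>u v. smooth_on (cimg c) (\<lambda>x. metric_in A g c x u v))"

definition isometric_immersion :: "('x, 'n::finite) atlas \<Rightarrow> ('x, 'n) metric \<Rightarrow>
    ('y, 'm::finite) atlas \<Rightarrow> ('y, 'm) metric \<Rightarrow> ('x \<Rightarrow> 'y) \<Rightarrow> bool" where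
  "isometric_immersion A gA B gB f \<longleftrightarrow> immersion A B f \<and>
     (\<forall>p\<in>carrier A. \<forall>u v. gB (f p) (mdiff A B f p u) (mdiff A B f p v) = gA p u v)"

text \<open>\<open>christoffel A g c x u v\<close> is the covariant derivative at \<open>x\<close>, in the chart \<open>c\<close>, of the
  vector field with constant components \<open>v\<close> in the direction \<open>u\<close>; it is bilinear in \<open>u\<close>, \<open>v\<close>, with
  the Christoffel symbols as coefficients.  It is given by the Koszul formula, in which the
  brackets of constant fields vanish.\<close>

definition christoffel :: "('x, 'n::finite) atlas \<Rightarrow> ('x, 'n) metric \<Rightarrow> ('x, 'n) chart \<Rightarrow>
    real^'n \<Rightarrow> real^'n \<Rightarrow> real^'n \<Rightarrow> real^'n" where
  "christoffel A g c x u v =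
     (let G = metric_in A g c;
          D = (\<lambda>a b e. frechet_derivative (\<lambda>y. G y b e) (at x within cimg c) a)
      in THE z. \<forall>w. 2 * G x z w = D u v w + D v u w - D w u v)"

text \<open>A vector field along \<open>f\<close> over \<open>S \<subseteq> carrier A\<close> assigns to \<open>p \<in> S\<close> a tangent vector
  \<open>W p\<close> of \<open>B\<close> at \<open>f p\<close>.\<close>

definition smooth_field_along :: "('x, 'n::finite) atlas \<Rightarrow> 'x set \<Rightarrow> ('y, 'm::finite) atlas \<Rightarrow>
    ('x \<Rightarrow> 'y) \<Rightarrow> ('x \<Rightarrow> real^'m) \<Rightarrow> bool" where
  "smooth_field_along A S B f W \<longleftrightarrow>
     (\<forall>c\<in>A. \<forall>d\<in>B. smooth_on (snd c ` {p \<in> S \<inter> fst c. f p \<in> fst d})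
        ((\<lambda>p. vec_in B d (f p) (W p)) \<circ> cinv c))"

text \<open>\<open>cov_deriv A S B g f W p v\<close> is the derivative of \<open>W\<close>, a field along \<open>f\<close> over \<open>S\<close>, in the
  direction \<open>v\<close>, with respect to the (pulled back) Levi-Civita connection of \<open>(B, g)\<close>.
  When \<open>S\<close> is a proper submanifold, \<open>W\<close> is defined on \<open>S\<close> only: the derivative is then
  meaningful exactly for \<open>v\<close> tangent to \<open>S\<close>, since all derivatives within \<open>S\<close> agree on such
  \<open>v\<close>, although not elsewhere.\<close>

definition cov_deriv :: "('x, 'n::finite) atlas \<Rightarrow> 'x set \<Rightarrow> ('y, 'm::finite) atlas \<Rightarrow>
    ('y, 'm) metric \<Rightarrow> ('x \<Rightarrow> 'y) \<Rightarrow> ('x \<Rightarrow> real^'m) \<Rightarrow> 'x \<Rightarrow> real^'n \<Rightarrow> real^'m" where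
  "cov_deriv A S B g f W p v = (let c = chart_at A p; d = chart_at B (f p) in
     frechet_derivative ((\<lambda>q. vec_in B d (f q) (W q)) \<circ> cinv c)
       (at (snd c p) within snd c ` {q \<in> S \<inter> fst c. f q \<in> fst d}) v
     + christoffel B g d (snd d (f p)) (mdiff A B f p v) (W p))"

section \<open>Hypersurfaces\<close>

definition unit_normal :: "('x, 'n::finite) atlas \<Rightarrow> ('y, 'm::finite) atlas \<Rightarrow>
    ('y, 'm) metric \<Rightarrow> ('x \<Rightarrow> 'y) \<Rightarrow> ('x \<Rightarrow> real^'m) \<Rightarrow> bool" where
  "unit_normal A B g f N \<longleftrightarrow> smooth_field_along A (carrier A) B f N \<and>
     (\<forall>p\<in>carrier A. g (f p) (N p) (N p) = 1 \<and> (\<forall>v. g (f p) (N p) (mdiff A B f p v) = 0))"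

definition unit_normal_sub ::
  "('x, 'n::finite) atlas \<Rightarrow> ('x, 'n) metric \<Rightarrow> 'x set \<Rightarrow> ('x \<Rightarrow> real^'n) \<Rightarrow> bool" where
  "unit_normal_sub A g S \<eta> \<longleftrightarrow> smooth_field_along A S A id \<eta> \<and>
     (\<forall>p\<in>S. g p (\<eta> p) (\<eta> p) = 1 \<and> (\<forall>v\<in>tangent_to A S p. g p (\<eta> p) v = 0))"

definition shape_op :: "('x, 'n::finite) atlas \<Rightarrow> ('y, 'm::finite) atlas \<Rightarrow>
    ('y, 'm) metric \<Rightarrow> ('x \<Rightarrow> 'y) \<Rightarrow> ('x \<Rightarrow> real^'m) \<Rightarrow> 'x \<Rightarrow> real^'n \<Rightarrow> real^'n" where
  "shape_op A B g f N p v =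
     (THE w. mdiff A B f p w = - cov_deriv A (carrier A) B g f N p v)"

definition shape_op_sub :: "('x, 'n::finite) atlas \<Rightarrow> ('x, 'n) metric \<Rightarrow> 'x set \<Rightarrow>
    ('x \<Rightarrow> real^'n) \<Rightarrow> 'x \<Rightarrow> real^'n \<Rightarrow> real^'n" where
  "shape_op_sub A g S \<eta> p v = - cov_deriv A S A g id \<eta> p v"

definition second_fundamental_form :: "('x, 'n::finite) atlas \<Rightarrow> ('x, 'n) metric \<Rightarrow>
    ('y, 'm::finite) atlas \<Rightarrow> ('y, 'm) metric \<Rightarrow> ('x \<Rightarrow> 'y) \<Rightarrow> ('x \<Rightarrow> real^'m) \<Rightarrow>
    'x \<Rightarrow> real^'n \<Rightarrow> real^'n \<Rightarrow> real" where
  "second_fundamental_form A gA B gB f N p u v = gA p (shape_op A B gB f N p u) v"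

definition totally_geodesic :: "('x, 'n::finite) atlas \<Rightarrow> ('x, 'n) metric \<Rightarrow>
    ('y, 'm::finite) atlas \<Rightarrow> ('y, 'm) metric \<Rightarrow> ('x \<Rightarrow> 'y) \<Rightarrow> ('x \<Rightarrow> real^'m) \<Rightarrow> bool" where
  "totally_geodesic A gA B gB f N \<longleftrightarrow>
     (\<forall>p\<in>carrier A. \<forall>u v. second_fundamental_form A gA B gB f N p u v = 0)"

text \<open>The model space is \<open>half_space\<close>, so outward vectors have negative \<open>bdy_index\<close> component.\<close>

definition outward_unit_conormal ::
  "('x, 'n::finite) atlas \<Rightarrow> ('x, 'n) metric \<Rightarrow> ('x \<Rightarrow> real^'n) \<Rightarrow> bool" where
  "outward_unit_conormal A g \<nu> \<longleftrightarrow>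
     (\<forall>p\<in>boundary A. g p (\<nu> p) (\<nu> p) = 1 \<and>
        (\<forall>v\<in>tangent_to A (boundary A) p. g p (\<nu> p) v = 0) \<and> \<nu> p $ bdy_index < 0)"

definition orthonormal_basis ::
  "('v::real_vector \<Rightarrow> 'v \<Rightarrow> real) \<Rightarrow> 'v set \<Rightarrow> 'v list \<Rightarrow> bool" where
  "orthonormal_basis b V es \<longleftrightarrow> span (set es) = V \<and>
     (\<forall>i<length es. \<forall>j<length es. b (es ! i) (es ! j) = (if i = j then 1 else 0))"

section \<open>Orientation\<close>

text \<open>An orientation is given by an atlas with orientation preserving chart changes.\<close>

definition oriented_atlas :: "('x, 'n::finite) atlas \<Rightarrow> bool" where
  "oriented_atlas A \<longleftrightarrow>
     (\<forall>c\<in>A. \<forall>d\<in>A. \<forall>p\<in>fst c \<inter> fst d. 0 < det (matrix (chart_change c d p)))"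

text \<open>The determinant of a list of \<open>CARD('n)\<close> tangent vectors at \<open>p\<close> with respect to any positively
  oriented orthonormal basis, i.e. the value of the Riemannian volume form
  \<open>sqrt (det g) dx\<^sub>1 \<and> \<dots> \<and> dx\<^sub>n\<close> on it.  The index type is unordered, so the order of
  the coordinates is that of the enumeration \<open>to_nat_on UNIV\<close>.\<close>

definition oriented_det :: "('x, 'n::finite) metric \<Rightarrow> 'x \<Rightarrow> (real^'n) list \<Rightarrow> real" where
  "oriented_det g p vs =
     sqrt (det (\<chi> i j. g p (axis i 1) (axis j 1))) * det (\<chi> i. vs ! to_nat_on (UNIV :: 'n set) i)"

section \<open>Symmetric functions and Newton transformations\<close>

definition esym :: "nat \<Rightarrow> real list \<Rightarrow> real" where
  "esym r xs = (\<Sum>I | I \<subseteq> {..<length xs} \<and> card I = r. \<Prod>i\<in>I. xs ! i)"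

definition omit :: "nat \<Rightarrow> 'a list \<Rightarrow> 'a list" where
  "omit i xs = take i xs @ drop (Suc i) xs"

text \<open>The eigenvalues, listed with algebraic multiplicity.\<close>

definition eigenvalue_list :: "(real^'n::finite \<Rightarrow> real^'n) \<Rightarrow> real list \<Rightarrow> bool" where
  "eigenvalue_list T \<kappa> \<longleftrightarrow> length \<kappa> = CARD('n) \<and>
     (\<forall>t. det (matrix (\<lambda>v. t *\<^sub>R v - T v)) = (\<Prod>k\<leftarrow>\<kappa>. t - k))"

definition sym_curvature :: "nat \<Rightarrow> (real^'n::finite \<Rightarrow> real^'n) \<Rightarrow> real" where
  "sym_curvature r T = esym r (SOME \<kappa>. eigenvalue_list T \<kappa>)"

primrec newton :: "nat \<Rightarrow> (real^'n::finite \<Rightarrow> real^'n) \<Rightarrow> real^'n \<Rightarrow> real^'n" where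
  "newton 0 T = id"
| "newton (Suc r) T = (\<lambda>v. sym_curvature (Suc r) T *\<^sub>R v - T (newton r T v))"

end

theory Submission
  imports Defs "HOL-Computational_Algebra.Fundamental_Theorem_Algebra"
begin

text \<open>Let \<open>c = \<langle>\<xi>, \<nu>\<rangle>\<close>.  The orientation convention forces \<open>\<langle>\<N>, \<eta>\<rangle> = - c\<close> for the unit normal \<open>\<N>\<close> of
  \<open>M\<close>.  The acceleration of a curve in \<open>\<Sigma>\<close> is normal to \<open>\<xi>\<close>, as \<open>P\<close> is totally geodesic, so its
  \<open>\<N>\<close>-component is \<open>- c\<close> times its \<open>\<eta>\<close>-component.  Polarization gives \<open>\<langle>A e\<^sub>i, e\<^sub>j\<rangle> = - c \<tau>\<^sub>i \<delta>\<^sub>i\<^sub>j\<close>, that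
  is, in the basis \<open>e\<^sub>1, \<dots>, e\<^sub>n\<^sub>-\<^sub>1, \<nu>\<close> the symmetric matrix of \<open>A\<close> is diagonal except for its last row
  and column.  Expanding the characteristic polynomial of such a matrix gives the \<open>S\<^sub>r\<close>; induction on \<open>r\<close>
  then gives \<open>T\<^sub>r \<nu> = s\<^sub>r \<nu> - \<Sum>\<^sub>i \<langle>A \<nu>, e\<^sub>i\<rangle> s\<^sub>r\<^sub>-\<^sub>1 e\<^sub>i\<close>, where \<open>s\<^sub>r\<close> is formed from all the numbers
  \<open>- c \<tau>\<^sub>j\<close> and \<open>s\<^sub>r\<^sub>-\<^sub>1\<close> from those with \<open>j \<noteq> i\<close>.\<close>

section \<open>Symmetric operators with diagonal compression to a hyperplane\<close>

text \<open>\<open>sym_curvature\<close> evaluates \<open>esym\<close> at an eigenvalue list taken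
  by choice. It says nothing until a real list is known to exist, so the characteristic polynomial
  has to split over the reals; the bordered form of the matrix gives this directly. At a boundary
  point the charts of \<open>M\<close> cover only one side, so first derivatives are taken within a
  set and second ones on a local extension. The shape operator of \<Sigma> is meaningful only on
  vectors tangent to \<Sigma>, which is why it is compared with that of \<open>M\<close> along
  curves in \<Sigma>. A curve yields only the quadratic form; the off-diagonal entries follow from
  it because the tangent space is closed under sums, both operators are linear and that of
  \<open>M\<close> is symmetric. The orientation hypothesis is an equivalence between two
  determinants being 1. Both are 1 or -1, so it makes them equal; the frames
  \<open>\<nu>, es, N\<close> and \<open>\<eta>, es, \<xi>\<close> then differ by a plane rotation,
  and \<open>\<langle>N, \<eta>\<rangle> = - c\<close> says that the two off-diagonal entries of a
  rotation are opposite.\<close>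

lemma prod_list_eq_prod_nth: "(\<Prod>k\<leftarrow>xs. f k) = (\<Prod>i<length xs. f (xs ! i))"
  for f :: "'a \<Rightarrow> 'b::comm_monoid_mult"
  by (simp add: prod.list_conv_set_nth atLeast0LessThan)

text \<open>Expanding the product means choosing the factors that contribute their linear term, and
  the number of these is the exponent. With this generating function, recursions for
  \<open>esym\<close> become products of polynomials.\<close>

lemma esym_eq_coeff: "esym r xs = coeff (\<Prod>k\<leftarrow>xs. [:1, k:]) r"
proof -
  have *: "(\<Prod>i\<in>I. [:0, xs ! i:]) = monom (\<Prod>i\<in>I. xs ! i) (card I)" if "finite I" for I
    using that
    by (induction I rule: finite_induct)
       (simp_all add: monom_Suc flip: smult_monom)
  have "(\<Prod>k\<leftarrow>xs. [:1, k:]) = (\<Prod>i<length xs. [:0, xs ! i:] + 1)"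
    by (simp add: prod_list_eq_prod_nth one_pCons)
  also have "\<dots> = (\<Sum>I\<in>Pow {..<length xs}. monom (\<Prod>i\<in>I. xs ! i) (card I))"
    by (subst prod_add) (auto intro!: sum.cong simp: * finite_subset)
  finally have "coeff (\<Prod>k\<leftarrow>xs. [:1, k:]) r =
      (\<Sum>I\<in>Pow {..<length xs}. if card I = r then \<Prod>i\<in>I. xs ! i else 0)"
    by (simp add: coeff_sum)
  also have "\<dots> = esym r xs"
    unfolding esym_def by (subst sum.inter_filter [symmetric]) (auto intro!: sum.cong)
  finally show ?thesis by simp
qed

lemma esym_0 [simp]: "esym 0 xs = 1"
proof -
  have "{I. I \<subseteq> {..<length xs} \<and> card I = 0} = {{}}"
    using finite_subset[of _ "{..<length xs}"] by auto
  then show ?thesis by (simp add: esym_def)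
qed

lemma length_omit: "i < length xs \<Longrightarrow> length (omit i xs) = length xs - 1"
  by (auto simp: omit_def)

lemma prod_list_omit:
  fixes f :: "'a \<Rightarrow> 'b::comm_monoid_mult"
  assumes "i < length xs"
  shows "(\<Prod>k\<leftarrow>xs. f k) = f (xs ! i) * (\<Prod>k\<leftarrow>omit i xs. f k)"
proof -
  have "xs = take i xs @ xs ! i # drop (Suc i) xs"
    using assms by (rule id_take_nth_drop)
  then have "(\<Prod>k\<leftarrow>xs. f k) = (\<Prod>k\<leftarrow>take i xs @ xs ! i # drop (Suc i) xs. f k)"
    by simp
  then show ?thesis by (simp add: omit_def mult_ac)
qed

lemma prod_list_omit_eq_prod_nth:
  fixes f :: "'a \<Rightarrow> 'b::comm_monoid_mult"
  assumes "i < length xs"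
  shows "(\<Prod>k\<leftarrow>omit i xs. f k) = (\<Prod>j\<in>{..<length xs} - {i}. f (xs ! j))"
proof -
  have "(\<Prod>j\<in>{Suc i..<length xs}. f (xs ! j)) = (\<Prod>j<length xs - Suc i. f (xs ! (Suc i + j)))"
    by (rule prod.reindex_bij_witness[of _ "\<lambda>j. Suc i + j" "\<lambda>j. j - Suc i"]) auto
  moreover have "{..<length xs} - {i} = {..<i} \<union> {Suc i..<length xs}"
    using assms by auto
  moreover have "(\<Prod>j\<in>{..<i} \<union> {Suc i..<length xs}. f (xs ! j)) =
      (\<Prod>j<i. f (xs ! j)) * (\<Prod>j\<in>{Suc i..<length xs}. f (xs ! j))"
    by (rule prod.union_disjoint) auto
  ultimately show ?thesis
    using assms by (simp add: omit_def prod_list_eq_prod_nth)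
qed

text \<open>The factor of the entry \<open>xs ! i\<close> is split off the generating function. The
  induction for the Newton transformations rests on this identity.\<close>

lemma esym_Suc_omit:
  assumes "i < length xs"
  shows "esym (Suc r) xs = esym (Suc r) (omit i xs) + xs ! i * esym r (omit i xs)"
  unfolding esym_eq_coeff prod_list_omit[OF assms, of "\<lambda>k. [:1, k:]"]
  by (simp add: coeff_pCons)

lemma esym_scale: "esym r (map ((*) c) xs) = c ^ r * esym r xs"
proof -
  have "(\<Prod>i\<in>I. map ((*) c) xs ! i) = c ^ r * (\<Prod>i\<in>I. xs ! i)"
    if "I \<subseteq> {..<length xs}" "card I = r" for I
  proof -
    have "(\<Prod>i\<in>I. map ((*) c) xs ! i) = (\<Prod>i\<in>I. c * xs ! i)"
      using that by (intro prod.cong) auto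
    then show ?thesis using that by (simp add: prod.distrib)
  qed
  then show ?thesis
    unfolding esym_def by (simp add: sum_distrib_left)
qed

lemma omit_map: "omit i (map f xs) = map f (omit i xs)"
  by (simp add: omit_def take_map drop_map)

text \<open>A root \<open>z\<close> off the real axis satisfies \<open>z - a = (\<Sum>i\<in>I. (b i)\<^sup>2 / (z - d i))\<close>,
  whose two sides have imaginary parts of opposite signs.\<close>

lemma bordered_diagonal_roots_real:
  fixes a :: real and b d :: "'i \<Rightarrow> real" and z :: complex
  assumes I: "finite I"
    and z: "(z - of_real a) * (\<Prod>i\<in>I. z - of_real (d i)) -
      (\<Sum>i\<in>I. of_real ((b i)\<^sup>2) * (\<Prod>j\<in>I - {i}. z - of_real (d j))) = 0"
  shows "Im z = 0"
proof (rule ccontr)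
  assume nz: "Im z \<noteq> 0"
  then have ne: "z - of_real (d i) \<noteq> 0" for i
    by (metis Im_complex_of_real eq_iff_diff_eq_0)
  let ?p = "\<Prod>i\<in>I. z - of_real (d i)"
  have p: "?p \<noteq> 0" using ne I by (simp add: prod_zero_iff)
  have "(\<Prod>j\<in>I - {i}. z - of_real (d j)) = ?p / (z - of_real (d i))" if "i \<in> I" for i
    using ne I that by (simp add: prod.remove[of I i])
  then have "(z - of_real a) * ?p = (\<Sum>i\<in>I. of_real ((b i)\<^sup>2) * (?p / (z - of_real (d i))))"
    using z by simp
  also have "\<dots> = (\<Sum>i\<in>I. of_real ((b i)\<^sup>2) / (z - of_real (d i))) * ?p"
    by (simp add: sum_distrib_right)
  finally have "z - of_real a = (\<Sum>i\<in>I. of_real ((b i)\<^sup>2) / (z - of_real (d i)))"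
    using p by simp
  then have "Im (z - of_real a) = (\<Sum>i\<in>I. Im (of_real ((b i)\<^sup>2) / (z - of_real (d i))))"
    by simp
  also have "\<dots> = (\<Sum>i\<in>I. - Im z * ((b i)\<^sup>2 / (cmod (z - of_real (d i)))\<^sup>2))"
  proof (rule sum.cong[OF refl])
    fix i
    show "Im (of_real ((b i)\<^sup>2) / (z - of_real (d i))) =
        - Im z * ((b i)\<^sup>2 / (cmod (z - of_real (d i)))\<^sup>2)"
      unfolding Im_divide cmod_power2 by (simp add: power2_eq_square)
  qed
  also have "\<dots> = - Im z * (\<Sum>i\<in>I. (b i)\<^sup>2 / (cmod (z - of_real (d i)))\<^sup>2)"
    by (simp only: sum_distrib_left)
  finally have "Im z * (1 + (\<Sum>i\<in>I. (b i)\<^sup>2 / (cmod (z - of_real (d i)))\<^sup>2)) = 0"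
    by (simp add: algebra_simps)
  moreover have "0 \<le> (\<Sum>i\<in>I. (b i)\<^sup>2 / (cmod (z - of_real (d i)))\<^sup>2)"
    by (intro sum_nonneg) auto
  ultimately show False using nz by auto
qed

lemma poly_prod_list_map: "poly (\<Prod>k\<leftarrow>l. f k) x = (\<Prod>k\<leftarrow>l. poly (f k) x)"
  by (induction l) simp_all

lemma degree_prod_linear: "degree (\<Prod>i\<in>I. [:- f i, 1:]) = card I"
  for f :: "'i \<Rightarrow> 'b::idom"
  by (subst degree_prod_sum_eq) auto

text \<open>The fundamental theorem of algebra supplies complex roots, and all of them are real by
  the preceding lemma. Since \<open>q1\<close> is monic and \<open>q2\<close> has smaller degree,
  \<open>q1 - q2\<close> is monic, so its factorization has no constant factor and the list of roots
  has the right length. This takes the place of diagonalizing a symmetric operator.\<close>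

lemma bordered_diagonal_charpoly_splits:
  fixes a :: real and b d :: "'i \<Rightarrow> real"
  assumes I: "finite I"
  shows "\<exists>\<kappa>. length \<kappa> = Suc (card I) \<and>
    (\<forall>t. (t - a) * (\<Prod>i\<in>I. t - d i) - (\<Sum>i\<in>I. (b i)\<^sup>2 * (\<Prod>j\<in>I - {i}. t - d j)) =
      (\<Prod>k\<leftarrow>\<kappa>. t - k))"
proof -
  define q1 :: "complex poly" where
    "q1 = [:- of_real a, 1:] * (\<Prod>i\<in>I. [:- of_real (d i), 1:])"
  define q2 :: "complex poly" where
    "q2 = (\<Sum>i\<in>I. smult (of_real ((b i)\<^sup>2)) (\<Prod>j\<in>I - {i}. [:- of_real (d j), 1:]))"
  have pr: "(\<Prod>i\<in>I. [:- complex_of_real (d i), 1:]) \<noteq> 0"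
    using I by (simp add: prod_zero_iff)
  have deg1: "degree q1 = Suc (card I)"
    unfolding q1_def by (subst degree_mult_eq) (use pr in \<open>auto simp: degree_prod_linear\<close>)
  have lead1: "lead_coeff q1 = 1"
    unfolding q1_def lead_coeff_mult by (simp add: lead_coeff_prod)
  have "degree (smult (of_real ((b i)\<^sup>2)) (\<Prod>j\<in>I - {i}. [:- complex_of_real (d j), 1:])) \<le> card I"
    if "i \<in> I" for i
    by (rule order_trans[OF degree_smult_le]) (simp add: degree_prod_linear card_Diff1_le)
  then have deg2: "degree q2 < degree q1"
    unfolding deg1 q2_def using I by (intro le_imp_less_Suc degree_sum_le) auto
  have deg: "degree (q1 - q2) = Suc (card I)"
    using degree_add_eq_left[of "- q2" q1] deg2 deg1 by simp
  have lead: "lead_coeff (q1 - q2) = 1"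
    using lead1 deg deg1 deg2 by (simp add: coeff_eq_0)
  have poly_q: "poly (q1 - q2) z = (z - of_real a) * (\<Prod>i\<in>I. z - of_real (d i)) -
      (\<Sum>i\<in>I. of_real ((b i)\<^sup>2) * (\<Prod>j\<in>I - {i}. z - of_real (d j)))" for z
    unfolding q1_def q2_def poly_diff poly_mult poly_prod poly_sum poly_smult by simp
  obtain zs where zs: "size zs = Suc (card I)" "q1 - q2 = (\<Prod>x\<in>#zs. [:-x, 1:])"
    using alg_closed_imp_factorization[of "q1 - q2"] lead deg
    by (metis degree_0 nat.distinct(1) smult_1_left)
  obtain l where l: "mset l = zs" using ex_mset by blast
  have real: "Im z = 0" if "z \<in> set l" for z
  proof (rule bordered_diagonal_roots_real[OF I, of z a d b])
    have "poly (q1 - q2) z = 0"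
      unfolding zs(2) using that l by (auto simp: poly_prod_mset)
    then show "(z - of_real a) * (\<Prod>i\<in>I. z - of_real (d i)) -
      (\<Sum>i\<in>I. of_real ((b i)\<^sup>2) * (\<Prod>j\<in>I - {i}. z - of_real (d j))) = 0"
      by (simp only: poly_q)
  qed
  have re: "(\<Prod>x\<leftarrow>l. of_real t - x) = of_real (\<Prod>k\<leftarrow>map Re l. t - k)" for t
    using real
    by (induction l) (auto simp: complex_eq_iff complex_is_Real_iff)
  have "poly (q1 - q2) (of_real t) = of_real (\<Prod>k\<leftarrow>map Re l. t - k)" for t
    unfolding zs(2) re[symmetric] l[symmetric]
    by (simp add: poly_prod_list_map prod_mset_prod_list flip: mset_map)
  then have "complex_of_real ((t - a) * (\<Prod>i\<in>I. t - d i) -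
      (\<Sum>i\<in>I. (b i)\<^sup>2 * (\<Prod>j\<in>I - {i}. t - d j))) = of_real (\<Prod>k\<leftarrow>map Re l. t - k)" for t
    using poly_q[of "of_real t" for t] by simp
  then have "(t - a) * (\<Prod>i\<in>I. t - d i) - (\<Sum>i\<in>I. (b i)\<^sup>2 * (\<Prod>j\<in>I - {i}. t - d j)) =
      (\<Prod>k\<leftarrow>map Re l. t - k)" for t
    using of_real_eq_iff by blast
  moreover have "length (map Re l) = Suc (card I)" using zs l by auto
  ultimately show ?thesis by blast
qed

lemma coeff_X2_mult: "coeff ([:0, 0, 1:] * p) (Suc (Suc r)) = coeff p r"
  "coeff ([:0, 0, 1:] * p) (Suc 0) = 0"
  for p :: "'b::comm_ring_1 poly"
  by (simp_all add: coeff_pCons)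

lemma coeff_linear_mult: "coeff ([:1, a:] * p) (Suc r) = coeff p (Suc r) + a * coeff p r"
  for p :: "'b::comm_ring_1 poly"
  by (simp add: coeff_pCons)

text \<open>Vieta's formulas, read off from the reversed characteristic polynomial
  \<open>x \<mapsto> \<Prod>k. 1 + k * x\<close>.\<close>

lemma sym_curvature_bordered_diagonal:
  fixes T :: "real^'n::finite \<Rightarrow> real^'n" and ds :: "real list" and b :: "nat \<Rightarrow> real"
  assumes dim: "CARD('n) = Suc (length ds)"
    and det: "\<And>t. det (matrix (\<lambda>v. t *\<^sub>R v - T v)) =
      (t - a) * (\<Prod>i<length ds. t - ds ! i) -
      (\<Sum>i<length ds. (b i)\<^sup>2 * (\<Prod>j\<in>{..<length ds} - {i}. t - ds ! j))"
  shows "sym_curvature (Suc 0) T = esym 1 ds + a"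
    and "sym_curvature (Suc (Suc r)) T = esym (Suc (Suc r)) ds + a * esym (Suc r) ds -
      (\<Sum>i<length ds. esym r (omit i ds) * (b i)\<^sup>2)"
proof -
  \<comment> \<open>This is the unspecified list inside \<open>sym_curvature\<close>. As soon as one
    list with the required product exists, the chosen one is an eigenvalue list as well.\<close>
  define \<kappa> where "\<kappa> = (SOME \<kappa>. eigenvalue_list T \<kappa>)"
  obtain \<kappa>' where "length \<kappa>' = CARD('n)" "\<And>t. det (matrix (\<lambda>v. t *\<^sub>R v - T v)) = (\<Prod>k\<leftarrow>\<kappa>'. t - k)"
    using bordered_diagonal_charpoly_splits[of "{..<length ds}" a "(!) ds" b]
    unfolding det dim by auto
  then have "eigenvalue_list T \<kappa>'" by (simp add: eigenvalue_list_def)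
  then have \<kappa>: "eigenvalue_list T \<kappa>" unfolding \<kappa>_def by (rule someI)
  \<comment> \<open>The bordered characteristic polynomial reversed: for \<open>t = - 1 / x\<close>,
    multiplication by a power of \<open>- x\<close> turns each \<open>t - k\<close> into
    \<open>1 + x * k\<close>. The products in the sum have two factors fewer than the leading term,
    which leaves \<open>x^2\<close> in front of them.\<close>
  define q where "q = [:1, a:] * (\<Prod>k\<leftarrow>ds. [:1, k:]) -
    [:0, 0, 1:] * (\<Sum>i<length ds. smult ((b i)\<^sup>2) (\<Prod>k\<leftarrow>omit i ds. [:1, k:]))"
  have "poly (\<Prod>k\<leftarrow>\<kappa>. [:1, k:]) x = poly q x" if "x \<noteq> 0" for x
  proof -
    define t where "t = - 1 / x"
    have tx: "- x * t = 1" using that by (simp add: t_def)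
    have fac: "(\<Prod>k\<leftarrow>l. 1 + x * k) = (-x) ^ length l * (\<Prod>k\<leftarrow>l. t - k)" for l
    proof (induction l)
      case (Cons k l)
      have "1 + x * k = - x * (t - k)" using tx by (simp add: algebra_simps)
      then show ?case using Cons by simp
    qed simp
    have om: "(-x) ^ length ds * (\<Prod>j\<in>{..<length ds} - {i}. t - ds ! j) =
        - x * (\<Prod>k\<leftarrow>omit i ds. 1 + x * k)" if "i < length ds" for i
    proof -
      note prod_list_omit_eq_prod_nth[OF that, of "\<lambda>k. t - k"]
      then show ?thesis
        using fac[of "omit i ds"] length_omit[OF that] that
        by (cases "length ds") auto
    qed
    have "poly (\<Prod>k\<leftarrow>\<kappa>. [:1, k:]) x = (-x) ^ Suc (length ds) * (\<Prod>k\<leftarrow>\<kappa>. t - k)"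
      using \<kappa> dim by (simp add: poly_prod_list_map fac eigenvalue_list_def)
    also have "(\<Prod>k\<leftarrow>\<kappa>. t - k) = (t - a) * (\<Prod>k\<leftarrow>ds. t - k) -
      (\<Sum>i<length ds. (b i)\<^sup>2 * (\<Prod>j\<in>{..<length ds} - {i}. t - ds ! j))"
      using \<kappa> by (simp add: eigenvalue_list_def det prod_list_eq_prod_nth flip: det)
    also have "(-x) ^ Suc (length ds) * \<dots> = (1 + x * a) * (\<Prod>k\<leftarrow>ds. 1 + x * k) +
      x * (\<Sum>i<length ds. (b i)\<^sup>2 * ((-x) ^ length ds * (\<Prod>j\<in>{..<length ds} - {i}. t - ds ! j)))"
    proof -
      have xa: "1 + x * a = - x * (t - a)" using tx by (simp add: algebra_simps)
      show ?thesis
        unfolding xa fac[of ds] by (simp add: sum_distrib_left sum_negf algebra_simps)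
    qed
    also have "(\<Sum>i<length ds. (b i)\<^sup>2 * ((-x) ^ length ds * (\<Prod>j\<in>{..<length ds} - {i}. t - ds ! j))) =
        (\<Sum>i<length ds. (b i)\<^sup>2 * (- x * (\<Prod>k\<leftarrow>omit i ds. 1 + x * k)))"
      by (intro sum.cong refl) (simp only: om lessThan_iff)
    also have "(1 + x * a) * (\<Prod>k\<leftarrow>ds. 1 + x * k) + x * \<dots> = poly q x"
      by (simp add: q_def poly_prod_list_map poly_sum sum_distrib_left sum_negf algebra_simps)
    finally show ?thesis .
  qed
  \<comment> \<open>The substitution excludes \<open>x = 0\<close>, but agreement at infinitely many
    points already determines a polynomial.\<close>
  then have "UNIV - {0} \<subseteq> {x. poly ((\<Prod>k\<leftarrow>\<kappa>. [:1, k:]) - q) x = 0}"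
    by auto
  then have "infinite {x. poly ((\<Prod>k\<leftarrow>\<kappa>. [:1, k:]) - q) x = 0}"
    using infinite_super infinite_remove[OF infinite_UNIV_char_0[where 'a = real]] by blast
  then have eq: "(\<Prod>k\<leftarrow>\<kappa>. [:1, k:]) = q"
    using poly_roots_finite[of "(\<Prod>k\<leftarrow>\<kappa>. [:1, k:]) - q"] by (metis eq_iff_diff_eq_0)
  have coeff: "sym_curvature r T = coeff q r" for r
    unfolding sym_curvature_def \<kappa>_def[symmetric] esym_eq_coeff eq ..
  show "sym_curvature (Suc 0) T = esym 1 ds + a"
    unfolding coeff q_def coeff_diff coeff_X2_mult coeff_linear_mult esym_eq_coeff[symmetric]
    by simp
  show "sym_curvature (Suc (Suc r)) T = esym (Suc (Suc r)) ds + a * esym (Suc r) ds -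
      (\<Sum>i<length ds. esym r (omit i ds) * (b i)\<^sup>2)"
    unfolding coeff q_def coeff_diff coeff_X2_mult coeff_linear_mult coeff_sum coeff_smult
      esym_eq_coeff[symmetric]
    by (simp add: mult.commute)
qed

text \<open>Only the identity and the transpositions of \<open>i0\<close> contribute to the Leibniz formula.\<close>

lemma det_bordered_diagonal:
  fixes R :: "'b::comm_ring_1^'n::finite^'n"
  assumes R: "\<And>i j. i \<noteq> i0 \<Longrightarrow> j \<noteq> i0 \<Longrightarrow> i \<noteq> j \<Longrightarrow> R $ i $ j = 0"
  shows "det R = R $ i0 $ i0 * (\<Prod>i\<in>UNIV - {i0}. R $ i $ i) -
    (\<Sum>k\<in>UNIV - {i0}. R $ k $ i0 * R $ i0 $ k * (\<Prod>i\<in>UNIV - {i0, k}. R $ i $ i))"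
proof -
  let ?t = "\<lambda>p. of_int (sign p) * (\<Prod>i\<in>UNIV. R $ i $ p i)"
  let ?X = "(\<lambda>k. Transposition.transpose i0 k) ` UNIV"
  have X: "p \<in> ?X" if p: "p permutes UNIV" and nz: "?t p \<noteq> 0" for p
  proof -
    have inj: "inj p" using p by (rule permutes_inj)
    have nz': "R $ i $ p i \<noteq> 0" for i
    proof
      assume "R $ i $ p i = 0"
      then have "(\<Prod>i\<in>UNIV. R $ i $ p i) = 0"
        by (subst prod.remove[of UNIV i]) simp_all
      then show False using nz by simp
    qed
    \<comment> \<open>Off the diagonal only row and column \<open>i0\<close> can be nonzero, so a
      contributing permutation fixes every other index or sends it to \<open>i0\<close>. By
      injectivity only \<open>p i0\<close> can be sent there.\<close>
    have cases: "p i = i \<or> p i = i0" if "i \<noteq> i0" for i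
      using R[of i "p i"] nz'[of i] that by metis
    have "p i = Transposition.transpose i0 (p i0) i" for i
    proof (cases "i = i0 \<or> i = p i0")
      case True
      then show ?thesis
        using cases[of "p i0"] inj by (metis injD transpose_apply_first transpose_apply_second)
    next
      case False
      obtain k where k: "p k = i0" using permutes_surj[OF p] by (metis surjD)
      have "p i \<noteq> i0"
      proof
        assume i: "p i = i0"
        have "p (p i0) = p i0 \<or> p (p i0) = i0" using cases[of "p i0"] by metis
        then show False using i False inj by (metis injD)
      qed
      then show ?thesis using cases[of i] False by simp
    qed
    then have "p = Transposition.transpose i0 (p i0)" by (rule ext)
    then show ?thesis by (rule range_eqI)
  qed
  have inj: "inj (\<lambda>k. Transposition.transpose i0 k)"
    by (metis injI transpose_apply_first)
  have "det R = (\<Sum>p\<in>?X. ?t p)"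
    unfolding det_def using X
    by (intro sum.mono_neutral_right) (auto intro: permutes_swap_id)
  also have "\<dots> = (\<Sum>k\<in>UNIV. ?t (Transposition.transpose i0 k))"
    by (subst sum.reindex[OF inj]) simp
  \<comment> \<open>The value \<open>k = i0\<close> gives the identity; all other transpositions
    have sign -1.\<close>
  also have "\<dots> = ?t id + (\<Sum>k\<in>UNIV - {i0}. ?t (Transposition.transpose i0 k))"
    by (subst sum.remove[of UNIV i0]) simp_all
  also have "?t id = R $ i0 $ i0 * (\<Prod>i\<in>UNIV - {i0}. R $ i $ i)"
    by (subst prod.remove[of UNIV i0]) (simp_all add: sign_id)
  also have "?t (Transposition.transpose i0 k) = - (R $ k $ i0 * R $ i0 $ k * (\<Prod>i\<in>UNIV - {i0, k}. R $ i $ i))"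
    if "k \<in> UNIV - {i0}" for k
  proof -
    have "(\<Prod>i\<in>UNIV. R $ i $ Transposition.transpose i0 k i) = R $ i0 $ k * (R $ k $ i0 *
       (\<Prod>i\<in>UNIV - {i0} - {k}. R $ i $ Transposition.transpose i0 k i))"
      using that by (subst prod.remove[of UNIV i0], simp, simp, subst prod.remove[of _ k]) auto
    also have "(\<Prod>i\<in>UNIV - {i0} - {k}. R $ i $ Transposition.transpose i0 k i) = (\<Prod>i\<in>UNIV - {i0, k}. R $ i $ i)"
      by (rule prod.cong) auto
    finally show ?thesis using that by (simp add: sign_swap_id mult_ac)
  qed
  then have "(\<Sum>k\<in>UNIV - {i0}. ?t (Transposition.transpose i0 k)) =
      (\<Sum>k\<in>UNIV - {i0}. - (R $ k $ i0 * R $ i0 $ k * (\<Prod>i\<in>UNIV - {i0, k}. R $ i $ i)))"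
    by (rule sum.cong[OF refl])
  finally show ?thesis by (simp add: sum_negf)
qed

section \<open>Gram determinants and the characteristic polynomial in an orthonormal basis\<close>

lemma bilinear_expand_axis:
  fixes B :: "real^'n::finite \<Rightarrow> real^'n \<Rightarrow> real"
  assumes "bilinear B"
  shows "B u v = (\<Sum>i\<in>UNIV. \<Sum>j\<in>UNIV. u $ i * v $ j * B (axis i 1) (axis j 1))"
proof -
  have "B u v = B (\<Sum>i\<in>UNIV. u $ i *\<^sub>R axis i 1) (\<Sum>j\<in>UNIV. v $ j *\<^sub>R axis j 1)"
    by (simp add: basis_expansion flip: scalar_mult_eq_scaleR)
  also have "\<dots> = (\<Sum>i\<in>UNIV. \<Sum>j\<in>UNIV. B (u $ i *\<^sub>R axis i 1) (v $ j *\<^sub>R axis j 1))"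
    by (simp add: bilinear_sum[OF assms] sum.cartesian_product)
  finally show ?thesis
    by (simp add: bilinear_lmul[OF assms] bilinear_rmul[OF assms] mult_ac)
qed

text \<open>The matrix on the left is the product of the matrix with rows \<open>u i\<close>, the
  Gram matrix of the standard basis, and the transpose of the matrix with rows
  \<open>w j\<close>.\<close>

lemma det_bilinear:
  fixes B :: "real^'n::finite \<Rightarrow> real^'n \<Rightarrow> real"
  assumes "bilinear B"
  shows "det (\<chi> i j. B (u i) (w j)) =
    det (\<chi> i. u i) * det (\<chi> i j. B (axis i 1) (axis j 1)) * det (\<chi> i. w i)"
proof -
  have "(\<chi> i j. B (u i) (w j)) =
    (\<chi> i. u i) ** (\<chi> i j. B (axis i 1) (axis j 1)) ** Finite_Cartesian_Product.transpose (\<chi> i. w i)"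
    by (simp add: vec_eq_iff matrix_matrix_mult_def Finite_Cartesian_Product.transpose_def
        bilinear_expand_axis[OF assms, of "u _"] sum_distrib_right sum_distrib_left mult_ac)
       (subst sum.swap, simp)
  then show ?thesis by (simp add: det_mul)
qed

lemma det_linear_image:
  fixes f :: "real^'n::finite \<Rightarrow> real^'n"
  assumes "linear f"
  shows "det (\<chi> i. f (w i)) = det (matrix f) * det (\<chi> i. w i)"
proof -
  have "(\<chi> i. f (w i)) = (\<chi> i. w i) ** Finite_Cartesian_Product.transpose (matrix f)"
  proof -
    have "f (w i) $ j = (matrix f *v w i) $ j" for i j
      by (simp add: assms)
    then show ?thesis
      by (simp add: vec_eq_iff matrix_matrix_mult_def Finite_Cartesian_Product.transpose_def
        matrix_vector_mult_def mult_ac)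
  qed
  then show ?thesis by (simp add: det_mul)
qed

lemma det_orthonormal_squared:
  fixes B :: "real^'n::finite \<Rightarrow> real^'n \<Rightarrow> real" and w :: "'n \<Rightarrow> real^'n"
  assumes B: "bilinear B" and w: "\<And>i j. B (w i) (w j) = (if i = j then 1 else (0::real))"
  shows "det (\<chi> i j. B (axis i 1) (axis j 1)) * (det (\<chi> i. w i))\<^sup>2 = 1"
proof -
  have "(\<chi> i j. B (w i) (w j)) = mat 1"
    by (simp add: vec_eq_iff mat_def w)
  then have "det (\<chi> i j. B (w i) (w j)) = 1" by simp
  then show ?thesis
    unfolding det_bilinear[OF B, of w w] by (simp add: power2_eq_square mult_ac)
qed

text \<open>Passing to the basis \<open>w\<close> multiplies the determinant by the Gram determinant
  times the square of \<open>det (\<chi> i. w i)\<close>, and for an orthonormal \<open>w\<close>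
  this factor is 1.\<close>

lemma det_operator_orthonormal:
  fixes B :: "real^'n::finite \<Rightarrow> real^'n \<Rightarrow> real" and w :: "'n \<Rightarrow> real^'n"
  assumes B: "bilinear B" and w: "\<And>i j. B (w i) (w j) = (if i = j then 1 else (0::real))"
    and f: "linear f"
  shows "det (matrix f) = det (\<chi> i j. B (f (w i)) (w j))"
  using det_orthonormal_squared[of B w, OF B w]
  by (simp add: det_bilinear[OF B, of "\<lambda>i. f (w i)" w] det_linear_image[OF f] power2_eq_square mult_ac)

lemma charpoly_bordered_diagonal:
  fixes T :: "real^'n::finite \<Rightarrow> real^'n" and B :: "real^'n \<Rightarrow> real^'n \<Rightarrow> real"
    and es :: "(real^'n) list" and ds :: "real list" and b :: "nat \<Rightarrow> real"
  assumes B: "bilinear B" and T: "linear T"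
    and dim: "CARD('n) = Suc (length es)" and len: "length ds = length es"
    and on: "\<And>i j. i \<le> length es \<Longrightarrow> j \<le> length es \<Longrightarrow>
      B ((es @ [\<nu>]) ! i) ((es @ [\<nu>]) ! j) = (if i = j then 1 else 0)"
    and Te: "\<And>i. i < length es \<Longrightarrow> T (es ! i) = ds ! i *\<^sub>R es ! i + b i *\<^sub>R \<nu>"
    and T\<nu>: "T \<nu> = a *\<^sub>R \<nu> + (\<Sum>i<length es. b i *\<^sub>R es ! i)"
  shows "det (matrix (\<lambda>v. t *\<^sub>R v - T v)) =
      (t - a) * (\<Prod>i<length ds. t - ds ! i) -
      (\<Sum>i<length ds. (b i)\<^sup>2 * (\<Prod>j\<in>{..<length ds} - {i}. t - ds ! j))"
proof -
  let ?m = "length es"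
  \<comment> \<open>The index type carries no order, so the list \<open>es @ [\<nu>]\<close> is
    distributed over it by an enumeration; \<open>i0\<close> is the index that receives
    \<nu>.\<close>
  define idx where "idx = to_nat_on (UNIV :: 'n set)"
  have bij: "bij_betw idx UNIV {..<Suc ?m}"
    using to_nat_on_finite[of "UNIV :: 'n set"] by (simp add: idx_def dim)
  then obtain i0 where i0: "idx i0 = ?m"
    by (metis UNIV_I bij_betw_iff_bijections lessI lessThan_iff)
  have inj: "idx i = idx j \<longleftrightarrow> i = j" for i j
    using bij by (auto simp: bij_betw_def inj_on_def)
  have bij': "bij_betw idx (UNIV - {i0}) {..<?m}"
    using bij_betw_DiffI[OF bij, of "{i0}" "{?m}"] i0
    by (simp add: lessThan_Suc insert_Diff_if bij_betw_def)
  have lt: "idx i < ?m" if "i \<noteq> i0" for i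
    using bij' that by (auto simp: bij_betw_def)
  have le: "idx i \<le> ?m" for i
    using bij by (auto simp: bij_betw_def less_Suc_eq_le)
  let ?f = "\<lambda>v. t *\<^sub>R v - T v"
  define w where "w i = (es @ [\<nu>]) ! idx i" for i
  have w: "B (w i) (w j) = (if i = j then 1 else 0)" for i j
    unfolding w_def using on[OF le le, of i j] inj by simp
  have w0: "w i0 = \<nu>" by (simp add: w_def i0)
  have we: "w i = es ! idx i" if "i \<noteq> i0" for i
    using lt[OF that] by (simp add: w_def nth_append)
  note bil = bilinear_ladd[OF B] bilinear_lmul[OF B] bilinear_lsub[OF B]
  define R where "R = (\<chi> i j. B (?f (w i)) (w j))"
  have R1: "R $ i $ j = (if i = j then t - ds ! idx i else 0)" if "i \<noteq> i0" "j \<noteq> i0" for i j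
    using that w[of i j] w[of i0 j] by (simp add: R_def we w0 Te lt bil)
  have R2: "R $ i $ i0 = - b (idx i)" if "i \<noteq> i0" for i
    using that w[of i i0] w[of i0 i0] by (simp add: R_def we w0 Te lt bil)
  have B\<nu>: "B (\<Sum>i<?m. b i *\<^sub>R es ! i) (w j) = (\<Sum>i<?m. b i * B (es ! i) (w j))" for j
  proof -
    interpret linear "\<lambda>u. B u (w j)" using B by (simp add: bilinear_def)
    show ?thesis by (simp add: sum scale)
  qed
  have R3: "R $ i0 $ j = - b (idx j)" if "j \<noteq> i0" for j
  proof -
    have "B (es ! i) (w j) = (if i = idx j then 1 else 0)" if "i < ?m" for i
      using on[of i "idx j"] that lt[OF \<open>j \<noteq> i0\<close>] we[OF \<open>j \<noteq> i0\<close>] by (simp add: nth_append)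
    then have "(\<Sum>i<?m. b i * B (es ! i) (w j)) = (\<Sum>i<?m. if i = idx j then b i else 0)"
      by (intro sum.cong) auto
    then show ?thesis
      using that w[of i0 j] lt[OF that] by (simp add: R_def w0 T\<nu> bil B\<nu>)
  qed
  have R4: "R $ i0 $ i0 = t - a"
  proof -
    have "B (es ! i) \<nu> = 0" if "i < ?m" for i
      using on[of i ?m] that by (simp add: nth_append)
    then show ?thesis
      using w[of i0 i0] B\<nu>[of i0] by (simp add: R_def w0 T\<nu> bil)
  qed
  have lin: "linear ?f"
    using T by (intro linear_compose_sub) (auto intro: linear_scaleR)
  have "det (matrix ?f) = det R"
    unfolding R_def by (rule det_operator_orthonormal[OF B w lin])
  also have "\<dots> = R $ i0 $ i0 * (\<Prod>i\<in>UNIV - {i0}. R $ i $ i) -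
    (\<Sum>k\<in>UNIV - {i0}. R $ k $ i0 * R $ i0 $ k * (\<Prod>i\<in>UNIV - {i0, k}. R $ i $ i))"
    using R1 by (intro det_bordered_diagonal) simp
  also have "\<dots> = (t - a) * (\<Prod>i\<in>UNIV - {i0}. t - ds ! idx i) -
    (\<Sum>k\<in>UNIV - {i0}. (b (idx k))\<^sup>2 * (\<Prod>i\<in>UNIV - {i0, k}. t - ds ! idx i))"
    by (simp add: R1 R2 R3 R4 power2_eq_square)
  also have "(\<Prod>i\<in>UNIV - {i0}. t - ds ! idx i) = (\<Prod>i<?m. t - ds ! i)"
    by (rule prod.reindex_bij_betw[OF bij'])
  also have "(\<Sum>k\<in>UNIV - {i0}. (b (idx k))\<^sup>2 * (\<Prod>i\<in>UNIV - {i0, k}. t - ds ! idx i)) =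
    (\<Sum>k\<in>UNIV - {i0}. (b (idx k))\<^sup>2 * (\<Prod>i\<in>{..<?m} - {idx k}. t - ds ! i))"
  proof (rule sum.cong[OF refl])
    fix k assume k: "k \<in> UNIV - {i0}"
    have "bij_betw idx (UNIV - {i0} - {k}) ({..<?m} - {idx k})"
      using bij_betw_DiffI[OF bij', of "{k}" "{idx k}"] k lt[of k] by (simp add: bij_betw_def)
    moreover have "UNIV - {i0} - {k} = UNIV - {i0, k}" by auto
    ultimately have "bij_betw idx (UNIV - {i0, k}) ({..<?m} - {idx k})" by simp
    then show "(b (idx k))\<^sup>2 * (\<Prod>i\<in>UNIV - {i0, k}. t - ds ! idx i) =
        (b (idx k))\<^sup>2 * (\<Prod>i\<in>{..<?m} - {idx k}. t - ds ! i)"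
      using prod.reindex_bij_betw[of idx "UNIV - {i0, k}" _ "\<lambda>i. t - ds ! i"] by metis
  qed
  also have "\<dots> = (\<Sum>k<?m. (b k)\<^sup>2 * (\<Prod>i\<in>{..<?m} - {k}. t - ds ! i))"
    by (rule sum.reindex_bij_betw[OF bij'])
  finally show ?thesis by (simp add: len)
qed

section \<open>Newton transformations of a bordered diagonal operator\<close>

text \<open>In \<open>S \<nu> - T (newton (Suc r) T \<nu>)\<close> the \<nu>-component of the second
  term cancels the parts of \<open>S\<close> that contain \<open>a\<close> and the squares of the
  \<open>b i\<close>. The component along \<open>es ! i\<close> is simplified by
  \<open>esym_Suc_omit\<close>.\<close>

lemma newton_bordered_diagonal:
  fixes T :: "real^'n::finite \<Rightarrow> real^'n" and es :: "(real^'n) list"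
  assumes T: "linear T" and len: "length ds = length es"
    and S1: "sym_curvature (Suc 0) T = esym 1 ds + a"
    and S: "\<And>r. sym_curvature (Suc (Suc r)) T = esym (Suc (Suc r)) ds + a * esym (Suc r) ds -
      (\<Sum>i<length ds. esym r (omit i ds) * (b i)\<^sup>2)"
    and Te: "\<And>i. i < length es \<Longrightarrow> T (es ! i) = ds ! i *\<^sub>R es ! i + b i *\<^sub>R \<nu>"
    and T\<nu>: "T \<nu> = a *\<^sub>R \<nu> + (\<Sum>i<length es. b i *\<^sub>R es ! i)"
  shows "newton (Suc r) T \<nu> =
    esym (Suc r) ds *\<^sub>R \<nu> - (\<Sum>i<length es. (b i * esym r (omit i ds)) *\<^sub>R es ! i)"
proof (induction r)
  case 0
  show ?case by (simp add: S1 T\<nu> algebra_simps)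
next
  case (Suc r)
  let ?e = "\<lambda>i. esym r (omit i ds)"
  have lin: "T (\<Sum>i<length es. (b i * ?e i) *\<^sub>R es ! i) =
      (\<Sum>i<length es. (b i * ?e i) *\<^sub>R (ds ! i *\<^sub>R es ! i + b i *\<^sub>R \<nu>))"
    by (simp add: linear_sum[OF T] linear_scale[OF T] Te)
  also have "\<dots> = (\<Sum>i<length es. (b i * (ds ! i * ?e i)) *\<^sub>R es ! i) +
      (\<Sum>i<length es. ?e i * (b i)\<^sup>2) *\<^sub>R \<nu>"
    by (simp add: scaleR_add_right sum.distrib scaleR_sum_left power2_eq_square mult_ac)
  finally have lin: "T (\<Sum>i<length es. (b i * ?e i) *\<^sub>R es ! i) =
    (\<Sum>i<length es. (b i * (ds ! i * ?e i)) *\<^sub>R es ! i) +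
      (\<Sum>i<length es. ?e i * (b i)\<^sup>2) *\<^sub>R \<nu>" .
  have om: "esym (Suc r) ds = esym (Suc r) (omit i ds) + ds ! i * ?e i" if "i < length es" for i
    using esym_Suc_omit[of i ds r] that len by simp
  have "(\<Sum>i<length es. (b i * esym (Suc r) (omit i ds)) *\<^sub>R es ! i) =
      (\<Sum>i<length es. (b i * (esym (Suc r) ds - ds ! i * ?e i)) *\<^sub>R es ! i)"
    by (intro sum.cong) (auto simp: om)
  also have "\<dots> = esym (Suc r) ds *\<^sub>R (\<Sum>i<length es. b i *\<^sub>R es ! i) -
      (\<Sum>i<length es. (b i * (ds ! i * ?e i)) *\<^sub>R es ! i)"
    by (simp add: scaleR_sum_right sum_subtractf algebra_simps)
  finally have *: "(\<Sum>i<length es. (b i * (ds ! i * ?e i)) *\<^sub>R es ! i) =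
     esym (Suc r) ds *\<^sub>R (\<Sum>i<length es. b i *\<^sub>R es ! i) -
     (\<Sum>i<length es. (b i * esym (Suc r) (omit i ds)) *\<^sub>R es ! i)"
    by (simp add: algebra_simps)
  have "newton (Suc (Suc r)) T \<nu> =
      sym_curvature (Suc (Suc r)) T *\<^sub>R \<nu> - T (newton (Suc r) T \<nu>)"
    by simp
  also have "\<dots> = sym_curvature (Suc (Suc r)) T *\<^sub>R \<nu> - (esym (Suc r) ds *\<^sub>R T \<nu> -
      ((\<Sum>i<length es. (b i * (ds ! i * ?e i)) *\<^sub>R es ! i) +
      (\<Sum>i<length es. ?e i * (b i)\<^sup>2) *\<^sub>R \<nu>))"
    unfolding Suc linear_diff[OF T] linear_scale[OF T] lin ..
  also have "\<dots> = esym (Suc (Suc r)) ds *\<^sub>R \<nu> -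
      (\<Sum>i<length es. (b i * esym (Suc r) (omit i ds)) *\<^sub>R es ! i)"
    unfolding S * T\<nu> by (simp add: len algebra_simps)
  finally show ?case .
qed

text \<open>The interface to the geometry: the shape operator enters only through its bordered form
  in an orthonormal basis. In the last claim the pairing with \<nu> removes the components along
  \<open>es\<close>.\<close>

lemma bordered_diagonal_curvatures:
  fixes T :: "real^'n::finite \<Rightarrow> real^'n" and B :: "real^'n \<Rightarrow> real^'n \<Rightarrow> real"
    and es :: "(real^'n) list" and ds :: "real list" and b :: "nat \<Rightarrow> real"
  assumes B: "bilinear B" and T: "linear T"
    and dim: "CARD('n) = Suc (length es)" and len: "length ds = length es"
    and on: "\<And>i j. i \<le> length es \<Longrightarrow> j \<le> length es \<Longrightarrow>
      B ((es @ [\<nu>]) ! i) ((es @ [\<nu>]) ! j) = (if i = j then 1 else 0)"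
    and Te: "\<And>i. i < length es \<Longrightarrow> T (es ! i) = ds ! i *\<^sub>R es ! i + b i *\<^sub>R \<nu>"
    and T\<nu>: "T \<nu> = a *\<^sub>R \<nu> + (\<Sum>i<length es. b i *\<^sub>R es ! i)"
  shows "sym_curvature (Suc 0) T = esym 1 ds + a"
    and "sym_curvature (Suc (Suc r)) T = esym (Suc (Suc r)) ds + a * esym (Suc r) ds -
      (\<Sum>i<length ds. esym r (omit i ds) * (b i)\<^sup>2)"
    and "B (newton (Suc r) T \<nu>) \<nu> = esym (Suc r) ds"
proof -
  have dim': "CARD('n) = Suc (length ds)" using dim len by simp
  note det = charpoly_bordered_diagonal[where b = b, OF B T dim len on Te T\<nu>]
  note S = sym_curvature_bordered_diagonal[where b = b, OF dim' det]
  show "sym_curvature (Suc 0) T = esym 1 ds + a" by (rule S(1))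
  show "sym_curvature (Suc (Suc r)) T = esym (Suc (Suc r)) ds + a * esym (Suc r) ds -
      (\<Sum>i<length ds. esym r (omit i ds) * (b i)\<^sup>2)"
    by (rule S(2))
  interpret linear "\<lambda>u. B u \<nu>" using B by (simp add: bilinear_def)
  have "B (es ! i) \<nu> = 0" if "i < length es" for i
    using on[of i "length es"] that by (simp add: nth_append)
  moreover have "B \<nu> \<nu> = 1" using on[of "length es" "length es"] by simp
  moreover have "newton (Suc r) T \<nu> =
      esym (Suc r) ds *\<^sub>R \<nu> - (\<Sum>i<length es. (b i * esym r (omit i ds)) *\<^sub>R es ! i)"
    using newton_bordered_diagonal[where b = b, OF T len S Te T\<nu>] .
  ultimately show "B (newton (Suc r) T \<nu>) \<nu> = esym (Suc r) ds"
    by (simp add: diff scale sum del: newton.simps)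
qed

section \<open>Calculus on half spaces\<close>

text \<open>This condition makes derivatives within relatively open subsets of \<open>H\<close> unique, also at
  the boundary points of \<open>half_space\<close>.\<close>

definition model :: "'a::euclidean_space set \<Rightarrow> bool" where
  "model H \<longleftrightarrow> (\<forall>x\<in>H. \<forall>i\<in>Basis. \<forall>d>0. x + d *\<^sub>R i \<in> H)"

lemma model_UNIV: "model UNIV"
  by (simp add: model_def)

lemma model_half_space: "model (half_space :: (real^'n::finite) set)"
  by (auto simp: model_def half_space_def Basis_vec_def axis_def)

text \<open>From a point of \<open>S\<close> arbitrarily short steps in each positive coordinate
  direction remain in \<open>S\<close>, and difference quotients along them determine a derivative
  on the basis vectors.\<close>

lemma has_derivative_unique_model:
  fixes f :: "'a::euclidean_space \<Rightarrow> 'b::real_normed_vector"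
  assumes H: "model H" and S: "openin (top_of_set H) S" "x \<in> S"
    and "(f has_derivative f') (at x within S)" "(f has_derivative f'') (at x within S)"
  shows "f' = f''"
proof (rule frechet_derivative_unique_within[OF assms(4,5)])
  fix i :: 'a and e :: real assume i: "i \<in> Basis" and e: "0 < e"
  obtain r where r: "r > 0" "ball x r \<inter> H \<subseteq> S"
    using S by (meson openin_contains_ball)
  have "x \<in> H" using S openin_imp_subset by blast
  define d where "d = min e r / 2"
  have d: "0 < d" "d < e" "d < r" using e r by (auto simp: d_def)
  have "x + d *\<^sub>R i \<in> H" using H \<open>x \<in> H\<close> i d by (auto simp: model_def)
  moreover have "x + d *\<^sub>R i \<in> ball x r" using i d by (simp add: dist_norm)
  ultimately show "\<exists>d. 0 < \<bar>d\<bar> \<and> \<bar>d\<bar> < e \<and> x + d *\<^sub>R i \<in> S"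
    using r d by (intro exI[of _ d]) auto
qed

section \<open>Calculus of k times differentiable maps\<close>

lemma Ck_on_subset: "Ck_on k V f \<Longrightarrow> U \<subseteq> V \<Longrightarrow> Ck_on k U f"
proof (induction k arbitrary: f)
  case (Suc k)
  then show ?case by (simp, meson subsetD)
qed (auto intro: continuous_on_subset)

lemma Ck_on_Suc_imp: "Ck_on (Suc k) U f \<Longrightarrow> Ck_on k U f"
proof (induction k arbitrary: f)
  case 0
  then obtain f' where "\<forall>x\<in>U. (f has_derivative f' x) (at x)" by auto
  then have "\<And>x. x \<in> U \<Longrightarrow> isCont f x"
    by (meson has_derivative_continuous)
  then show ?case by (simp add: continuous_at_imp_continuous_on)
next
  case (Suc k)
  then obtain f' where f': "\<forall>x\<in>U. (f has_derivative f' x) (at x)" "\<forall>v. Ck_on (Suc k) U (\<lambda>x. f' x v)"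
    unfolding Ck_on.simps(2)[of "Suc k"] by blast
  then show ?case using Suc.IH by auto
qed

lemma Ck_on_cong:
  assumes "open U" "\<And>x. x \<in> U \<Longrightarrow> f x = g x" "Ck_on k U f"
  shows "Ck_on k U g"
proof (cases k)
  case 0
  then show ?thesis using assms by (simp cong: continuous_on_cong)
next
  case (Suc m)
  then obtain f' where f': "\<forall>x\<in>U. (f has_derivative f' x) (at x)" "\<forall>v. Ck_on m U (\<lambda>x. f' x v)"
    using assms by auto
  have "(g has_derivative f' x) (at x)" if "x \<in> U" for x
    using has_derivative_transform_within_open[of f "f' x" x UNIV U g] f' assms that by auto
  then show ?thesis using f' Suc by auto
qed

lemma Ck_on_const: "Ck_on k U (\<lambda>x. c)"
proof (induction k arbitrary: c)
  case (Suc k)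
  then show ?case by (auto intro!: exI[of _ "\<lambda>x v. 0"])
qed simp

lemma Ck_on_add: "Ck_on k U f \<Longrightarrow> Ck_on k U g \<Longrightarrow> Ck_on k U (\<lambda>x. f x + g x)"
proof (induction k arbitrary: f g)
  case (Suc k)
  then obtain f' g' where "\<forall>x\<in>U. (f has_derivative f' x) (at x)" "\<forall>v. Ck_on k U (\<lambda>x. f' x v)"
    "\<forall>x\<in>U. (g has_derivative g' x) (at x)" "\<forall>v. Ck_on k U (\<lambda>x. g' x v)"
    by auto
  then show ?case
    using Suc.IH by (auto intro!: exI[of _ "\<lambda>x v. f' x v + g' x v"] has_derivative_add)
qed (auto intro: continuous_on_add)

lemma Ck_on_sum: "(\<And>i. i \<in> I \<Longrightarrow> Ck_on k U (f i)) \<Longrightarrow> Ck_on k U (\<lambda>x. \<Sum>i\<in>I. f i x)"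
  by (induction I rule: infinite_finite_induct) (simp_all add: Ck_on_const Ck_on_add del: Ck_on.simps)

lemma Ck_on_scaleR: "Ck_on k U f \<Longrightarrow> Ck_on k U g \<Longrightarrow> Ck_on k U (\<lambda>x. f x *\<^sub>R g x)"
proof (induction k arbitrary: f g)
  case (Suc k)
  then obtain f' g' where *: "\<forall>x\<in>U. (f has_derivative f' x) (at x)" "\<forall>v. Ck_on k U (\<lambda>x. f' x v)"
    "\<forall>x\<in>U. (g has_derivative g' x) (at x)" "\<forall>v. Ck_on k U (\<lambda>x. g' x v)"
    by auto
  have "Ck_on k U (\<lambda>x. f x *\<^sub>R g' x v + f' x v *\<^sub>R g x)" for v
    using Suc.prems * by (intro Ck_on_add Suc.IH Ck_on_Suc_imp[of k U f] Ck_on_Suc_imp[of k U g]) auto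
  then show ?case
    using * by (auto intro!: exI[of _ "\<lambda>x v. f x *\<^sub>R g' x v + f' x v *\<^sub>R g x"] has_derivative_scaleR)
qed (auto intro: continuous_on_scaleR)

lemma Ck_on_inner_const:
  fixes f :: "'a::real_normed_vector \<Rightarrow> 'b::real_inner"
  shows "Ck_on k U f \<Longrightarrow> Ck_on k U (\<lambda>x. f x \<bullet> c)"
proof (induction k arbitrary: f)
  case (Suc k)
  then obtain f' where *: "\<forall>x\<in>U. (f has_derivative f' x) (at x)" "\<forall>v. Ck_on k U (\<lambda>x. f' x v)"
    by auto
  then show ?case
    using Suc.IH by (auto intro!: exI[of _ "\<lambda>x v. f' x v \<bullet> c"] has_derivative_inner_left)
qed (auto intro: continuous_intros)

text \<open>\<open>Ck_on\<close> controls the derivative of \<open>h\<close> only in constant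
  directions. The derivative of the composite is therefore expanded in the basis, which makes it a
  sum of products of maps covered by the induction hypothesis.\<close>

lemma Ck_on_compose:
  fixes x :: "'c::real_normed_vector \<Rightarrow> 'a::euclidean_space" and h :: "'a \<Rightarrow> 'b::real_normed_vector"
  assumes "x ` I \<subseteq> U" "Ck_on k I x" "Ck_on k U h"
  shows "Ck_on k I (\<lambda>t. h (x t))"
  using assms
proof (induction k arbitrary: h)
  case 0
  then show ?case by (auto intro: continuous_on_compose2)
next
  case (Suc k)
  then obtain x' h' where *: "\<forall>t\<in>I. (x has_derivative x' t) (at t)" "\<forall>v. Ck_on k I (\<lambda>t. x' t v)"
    "\<forall>y\<in>U. (h has_derivative h' y) (at y)" "\<forall>v. Ck_on k U (\<lambda>y. h' y v)"
    by auto
  have eq: "(\<Sum>b\<in>Basis. (x' t s \<bullet> b) *\<^sub>R h' (x t) b) = h' (x t) (x' t s)" if "t \<in> I" for t s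
  proof -
    interpret bounded_linear "h' (x t)"
      using *(3) that Suc.prems(1) by (intro has_derivative_bounded_linear) auto
    show ?thesis
      using euclidean_representation[of "x' t s"] by (metis (no_types, lifting) scale sum sum.cong)
  qed
  have "Ck_on k I (\<lambda>t. \<Sum>b\<in>Basis. (x' t s \<bullet> b) *\<^sub>R h' (x t) b)" for s
    using Suc.prems * by (intro Ck_on_sum Ck_on_scaleR Ck_on_inner_const Suc.IH Ck_on_Suc_imp[of k I x]) auto
  moreover have "((\<lambda>t. h (x t)) has_derivative (\<lambda>s. \<Sum>b\<in>Basis. (x' t s \<bullet> b) *\<^sub>R h' (x t) b)) (at t)"
    if "t \<in> I" for t
    unfolding eq[OF that] using * Suc.prems(1) that
    by (intro has_derivative_compose[of x "x' t" t UNIV h "h' (x t)"]) auto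
  ultimately show ?case
    by (auto intro!: exI[of _ "\<lambda>t s. \<Sum>b\<in>Basis. (x' t s \<bullet> b) *\<^sub>R h' (x t) b"])
qed

lemma Ck_on_line: "Ck_on k U (\<lambda>t::real. a + t *\<^sub>R b)"
proof (cases k)
  case 0
  then show ?thesis by (auto intro!: continuous_intros)
next
  case (Suc m)
  then show ?thesis
    by (auto intro!: exI[of _ "\<lambda>x v. v *\<^sub>R b"] Ck_on_const derivative_eq_intros)
qed

lemma smooth_onD:
  assumes "smooth_on S f" "x \<in> S"
  obtains U h where "open U" "x \<in> U" "\<And>k. Ck_on k U h" "\<And>y. y \<in> S \<Longrightarrow> y \<in> U \<Longrightarrow> h y = f y"
proof -
  have "\<exists>U h. open U \<and> x \<in> U \<and> (\<forall>k. Ck_on k U h) \<and> (\<forall>y\<in>S \<inter> U. h y = f y)"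
    using assms unfolding smooth_on_def by (rule bspec)
  then show thesis using that by (metis IntI)
qed

text \<open>Fixes the convention for second derivatives: in \<open>h'' y u v\<close> the direction
  \<open>u\<close> belongs to the first differentiation and \<open>v\<close> to the second.\<close>

lemma smooth_on_C2:
  assumes "smooth_on S f" "x \<in> S"
  obtains U h h' h'' where "open U" "x \<in> U" "\<And>y. y \<in> S \<Longrightarrow> y \<in> U \<Longrightarrow> h y = f y"
    "\<And>y. y \<in> U \<Longrightarrow> (h has_derivative h' y) (at y)"
    "\<And>y u. y \<in> U \<Longrightarrow> ((\<lambda>y. h' y u) has_derivative h'' y u) (at y)"
proof -
  obtain U h where U: "open U" "x \<in> U" "\<And>k. Ck_on k U h" "\<And>y. y \<in> S \<Longrightarrow> y \<in> U \<Longrightarrow> h y = f y"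
    by (rule smooth_onD[OF assms]) blast
  from U(3)[of "Suc (Suc 0)"] obtain h' where h': "\<forall>y\<in>U. (h has_derivative h' y) (at y)"
    "\<forall>u. \<exists>f'. \<forall>y\<in>U. ((\<lambda>y. h' y u) has_derivative f' y) (at y)"
    by simp blast
  then obtain h'' where "\<forall>u. \<forall>y\<in>U. ((\<lambda>y. h' y u) has_derivative h'' u y) (at y)"
    by metis
  then show thesis using that[of U h h' "\<lambda>y u. h'' u y"] U h' by auto
qed

lemma smooth_on_differentiable:
  assumes "smooth_on S f" "x \<in> S"
  shows "f differentiable (at x within S)"
proof -
  obtain U h h' where U: "open U" "x \<in> U" "\<And>y. y \<in> S \<Longrightarrow> y \<in> U \<Longrightarrow> h y = f y"
    "\<And>y. y \<in> U \<Longrightarrow> (h has_derivative h' y) (at y)"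
    using smooth_on_C2[OF assms] by metis
  have "(h has_derivative h' x) (at x within S)"
    using U by (auto intro: has_derivative_at_withinI)
  then have "(f has_derivative h' x) (at x within S)"
    by (rule has_derivative_transform_eventually)
       (use U assms in \<open>auto simp: eventually_at_topological\<close>)
  then show ?thesis by (auto simp: differentiable_def)
qed

section \<open>Symmetry of second derivatives\<close>

text \<open>The mean value theorem is applied to the increment in direction \<open>v\<close>,
  regarded as a function of the step \<open>p\<close> in direction \<open>u\<close>. The two values
  of \<open>f' _ u\<close> that it produces are replaced by their expansions at \<open>x\<close>;
  their errors add up to the multiple of \<open>2 * norm u + norm v\<close>.\<close>

lemma second_difference_bound:
  fixes f :: "'a::real_normed_vector \<Rightarrow> real"
  assumes U: "open U" "x \<in> U" and f': "\<And>y. y \<in> U \<Longrightarrow> (f has_derivative f' y) (at y)"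
    and D: "((\<lambda>y. f' y u) has_derivative D) (at x)" and e: "e > 0"
  shows "\<exists>s0>0. \<forall>s. 0 < s \<and> s < s0 \<longrightarrow>
    \<bar>(f (x + s *\<^sub>R u + s *\<^sub>R v) - f (x + s *\<^sub>R u) - f (x + s *\<^sub>R v) + f x) - s\<^sup>2 * D v\<bar>
      \<le> e * s\<^sup>2 * (2 * norm u + norm v)"
proof -
  interpret bounded_linear D using D by (rule has_derivative_bounded_linear)
  obtain r where r: "r > 0" "ball x r \<subseteq> U" using U openE by blast
  obtain d where d: "d > 0" "\<And>y. norm (y - x) < d \<Longrightarrow>
      \<bar>f' y u - f' x u - D (y - x)\<bar> \<le> e * norm (y - x)"
    using D e unfolding has_derivative_at_alt by (metis real_norm_def)
  define m where "m = min r d"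
  \<comment> \<open>Keeps every point \<open>x + p u + q v\<close> with \<open>p\<close> and
    \<open>q\<close> between 0 and \<open>s\<close> inside \<open>U\<close> and within reach of the
    expansion of \<open>f' _ u\<close>. The summand 1 excludes a zero denominator.\<close>
  define s0 where "s0 = m / (norm u + norm v + 1)"
  have m: "m > 0" using r d by (simp add: m_def)
  have pos: "norm u + norm v + 1 > 0" by (smt (verit) norm_ge_zero)
  have s0: "s0 > 0" using m pos by (simp add: s0_def)
  have "\<bar>(f (x + s *\<^sub>R u + s *\<^sub>R v) - f (x + s *\<^sub>R u) - f (x + s *\<^sub>R v) + f x) - s\<^sup>2 * D v\<bar>
      \<le> e * s\<^sup>2 * (2 * norm u + norm v)" if s: "0 < s" "s < s0" for s
  proof -
    have sm: "s * (norm u + norm v + 1) < m" using s pos by (simp add: s0_def field_simps)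
    have small: "norm (p *\<^sub>R u + q *\<^sub>R v) < m" if "0 \<le> p" "p \<le> s" "0 \<le> q" "q \<le> s" for p q
    proof -
      have "norm (p *\<^sub>R u + q *\<^sub>R v) \<le> p * norm u + q * norm v"
        using norm_triangle_ineq[of "p *\<^sub>R u" "q *\<^sub>R v"] that by simp
      also have "\<dots> \<le> s * norm u + s * norm v"
        using that by (intro add_mono mult_right_mono) auto
      also have "\<dots> < m" using sm s by (simp add: algebra_simps)
      finally show ?thesis .
    qed
    have inU: "x + p *\<^sub>R u + q *\<^sub>R v \<in> U" if "0 \<le> p" "p \<le> s" "0 \<le> q" "q \<le> s" for p q
    proof -
      have "dist x (x + (p *\<^sub>R u + q *\<^sub>R v)) = norm (p *\<^sub>R u + q *\<^sub>R v)"
        by (simp only: dist_add_cancel dist_norm add_diff_cancel_left' norm_minus_commute[of x])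
      then show ?thesis
        using small[OF that] by (intro subsetD[OF r(2)]) (simp add: m_def add.assoc)
    qed
    let ?\<phi> = "\<lambda>p. f (x + p *\<^sub>R u + s *\<^sub>R v) - f (x + p *\<^sub>R u)"
    let ?\<phi>' = "\<lambda>p. f' (x + p *\<^sub>R u + s *\<^sub>R v) u - f' (x + p *\<^sub>R u) u"
    have "DERIV ?\<phi> p :> ?\<phi>' p" if p: "0 \<le> p" "p \<le> s" for p
    proof -
      have 1: "((\<lambda>p. f (x + p *\<^sub>R u + q *\<^sub>R v)) has_derivative (\<lambda>h. f' (x + p *\<^sub>R u + q *\<^sub>R v) (h *\<^sub>R u))) (at p)"
        if "0 \<le> q" "q \<le> s" for q
        by (rule has_derivative_compose[where g = f]) (use inU[OF p that] f' in \<open>auto intro!: derivative_eq_intros\<close>)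
      have 2: "f' (x + p *\<^sub>R u + q *\<^sub>R v) (h *\<^sub>R u) = h * f' (x + p *\<^sub>R u + q *\<^sub>R v) u"
        if "0 \<le> q" "q \<le> s" for q h
        using has_derivative_bounded_linear[OF f'[OF inU[OF p that]]]
        by (simp add: linear_scale bounded_linear.linear)
      have 3: "((\<lambda>p. f (x + p *\<^sub>R u + q *\<^sub>R v)) has_real_derivative f' (x + p *\<^sub>R u + q *\<^sub>R v) u) (at p)"
        if "0 \<le> q" "q \<le> s" for q
        unfolding has_field_derivative_def
        using 1[OF that] 2[OF that] by (simp add: mult.commute[of _ "f' _ u"])
      show ?thesis
        using DERIV_diff[OF 3[of s] 3[of 0]] s by simp
    qed
    then obtain p where p: "0 < p" "p < s" "?\<phi> s - ?\<phi> 0 = (s - 0) * ?\<phi>' p"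
      using MVT2[of 0 s ?\<phi> ?\<phi>'] s by blast
    have b1: "\<bar>f' (x + p *\<^sub>R u + s *\<^sub>R v) u - f' x u - D (p *\<^sub>R u + s *\<^sub>R v)\<bar> \<le> e * norm (p *\<^sub>R u + s *\<^sub>R v)"
      using d(2)[of "x + p *\<^sub>R u + s *\<^sub>R v"] small[of p s] p by (simp add: m_def add.assoc)
    have b2: "\<bar>f' (x + p *\<^sub>R u) u - f' x u - D (p *\<^sub>R u)\<bar> \<le> e * norm (p *\<^sub>R u)"
      using d(2)[of "x + p *\<^sub>R u"] small[of p 0] p by (simp add: m_def)
    have "\<bar>?\<phi>' p - s * D v\<bar> \<le> e * norm (p *\<^sub>R u + s *\<^sub>R v) + e * norm (p *\<^sub>R u)"
      using b1 b2 by (simp add: add scale)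
    also have "\<dots> \<le> e * (s * norm u + s * norm v) + e * (s * norm u)"
    proof -
      have "norm (p *\<^sub>R u) \<le> s * norm u" using p by (simp add: mult_right_mono)
      moreover have "norm (p *\<^sub>R u + s *\<^sub>R v) \<le> norm (p *\<^sub>R u) + s * norm v"
        using norm_triangle_ineq[of "p *\<^sub>R u" "s *\<^sub>R v"] s by simp
      ultimately show ?thesis using e by (intro add_mono mult_left_mono) auto
    qed
    finally have b: "\<bar>?\<phi>' p - s * D v\<bar> \<le> e * s * (2 * norm u + norm v)"
      by (simp add: algebra_simps)
    have "\<bar>(?\<phi> s - ?\<phi> 0) - s\<^sup>2 * D v\<bar> = s * \<bar>?\<phi>' p - s * D v\<bar>"
      unfolding p(3) using s
      by (simp add: power2_eq_square abs_mult_pos' right_diff_distrib mult.assoc)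
    also have "\<dots> \<le> s * (e * s * (2 * norm u + norm v))"
      using b s by (intro mult_left_mono) auto
    finally show ?thesis
      by (simp add: power2_eq_square algebra_simps)
  qed
  then show ?thesis using s0 by blast
qed

text \<open>The second difference does not change when \<open>u\<close> and \<open>v\<close> are
  exchanged, while to leading order it is both \<open>s^2\<close> times \<open>D u v\<close> and
  \<open>s^2\<close> times \<open>D v u\<close>.\<close>

lemma symmetric_second_derivative_real:
  fixes f :: "'a::real_normed_vector \<Rightarrow> real"
  assumes U: "open U" "x \<in> U" and f': "\<And>y. y \<in> U \<Longrightarrow> (f has_derivative f' y) (at y)"
    and D: "\<And>u. ((\<lambda>y. f' y u) has_derivative D u) (at x)"
  shows "D u v = D v u"
proof (rule ccontr)
  assume "D u v \<noteq> D v u"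
  define K where "K = 3 * norm u + 3 * norm v + 1"
  \<comment> \<open>The two errors amount to \<open>e * (K - 1)\<close> after division by
    \<open>s^2\<close>, which is less than \<open>e * (2 * K)\<close>, the gap between
    \<open>D u v\<close> and \<open>D v u\<close>.\<close>
  define e where "e = \<bar>D u v - D v u\<bar> / (2 * K)"
  have K: "K > 0" by (smt (verit) K_def norm_ge_zero)
  have e: "e > 0" using \<open>D u v \<noteq> D v u\<close> K by (simp add: e_def)
  let ?\<Delta> = "\<lambda>s u v. f (x + s *\<^sub>R u + s *\<^sub>R v) - f (x + s *\<^sub>R u) - f (x + s *\<^sub>R v) + f x"
  obtain s1 s2 where s: "s1 > 0" "s2 > 0"
    "\<And>s. 0 < s \<Longrightarrow> s < s1 \<Longrightarrow> \<bar>?\<Delta> s u v - s\<^sup>2 * D u v\<bar> \<le> e * s\<^sup>2 * (2 * norm u + norm v)"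
    "\<And>s. 0 < s \<Longrightarrow> s < s2 \<Longrightarrow> \<bar>?\<Delta> s v u - s\<^sup>2 * D v u\<bar> \<le> e * s\<^sup>2 * (2 * norm v + norm u)"
    using second_difference_bound[OF U f' D[of u] e, of v]
      second_difference_bound[OF U f' D[of v] e, of u] by blast
  define s where "s = min s1 s2 / 2"
  have s': "0 < s" "s < s1" "s < s2" using s by (auto simp: s_def)
  have "?\<Delta> s u v = ?\<Delta> s v u" by (simp add: add.commute add.left_commute)
  then have "\<bar>s\<^sup>2 * D u v - s\<^sup>2 * D v u\<bar> \<le> e * s\<^sup>2 * (2 * norm u + norm v) + e * s\<^sup>2 * (2 * norm v + norm u)"
    using s(3)[OF s'(1,2)] s(4)[OF s'(1,3)] by linarith
  also have "\<dots> = s\<^sup>2 * (e * (K - 1))" by (simp add: K_def algebra_simps)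
  also have "\<bar>s\<^sup>2 * D u v - s\<^sup>2 * D v u\<bar> = s\<^sup>2 * \<bar>D u v - D v u\<bar>"
    by (simp add: abs_mult flip: right_diff_distrib)
  finally have "\<bar>D u v - D v u\<bar> \<le> e * (K - 1)" using s' by simp
  also have "\<dots> < e * (2 * K)" using e K by (intro mult_strict_left_mono) auto
  also have "\<dots> = \<bar>D u v - D v u\<bar>" using K by (simp add: e_def)
  finally show False by simp
qed

lemma symmetric_second_derivative:
  fixes f :: "'a::real_normed_vector \<Rightarrow> 'b::euclidean_space"
  assumes U: "open U" "x \<in> U" and f': "\<And>y. y \<in> U \<Longrightarrow> (f has_derivative f' y) (at y)"
    and D: "\<And>u. ((\<lambda>y. f' y u) has_derivative D u) (at x)"
  shows "D u v = D v u"
proof (rule euclidean_eqI)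
  fix b :: 'b assume "b \<in> Basis"
  show "D u v \<bullet> b = D v u \<bullet> b"
    by (rule symmetric_second_derivative_real[OF U, of "\<lambda>y. f y \<bullet> b" "\<lambda>y u. f' y u \<bullet> b"])
       (use f' D in \<open>auto intro: has_derivative_inner_left\<close>)
qed

section \<open>Bilinear forms depending on a point\<close>

text \<open>The product rule for an inner product of two fields in a varying metric.
  Differentiability of \<open>G\<close> is given for constant arguments only, hence the detour
  through coordinates.\<close>

lemma has_derivative_metric:
  fixes G :: "'y::real_normed_vector \<Rightarrow> real^'k::finite \<Rightarrow> real^'k \<Rightarrow> real" and y :: "'z::real_normed_vector \<Rightarrow> 'y"
  assumes G: "\<And>z. z \<in> S \<Longrightarrow> bilinear (G (y z))" and z0: "z0 \<in> S"
    and DG: "\<And>u v. ((\<lambda>y. G y u v) has_derivative (\<lambda>h. D h u v)) (at (y z0))"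
    and D: "\<And>h. bilinear (D h)"
    and y: "(y has_derivative y') (at z0 within S)"
    and a: "(a has_derivative a') (at z0 within S)"
    and b: "(b has_derivative b') (at z0 within S)"
  shows "((\<lambda>z. G (y z) (a z) (b z)) has_derivative
    (\<lambda>h. D (y' h) (a z0) (b z0) + G (y z0) (a' h) (b z0) + G (y z0) (a z0) (b' h))) (at z0 within S)"
proof -
  have nth: "((\<lambda>z. f z $ i) has_derivative (\<lambda>h. f' h $ i)) (at z0 within S)"
    if "(f has_derivative f') (at z0 within S)" for f :: "'z \<Rightarrow> real^'k" and f' i
    using bounded_linear.has_derivative[OF bounded_linear_vec_nth that] .
  have Gij: "((\<lambda>z. G (y z) u v) has_derivative (\<lambda>h. D (y' h) u v)) (at z0 within S)" for u v
    using has_derivative_compose[OF y, of "\<lambda>y. G y u v" "\<lambda>h. D h u v"] DG by simp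
  have "((\<lambda>z. \<Sum>i\<in>UNIV. \<Sum>j\<in>UNIV. a z $ i * b z $ j * G (y z) (axis i 1) (axis j 1)) has_derivative
    (\<lambda>h. \<Sum>i\<in>UNIV. \<Sum>j\<in>UNIV. a z0 $ i * b z0 $ j * D (y' h) (axis i 1) (axis j 1) +
      (a z0 $ i * b' h $ j + a' h $ i * b z0 $ j) * G (y z0) (axis i 1) (axis j 1))) (at z0 within S)"
    by (intro has_derivative_sum has_derivative_mult nth[OF a] nth[OF b] Gij)
  moreover have "(\<lambda>h. \<Sum>i\<in>UNIV. \<Sum>j\<in>UNIV. a z0 $ i * b z0 $ j * D (y' h) (axis i 1) (axis j 1) +
      (a z0 $ i * b' h $ j + a' h $ i * b z0 $ j) * G (y z0) (axis i 1) (axis j 1)) =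
    (\<lambda>h. D (y' h) (a z0) (b z0) + G (y z0) (a' h) (b z0) + G (y z0) (a z0) (b' h))"
  proof
    fix h
    show "(\<Sum>i\<in>UNIV. \<Sum>j\<in>UNIV. a z0 $ i * b z0 $ j * D (y' h) (axis i 1) (axis j 1) +
      (a z0 $ i * b' h $ j + a' h $ i * b z0 $ j) * G (y z0) (axis i 1) (axis j 1)) =
      D (y' h) (a z0) (b z0) + G (y z0) (a' h) (b z0) + G (y z0) (a z0) (b' h)"
      unfolding bilinear_expand_axis[OF D[of "y' h"], of "a z0" "b z0"]
        bilinear_expand_axis[OF G[OF z0], of "a' h" "b z0"]
        bilinear_expand_axis[OF G[OF z0], of "a z0" "b' h"]
      by (simp add: sum.distrib distrib_right)
  qed
  ultimately have "((\<lambda>z. \<Sum>i\<in>UNIV. \<Sum>j\<in>UNIV. a z $ i * b z $ j * G (y z) (axis i 1) (axis j 1)) has_derivative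
    (\<lambda>h. D (y' h) (a z0) (b z0) + G (y z0) (a' h) (b z0) + G (y z0) (a z0) (b' h))) (at z0 within S)"
    by simp
  then show ?thesis
    by (rule has_derivative_transform[OF z0 bilinear_expand_axis[OF G], rotated])
qed

text \<open>Positivity makes the map from \<open>z\<close> to the functional \<open>B z\<close>
  injective, and by dimension it is then surjective. This gives meaning to the definite description
  in \<open>christoffel\<close>.\<close>

lemma ex1_riesz:
  fixes B :: "real^'k::finite \<Rightarrow> real^'k \<Rightarrow> real"
  assumes B: "bilinear B" and pos: "\<And>u. u \<noteq> 0 \<Longrightarrow> 0 < B u u" and f: "linear f"
  shows "\<exists>!z. \<forall>w. B z w = f w"
proof -
  let ?F = "\<lambda>z. \<chi> i. B z (axis i 1)"
  have lin: "linear ?F"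
    by (rule linearI) (simp_all add: vec_eq_iff bilinear_ladd[OF B] bilinear_lmul[OF B])
  have B': "linear (B z)" for z using B by (simp add: bilinear_def)
  have ext: "(\<forall>w. B z w = f w) \<longleftrightarrow> (\<forall>i. B z (axis i 1) = f (axis i 1))" for z
  proof
    assume *: "\<forall>i. B z (axis i 1) = f (axis i 1)"
    have "B z = f"
      by (rule linear_eq_stdbasis[OF B' f]) (use * in \<open>auto simp: Basis_vec_def\<close>)
    then show "\<forall>w. B z w = f w" by simp
  qed simp
  have inj: "inj ?F"
    unfolding linear_injective_0[OF lin]
  proof (intro allI impI)
    fix z assume "?F z = 0"
    then have "B z (axis i 1) = 0" for i by (simp add: vec_eq_iff)
    then have "B z = (\<lambda>w. 0)"
      by (intro linear_eq_stdbasis[OF B' linear_zero]) (auto simp: Basis_vec_def)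
    then have "B z z = 0" by (rule fun_cong)
    then have "\<not> 0 < B z z" by simp
    then show "z = 0" using pos[of z] by blast
  qed
  then have "surj ?F" by (rule linear_inj_imp_surj[OF lin])
  then obtain z where z: "?F z = (\<chi> i. f (axis i 1))"
    unfolding surj_def by (metis (mono_tags))
  show ?thesis
  proof (rule ex1I[of _ z])
    show "\<forall>w. B z w = f w" using z by (simp add: ext vec_eq_iff)
    fix z' assume "\<forall>w. B z' w = f w"
    then have "?F z' = ?F z" using z by (simp add: ext vec_eq_iff)
    with inj show "z' = z" by (rule injD)
  qed
qed

section \<open>Charts and the Levi-Civita connection\<close>

text \<open>\<open>mdiff\<close> with freely chosen charts, and \<open>chart_change\<close> when
  \<open>f = id\<close>. A single chain rule thus covers all changes of coordinates.\<close>

definition chart_deriv :: "('x, 'n::finite) chart \<Rightarrow> ('y, 'm::finite) chart \<Rightarrow> ('x \<Rightarrow> 'y) \<Rightarrow>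
    'x \<Rightarrow> real^'n \<Rightarrow> real^'m" where
  "chart_deriv c d f p = frechet_derivative (snd d \<circ> f \<circ> cinv c)
     (at (snd c p) within snd c ` {x \<in> fst c. f x \<in> fst d})"

lemma mdiff_eq_chart_deriv: "mdiff A B f p = chart_deriv (chart_at A p) (chart_at B (f p)) f p"
  by (simp add: mdiff_def chart_deriv_def Let_def)

lemma chart_change_eq_chart_deriv: "chart_change c d p = chart_deriv c d id p"
proof -
  have "fst c \<inter> fst d = {x \<in> fst c. id x \<in> fst d}" by auto
  then show ?thesis by (simp add: chart_change_def chart_deriv_def o_def)
qed

lemma cinv_chart: "smooth_atlas H A \<Longrightarrow> c \<in> A \<Longrightarrow> p \<in> fst c \<Longrightarrow> cinv c (snd c p) = p"
  by (simp add: smooth_atlas_def cinv_def)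

lemma chart_at_in: "p \<in> carrier A \<Longrightarrow> chart_at A p \<in> A"
  and in_chart_at: "p \<in> carrier A \<Longrightarrow> p \<in> fst (chart_at A p)"
proof -
  assume "p \<in> carrier A"
  then have "\<exists>c. c \<in> A \<and> p \<in> fst c" by (auto simp: carrier_def)
  then have "chart_at A p \<in> A \<and> p \<in> fst (chart_at A p)"
    unfolding chart_at_def by (rule someI_ex)
  then show "chart_at A p \<in> A" "p \<in> fst (chart_at A p)" by auto
qed

lemma in_carrier: "c \<in> A \<Longrightarrow> p \<in> fst c \<Longrightarrow> p \<in> carrier A"
  by (auto simp: carrier_def)

lemma chart_image_open:
  assumes A: "smooth_atlas H A" and W: "openin (mtop A) W" and c: "c \<in> A"
  shows "openin (top_of_set H) (snd c ` (W \<inter> fst c))"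
proof -
  have "openin (top_of_set (cimg c)) (snd c ` (W \<inter> fst c))"
    using W c by (simp add: openin_mtop[OF A])
  moreover have "openin (top_of_set H) (cimg c)" using A c by (simp add: smooth_atlas_def)
  ultimately show ?thesis by (rule openin_trans)
qed

lemma overlap_open:
  assumes A: "smooth_atlas H A" and "c \<in> A" "d \<in> A"
  shows "openin (mtop A) (fst c \<inter> fst d)"
  unfolding openin_mtop[OF A]
proof (intro conjI ballI)
  show "fst c \<inter> fst d \<subseteq> carrier A" using assms by (auto simp: carrier_def)
  fix e assume e: "e \<in> A"
  have inj: "inj_on (snd e) (fst e)" using A e by (auto simp: smooth_atlas_def)
  have "openin (top_of_set H) (snd e ` (fst e \<inter> fst c) \<inter> snd e ` (fst e \<inter> fst d))"
    using A assms e by (intro openin_Int) (auto simp: smooth_atlas_def)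
  moreover have "snd e ` (fst e \<inter> fst c) \<inter> snd e ` (fst e \<inter> fst d) = snd e ` (fst c \<inter> fst d \<inter> fst e)"
    using inj_on_image_Int[OF inj, of "fst e \<inter> fst c" "fst e \<inter> fst d"] by (simp add: Int_ac)
  ultimately have "openin (top_of_set H) (snd e ` (fst c \<inter> fst d \<inter> fst e))" by simp
  moreover have "openin (top_of_set H) (cimg e)" using A e by (simp add: smooth_atlas_def)
  ultimately show "openin (top_of_set (cimg e)) (snd e ` (fst c \<inter> fst d \<inter> fst e))"
    using openin_subset_trans[OF _ _ openin_imp_subset] by (metis Int_lower2 cimg_def image_mono)
qed

lemma smooth_map_on_id:
  assumes A: "smooth_atlas H A"
  shows "smooth_map_on A (carrier A) A id"
  unfolding smooth_map_on_def
proof (intro conjI ballI)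
  fix c d assume cd: "c \<in> A" "d \<in> A"
  have eq: "{p \<in> carrier A \<inter> fst c. id p \<in> fst d} = fst c \<inter> fst d"
    using cd by (auto simp: carrier_def)
  show "openin (subtopology (mtop A) (carrier A)) {p \<in> carrier A \<inter> fst c. id p \<in> fst d}"
    unfolding eq using overlap_open[OF A cd] cd
    by (auto simp: openin_subtopology carrier_def intro!: exI[of _ "fst c \<inter> fst d"])
  show "smooth_on (snd c ` {p \<in> carrier A \<inter> fst c. id p \<in> fst d}) (snd d \<circ> id \<circ> cinv c)"
    unfolding eq using A cd by (auto simp: smooth_atlas_def)
qed simp

lemma smooth_map_dom_open:
  assumes A: "smooth_atlas H A" and f: "smooth_map_on A (carrier A) B f" and cd: "c \<in> A" "d \<in> B"
  shows "openin (mtop A) {x \<in> fst c. f x \<in> fst d}"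
proof -
  have eq: "{p \<in> carrier A \<inter> fst c. f p \<in> fst d} = {x \<in> fst c. f x \<in> fst d}"
    using cd by (auto simp: carrier_def)
  have "openin (subtopology (mtop A) (carrier A)) {x \<in> fst c. f x \<in> fst d}"
    using f cd unfolding smooth_map_on_def eq[symmetric] by blast
  then obtain T where T: "openin (mtop A) T" "{x \<in> fst c. f x \<in> fst d} = T \<inter> carrier A"
    by (auto simp: openin_subtopology)
  moreover have "T \<subseteq> carrier A" using T by (simp add: openin_mtop[OF A])
  ultimately show ?thesis by (simp add: Int_absorb2)
qed

lemma smooth_map_chart:
  assumes f: "smooth_map_on A (carrier A) B f" and cd: "c \<in> A" "d \<in> B"
  shows "smooth_on (snd c ` {x \<in> fst c. f x \<in> fst d}) (snd d \<circ> f \<circ> cinv c)"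
proof -
  have eq: "{p \<in> carrier A \<inter> fst c. f p \<in> fst d} = {x \<in> fst c. f x \<in> fst d}"
    using cd by (auto simp: carrier_def)
  show ?thesis using f cd unfolding smooth_map_on_def eq[symmetric] by blast
qed

lemma chart_dom_open:
  assumes A: "smooth_atlas H A" and f: "smooth_map_on A (carrier A) B f" and cd: "c \<in> A" "d \<in> B"
  shows "openin (top_of_set H) (snd c ` {x \<in> fst c. f x \<in> fst d})"
proof -
  have "{x \<in> fst c. f x \<in> fst d} \<inter> fst c = {x \<in> fst c. f x \<in> fst d}" by auto
  then show ?thesis
    using chart_image_open[OF A smooth_map_dom_open[OF A f cd] cd(1)] by simp
qed

lemma has_derivative_chart_deriv:
  assumes f: "smooth_map_on A (carrier A) B f" and cd: "c \<in> A" "d \<in> B"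
    and p: "p \<in> fst c" "f p \<in> fst d"
  shows "((snd d \<circ> f \<circ> cinv c) has_derivative chart_deriv c d f p)
    (at (snd c p) within snd c ` {x \<in> fst c. f x \<in> fst d})"
  unfolding chart_deriv_def frechet_derivative_works[symmetric]
  using smooth_on_differentiable[OF smooth_map_chart[OF f cd]] p by blast

lemma linear_chart_deriv:
  assumes f: "smooth_map_on A (carrier A) B f" and cd: "c \<in> A" "d \<in> B"
    and p: "p \<in> fst c" "f p \<in> fst d"
  shows "linear (chart_deriv c d f p)"
  using has_derivative_chart_deriv[OF assms] by (rule has_derivative_linear)

text \<open>All three coordinate expressions are defined on \<open>W\<close>, where the ordinary
  chain rule applies. As \<open>W\<close> has an image open in the model space, the derivative
  within it is unique and agrees with those taken within the larger domains.\<close>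

lemma chart_deriv_compose:
  assumes H: "model H" and A: "smooth_atlas H A" and B: "smooth_atlas H' B"
    and f: "smooth_map_on A (carrier A) B f" and g: "smooth_map_on B (carrier B) C g"
    and gf: "smooth_map_on A (carrier A) C (g \<circ> f)"
    and cde: "c \<in> A" "d \<in> B" "e \<in> C"
    and p: "p \<in> fst c" "f p \<in> fst d" "g (f p) \<in> fst e"
  shows "chart_deriv c e (g \<circ> f) p = chart_deriv d e g (f p) \<circ> chart_deriv c d f p"
proof -
  define W where "W = {x \<in> fst c. f x \<in> fst d} \<inter> {x \<in> fst c. (g \<circ> f) x \<in> fst e}"
  have "openin (mtop A) W"
    unfolding W_def
    by (rule openin_Int[OF smooth_map_dom_open[OF A f cde(1,2)] smooth_map_dom_open[OF A gf cde(1,3)]])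
  then have open_W: "openin (top_of_set H) (snd c ` W)"
    using chart_image_open[OF A _ cde(1), of W] by (simp add: W_def Int_ac Int_absorb2 Collect_conj_eq)
  have pW: "snd c p \<in> snd c ` W" using p by (auto simp: W_def)
  have 1: "((snd e \<circ> (g \<circ> f) \<circ> cinv c) has_derivative chart_deriv c e (g \<circ> f) p) (at (snd c p) within snd c ` W)"
    by (rule has_derivative_subset[OF has_derivative_chart_deriv[OF gf cde(1,3)]])
       (use p in \<open>auto simp: W_def\<close>)
  have 2: "((snd d \<circ> f \<circ> cinv c) has_derivative chart_deriv c d f p) (at (snd c p) within snd c ` W)"
    by (rule has_derivative_subset[OF has_derivative_chart_deriv[OF f cde(1,2)]])
       (use p in \<open>auto simp: W_def\<close>)
  have val: "(snd d \<circ> f \<circ> cinv c) (snd c x) = snd d (f x)" if "x \<in> fst c" for x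
    using that cinv_chart[OF A cde(1)] by simp
  have "((snd e \<circ> g \<circ> cinv d) has_derivative chart_deriv d e g (f p))
      (at ((snd d \<circ> f \<circ> cinv c) (snd c p)) within (snd d \<circ> f \<circ> cinv c) ` (snd c ` W))"
    unfolding val[OF p(1)]
    by (rule has_derivative_subset[OF has_derivative_chart_deriv[OF g cde(2,3)]])
       (use p cinv_chart[OF A cde(1)] in \<open>auto simp: W_def\<close>)
  from diff_chain_within[OF 2 this]
  have 3: "((snd e \<circ> g \<circ> cinv d) \<circ> (snd d \<circ> f \<circ> cinv c) has_derivative
      chart_deriv d e g (f p) \<circ> chart_deriv c d f p) (at (snd c p) within snd c ` W)" .
  have "((snd e \<circ> (g \<circ> f) \<circ> cinv c) has_derivative chart_deriv d e g (f p) \<circ> chart_deriv c d f p)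
      (at (snd c p) within snd c ` W)"
    by (rule has_derivative_transform[OF pW _ 3])
       (use cinv_chart[OF A cde(1)] cinv_chart[OF B cde(2)] in \<open>auto simp: W_def\<close>)
  then show ?thesis
    using has_derivative_unique_model[OF H open_W pW 1] by blast
qed

lemma chart_change_self:
  assumes H: "model H" and A: "smooth_atlas H A" and c: "c \<in> A" "p \<in> fst c"
  shows "chart_change c c p = id"
proof -
  let ?S = "snd c ` {x \<in> fst c. id x \<in> fst c}"
  note id = smooth_map_on_id[OF A]
  have pS: "snd c p \<in> ?S" using c by auto
  have "((snd c \<circ> id \<circ> cinv c) has_derivative id) (at (snd c p) within ?S)"
    by (rule has_derivative_transform[OF pS _ has_derivative_id]) (use cinv_chart[OF A c(1)] in auto)
  then show ?thesis
    unfolding chart_change_eq_chart_deriv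
    using has_derivative_unique_model[OF H chart_dom_open[OF A id c(1) c(1)] pS
        has_derivative_chart_deriv[OF id c(1) c(1) c(2)]] c by auto
qed

lemma chart_deriv_change:
  assumes H: "model H" and H': "model H'" and A: "smooth_atlas H A" and B: "smooth_atlas H' B"
    and f: "smooth_map_on A (carrier A) B f"
    and c: "c \<in> A" "c' \<in> A" "d \<in> B"
    and p: "p \<in> fst c" "p \<in> fst c'" "f p \<in> fst d"
  shows "chart_deriv c' d f p (chart_change c c' p v) = chart_deriv c d f p v"
  using chart_deriv_compose[OF H A A smooth_map_on_id[OF A] f, of c c' d p] f c p
  by (simp add: chart_change_eq_chart_deriv)

lemma chart_change_deriv:
  assumes H: "model H" and A: "smooth_atlas H A" and B: "smooth_atlas H' B"
    and f: "smooth_map_on A (carrier A) B f"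
    and c: "c \<in> A" "d \<in> B" "d' \<in> B"
    and p: "p \<in> fst c" "f p \<in> fst d" "f p \<in> fst d'"
  shows "chart_change d d' (f p) (chart_deriv c d f p v) = chart_deriv c d' f p v"
  using chart_deriv_compose[OF H A B f smooth_map_on_id[OF B], of c d d' p] f c p
  by (simp add: chart_change_eq_chart_deriv)

lemma chart_change_chart_change:
  assumes H: "model H" and A: "smooth_atlas H A" and c: "c \<in> A" "d \<in> A" "e \<in> A"
    and p: "p \<in> fst c" "p \<in> fst d" "p \<in> fst e"
  shows "chart_change d e p (chart_change c d p v) = chart_change c e p v"
  using chart_change_deriv[OF H A A smooth_map_on_id[OF A], of c d e p v] c p
  by (simp add: chart_change_eq_chart_deriv)

lemma chart_change_inverse:
  assumes H: "model H" and A: "smooth_atlas H A" and c: "c \<in> A" "d \<in> A"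
    and p: "p \<in> fst c" "p \<in> fst d"
  shows "chart_change d c p (chart_change c d p v) = v"
  using chart_change_chart_change[OF H A c(1,2,1) p(1,2,1)] chart_change_self[OF H A c(1) p(1)] by simp

lemma linear_chart_change:
  assumes A: "smooth_atlas H A" and c: "c \<in> A" "d \<in> A" and p: "p \<in> fst c" "p \<in> fst d"
  shows "linear (chart_change c d p)"
  unfolding chart_change_eq_chart_deriv
  by (rule linear_chart_deriv[OF smooth_map_on_id[OF A]]) (use assms in auto)

lemma metric_in_chart:
  assumes A: "smooth_atlas H A" and c: "c \<in> A" "q \<in> fst c"
  shows "metric_in A g c (snd c q) u v =
    g q (chart_change c (chart_at A q) q u) (chart_change c (chart_at A q) q v)"
  using cinv_chart[OF A c] by (simp add: metric_in_def Let_def)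

lemma metric_in_chart_at:
  assumes H: "model H" and A: "smooth_atlas H A" and q: "q \<in> carrier A"
  shows "metric_in A g (chart_at A q) (snd (chart_at A q) q) u v = g q u v"
  using metric_in_chart[OF A chart_at_in[OF q] in_chart_at[OF q]]
    chart_change_self[OF H A chart_at_in[OF q] in_chart_at[OF q]] by simp

lemma metric_in_vec_in:
  assumes H: "model H" and A: "smooth_atlas H A" and c: "c \<in> A" "q \<in> fst c"
  shows "metric_in A g c (snd c q) (vec_in A c q a) w = g q a (chart_change c (chart_at A q) q w)"
    and "metric_in A g c (snd c q) (vec_in A c q a) (vec_in A c q b) = g q a b"
  using in_carrier[OF c] chart_change_inverse[OF H A chart_at_in c(1) in_chart_at c(2)]
  by (simp_all add: metric_in_chart[OF A c] vec_in_def)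

lemma metric_in_bilinear:
  assumes A: "smooth_atlas H A" and g: "riemannian_metric A g" and c: "c \<in> A" and x: "x \<in> cimg c"
  shows "bilinear (metric_in A g c x)"
proof -
  obtain q where q: "q \<in> fst c" "x = snd c q" using x by (auto simp: cimg_def)
  note qc = in_carrier[OF c q(1)]
  interpret T: linear "chart_change c (chart_at A q) q"
    using linear_chart_change[OF A c chart_at_in[OF qc] q(1) in_chart_at[OF qc]] .
  have "bilinear (g q)" using g qc by (simp add: riemannian_metric_def)
  note bil = bilinear_ladd[OF this] bilinear_radd[OF this] bilinear_lmul[OF this] bilinear_rmul[OF this]
  show ?thesis
    by (auto simp: bilinear_def linear_iff metric_in_chart[OF A c q(1)] q(2) T.add T.scale bil)
qed

lemma metric_in_sym:
  assumes A: "smooth_atlas H A" and g: "riemannian_metric A g" and c: "c \<in> A" and x: "x \<in> cimg c"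
  shows "metric_in A g c x u v = metric_in A g c x v u"
proof -
  obtain q where q: "q \<in> fst c" "x = snd c q" using x by (auto simp: cimg_def)
  then show ?thesis
    using g in_carrier[OF c q(1)] by (simp add: metric_in_chart[OF A c q(1)] riemannian_metric_def)
qed

lemma metric_in_pos:
  assumes H: "model H" and A: "smooth_atlas H A" and g: "riemannian_metric A g"
    and c: "c \<in> A" and x: "x \<in> cimg c" and u: "u \<noteq> 0"
  shows "0 < metric_in A g c x u u"
proof -
  obtain q where q: "q \<in> fst c" "x = snd c q" using x by (auto simp: cimg_def)
  note qc = in_carrier[OF c q(1)]
  have "chart_change c (chart_at A q) q u \<noteq> 0"
    using chart_change_inverse[OF H A c chart_at_in[OF qc] q(1) in_chart_at[OF qc], of u] u
      linear_0[OF linear_chart_change[OF A chart_at_in[OF qc] c in_chart_at[OF qc] q(1)]] by auto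
  then show ?thesis
    using g qc q by (simp add: metric_in_chart[OF A c q(1)] riemannian_metric_def)
qed

section \<open>Christoffel symbols: vanishing torsion and compatibility with the metric\<close>

text \<open>The derivative of the metric coefficients with the direction as first argument. It is
  used for atlases without boundary, whose chart images are open, so that \<open>at x\<close> agrees
  with the restricted derivative in \<open>christoffel\<close>.\<close>

definition metric_deriv :: "('x, 'n::finite) atlas \<Rightarrow> ('x, 'n) metric \<Rightarrow> ('x, 'n) chart \<Rightarrow>
    real^'n \<Rightarrow> real^'n \<Rightarrow> real^'n \<Rightarrow> real^'n \<Rightarrow> real" where
  "metric_deriv A g c x h u v = frechet_derivative (\<lambda>y. metric_in A g c y u v) (at x) h"

lemma cimg_open: "smooth_atlas UNIV A \<Longrightarrow> c \<in> A \<Longrightarrow> open (cimg c)"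
  by (simp add: smooth_atlas_def)

lemma has_derivative_metric_deriv:
  assumes A: "smooth_atlas UNIV A" and g: "riemannian_metric A g" and c: "c \<in> A" and x: "x \<in> cimg c"
  shows "((\<lambda>y. metric_in A g c y u v) has_derivative (\<lambda>h. metric_deriv A g c x h u v)) (at x)"
proof -
  have "smooth_on (cimg c) (\<lambda>x. metric_in A g c x u v)"
    using g c by (simp add: riemannian_metric_def)
  from smooth_on_differentiable[OF this x] show ?thesis
    by (simp add: frechet_derivative_works metric_deriv_def at_within_open[OF x cimg_open[OF A c]])
qed

lemma metric_deriv_bilinear:
  assumes A: "smooth_atlas UNIV A" and g: "riemannian_metric A g" and c: "c \<in> A" and x: "x \<in> cimg c"
  shows "bilinear (metric_deriv A g c x h)"
proof -
  let ?G = "metric_in A g c" and ?D = "metric_deriv A g c x"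
  note D = has_derivative_metric_deriv[OF assms]
  note G = metric_in_bilinear[OF A g c]
  have uniq: "?D h u v = f' h"
    if "(f has_derivative f') (at x)" "\<And>y. y \<in> cimg c \<Longrightarrow> f y = ?G y u v" for f f' u v
    using has_derivative_unique[OF D has_derivative_transform_within_open[OF that(1) cimg_open[OF A c] x that(2)]]
    by (rule fun_cong)
  have "?D h (u + u') v = ?D h u v + ?D h u' v" for u u' v
    by (rule uniq[OF has_derivative_add[OF D D]]) (simp add: bilinear_ladd[OF G])
  moreover have "?D h v (u + u') = ?D h v u + ?D h v u'" for u u' v
    by (rule uniq[OF has_derivative_add[OF D D]]) (simp add: bilinear_radd[OF G])
  moreover have "?D h (r *\<^sub>R u) v = r * ?D h u v" for r u v
    by (rule uniq[OF has_derivative_mult_right[OF D]]) (simp add: bilinear_lmul[OF G])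
  moreover have "?D h v (r *\<^sub>R u) = r * ?D h v u" for r u v
    by (rule uniq[OF has_derivative_mult_right[OF D]]) (simp add: bilinear_rmul[OF G])
  ultimately show ?thesis by (simp add: bilinear_def linear_iff)
qed

lemma metric_deriv_sym:
  assumes A: "smooth_atlas UNIV A" and g: "riemannian_metric A g" and c: "c \<in> A" and x: "x \<in> cimg c"
  shows "metric_deriv A g c x h u v = metric_deriv A g c x h v u"
  using has_derivative_unique[OF has_derivative_metric_deriv[OF assms]
      has_derivative_transform_within_open[OF has_derivative_metric_deriv[OF assms] cimg_open[OF A c] x]]
    metric_in_sym[OF A g c] by meson

lemma metric_deriv_linear:
  assumes A: "smooth_atlas UNIV A" and g: "riemannian_metric A g" and c: "c \<in> A" and x: "x \<in> cimg c"
  shows "linear (\<lambda>h. metric_deriv A g c x h u v)"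
  using has_derivative_metric_deriv[OF assms] by (rule has_derivative_linear)

text \<open>The right-hand side is linear in \<open>w\<close>, so the positive definite metric
  represents it by exactly one vector. The second claim allows identities between Christoffel
  symbols to be proved by testing against every \<open>w\<close>.\<close>

lemma christoffel_koszul:
  assumes A: "smooth_atlas UNIV A" and g: "riemannian_metric A g" and c: "c \<in> A" and x: "x \<in> cimg c"
  shows "2 * metric_in A g c x (christoffel A g c x u v) w =
      metric_deriv A g c x u v w + metric_deriv A g c x v u w - metric_deriv A g c x w u v"
    and "(\<And>w. 2 * metric_in A g c x z w =
      metric_deriv A g c x u v w + metric_deriv A g c x v u w - metric_deriv A g c x w u v) \<Longrightarrow>
      z = christoffel A g c x u v"
proof -
  let ?G = "metric_in A g c x" and ?D = "metric_deriv A g c x"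
  have D: "frechet_derivative (\<lambda>y. metric_in A g c y b e) (at x within cimg c) a = ?D a b e" for a b e
    by (simp add: metric_deriv_def at_within_open[OF x cimg_open[OF A c]])
  note G = metric_in_bilinear[OF A g c x]
  note DB = metric_deriv_bilinear[OF A g c x]
  have "linear (\<lambda>w. (?D u v w + ?D v u w - ?D w u v) / 2)"
    by (simp add: linear_iff bilinear_radd[OF DB] bilinear_rmul[OF DB] field_simps
        linear_add[OF metric_deriv_linear[OF assms]] linear_scale[OF metric_deriv_linear[OF assms]])
  from ex1_riesz[OF G metric_in_pos[OF model_UNIV A g c x] this]
  have "\<exists>!z. \<forall>w. 2 * ?G z w = ?D u v w + ?D v u w - ?D w u v"
    by (simp add: field_simps)
  note * = theI'[OF this] the1_equality[OF this]
  have chr: "christoffel A g c x u v = (THE z. \<forall>w. 2 * ?G z w = ?D u v w + ?D v u w - ?D w u v)"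
    by (simp add: christoffel_def Let_def D)
  show "2 * ?G (christoffel A g c x u v) w = ?D u v w + ?D v u w - ?D w u v"
    unfolding chr using *(1) by blast
  show "(\<And>w. 2 * ?G z w = ?D u v w + ?D v u w - ?D w u v) \<Longrightarrow> z = christoffel A g c x u v"
    unfolding chr using *(2) by blast
qed

context
  fixes A :: "('x, 'n::finite) atlas" and g c x
  assumes A: "smooth_atlas UNIV A" and g: "riemannian_metric A g" and c: "c \<in> A" and x: "x \<in> cimg c"
begin

lemma christoffel_sym: "christoffel A g c x u v = christoffel A g c x v u"
  by (rule christoffel_koszul(2)[OF A g c x])
     (simp add: christoffel_koszul(1)[OF A g c x] metric_deriv_sym[OF A g c x, of _ u v])

lemma christoffel_linear: "linear (\<lambda>u. christoffel A g c x u v)"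
proof -
  note K = christoffel_koszul[OF A g c x]
  note DB = metric_deriv_bilinear[OF A g c x]
  note DL = metric_deriv_linear[OF A g c x]
  note G = metric_in_bilinear[OF A g c x]
  have r: "2 * (r * a) = r * (2 * a)" for r a :: real by simp
  show ?thesis
    by (rule linearI; rule K(2)[symmetric])
       (simp_all only: bilinear_ladd[OF G] bilinear_lmul[OF G] distrib_left K(1) r real_scaleR_def
          bilinear_ladd[OF DB] bilinear_lmul[OF DB] bilinear_radd[OF DB] bilinear_rmul[OF DB]
          linear_add[OF DL] linear_scale[OF DL], simp_all add: algebra_simps)
qed

text \<open>When the Koszul formulas with \<open>v\<close> and \<open>w\<close> exchanged are added,
  all terms cancel except twice the derivative in direction \<open>u\<close>.\<close>

lemma christoffel_metric:
  "metric_in A g c x (christoffel A g c x u v) w + metric_in A g c x v (christoffel A g c x u w) =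
    metric_deriv A g c x u v w"
  using christoffel_koszul(1)[OF A g c x, of u v w] christoffel_koszul(1)[OF A g c x, of u w v]
    metric_in_sym[OF A g c x, of v "christoffel A g c x u w"]
    metric_deriv_sym[OF A g c x, of u v w]
  by simp

end

text \<open>\<open>isometric_immersion\<close> speaks at each point about the chart selected there.
  The identity will be differentiated, which requires it at all nearby \<open>q\<close> with the
  charts \<open>c\<close> and \<open>d\<close> held fixed.\<close>

lemma isometric_metric_in:
  assumes H: "model H" and H': "model H'" and A: "smooth_atlas H A" and B: "smooth_atlas H' B"
    and f: "isometric_immersion A gA B gB f"
    and c: "c \<in> A" "d \<in> B" and q: "q \<in> fst c" "f q \<in> fst d"
  shows "metric_in B gB d (snd d (f q)) (chart_deriv c d f q u) (chart_deriv c d f q v) =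
    metric_in A gA c (snd c q) u v"
proof -
  have sm: "smooth_map_on A (carrier A) B f"
    and iso: "gB (f q) (mdiff A B f q u) (mdiff A B f q v) = gA q u v" for u v
    using f in_carrier[OF c(1) q(1)] by (simp_all add: isometric_immersion_def immersion_def)
  note qc = in_carrier[OF c(1) q(1)] and fqc = in_carrier[OF c(2) q(2)]
  note ch = chart_at_in[OF qc] in_chart_at[OF qc] chart_at_in[OF fqc] in_chart_at[OF fqc]
  have "chart_change d (chart_at B (f q)) (f q) (chart_deriv c d f q u) =
      mdiff A B f q (chart_change c (chart_at A q) q u)" for u
    unfolding mdiff_eq_chart_deriv
      chart_change_deriv[OF H A B sm c ch(3) q ch(4)]
      chart_deriv_change[OF H H' A B sm c(1) ch(1) ch(3) q(1) ch(2) ch(4)] ..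
  then show ?thesis
    by (simp add: metric_in_chart[OF B c(2) q(2)] metric_in_chart[OF A c(1) q(1)] iso)
qed

lemma unit_normal_metric_in:
  assumes H: "model H" and H': "model H'" and A: "smooth_atlas H A" and B: "smooth_atlas H' B"
    and sm: "smooth_map_on A (carrier A) B f" and N: "unit_normal A B gB f N"
    and c: "c \<in> A" "d \<in> B" and q: "q \<in> fst c" "f q \<in> fst d"
  shows "metric_in B gB d (snd d (f q)) (vec_in B d (f q) (N q)) (chart_deriv c d f q u) = 0"
    and "metric_in B gB d (snd d (f q)) (vec_in B d (f q) (N q)) (vec_in B d (f q) (N q)) = 1"
proof -
  note qc = in_carrier[OF c(1) q(1)] and fqc = in_carrier[OF c(2) q(2)]
  note ch = chart_at_in[OF qc] in_chart_at[OF qc] chart_at_in[OF fqc] in_chart_at[OF fqc]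
  have "chart_change d (chart_at B (f q)) (f q) (chart_deriv c d f q u) =
      mdiff A B f q (chart_change c (chart_at A q) q u)"
    unfolding mdiff_eq_chart_deriv
      chart_change_deriv[OF H A B sm c ch(3) q ch(4)]
      chart_deriv_change[OF H H' A B sm c(1) ch(1) ch(3) q(1) ch(2) ch(4)] ..
  then show "metric_in B gB d (snd d (f q)) (vec_in B d (f q) (N q)) (chart_deriv c d f q u) = 0"
    using N qc by (simp add: metric_in_vec_in(1)[OF H' B c(2) q(2)] unit_normal_def)
  show "metric_in B gB d (snd d (f q)) (vec_in B d (f q) (N q)) (vec_in B d (f q) (N q)) = 1"
    using N qc by (simp add: metric_in_vec_in(2)[OF H' B c(2) q(2)] unit_normal_def)
qed

section \<open>The second fundamental form\<close>

lemma chart_deriv_extension: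
  assumes H: "model H" and A: "smooth_atlas H A" and f: "smooth_map_on A (carrier A) B f"
    and cd: "c \<in> A" "d \<in> B" and q: "q \<in> fst c" "f q \<in> fst d"
    and U: "open U" "snd c q \<in> U"
    and h: "\<And>x. x \<in> snd c ` {x \<in> fst c. f x \<in> fst d} \<Longrightarrow> x \<in> U \<Longrightarrow> h x = (snd d \<circ> f \<circ> cinv c) x"
    and h': "(h has_derivative h') (at (snd c q))"
  shows "h' = chart_deriv c d f q"
proof -
  let ?S = "snd c ` {x \<in> fst c. f x \<in> fst d}"
  have qS: "snd c q \<in> ?S" using q by auto
  have "(h has_derivative h') (at (snd c q) within ?S)"
    using h' by (rule has_derivative_at_withinI)
  moreover have "\<forall>\<^sub>F x in at (snd c q) within ?S. h x = (snd d \<circ> f \<circ> cinv c) x"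
    unfolding eventually_at_topological using U h by blast
  ultimately have "((snd d \<circ> f \<circ> cinv c) has_derivative h') (at (snd c q) within ?S)"
    by (rule has_derivative_transform_eventually) (use h[OF qS U(2)] qS in auto)
  then show ?thesis
    using has_derivative_unique_model[OF H chart_dom_open[OF A f cd] qS]
      has_derivative_chart_deriv[OF f cd q] by blast
qed

text \<open>One point of an immersed hypersurface over an arbitrary model space. The locale is used
  twice at the same ambient point: for \<open>M\<close> over the half space and for \<open>P\<close>
  over \<open>UNIV\<close>.\<close>

locale hypersurface =
  fixes H :: "(real^'n::finite) set" and A :: "('x, 'n) atlas" and gA :: "('x, 'n) metric"
    and B :: "('y, 'm::finite) atlas" and gB :: "('y, 'm) metric"
    and f :: "'x \<Rightarrow> 'y" and N :: "'x \<Rightarrow> real^'m" and p :: 'x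
  assumes dim: "CARD('m) = CARD('n) + 1"
    and H: "model H" and A: "smooth_atlas H A" and gA: "riemannian_metric A gA"
    and B: "smooth_atlas UNIV B" and gB: "riemannian_metric B gB"
    and iso: "isometric_immersion A gA B gB f"
    and N: "unit_normal A B gB f N"
    and p: "p \<in> carrier A"
begin

abbreviation "c \<equiv> chart_at A p"
abbreviation "d \<equiv> chart_at B (f p)"
abbreviation "x0 \<equiv> snd c p"
abbreviation "y0 \<equiv> snd d (f p)"
abbreviation "S \<equiv> snd c ` {x \<in> fst c. f x \<in> fst d}"
abbreviation "F \<equiv> snd d \<circ> f \<circ> cinv c"
abbreviation "dF \<equiv> mdiff A B f p"
abbreviation "\<Gamma> \<equiv> christoffel B gB d y0"
abbreviation "gp \<equiv> gB (f p)"
abbreviation "cov \<equiv> cov_deriv A (carrier A) B gB f N p"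

lemma sm: "smooth_map_on A (carrier A) B f"
  and dF_inj: "inj dF"
  and dF_iso: "gp (dF u) (dF v) = gA p u v"
  using iso p by (auto simp: isometric_immersion_def immersion_def)

lemma fp: "f p \<in> carrier B"
  using sm p by (auto simp: smooth_map_on_def)

lemma c: "c \<in> A" "p \<in> fst c" and d: "d \<in> B" "f p \<in> fst d"
  using p fp by (auto intro: chart_at_in in_chart_at)

lemma x0_S: "x0 \<in> S" using c d by auto

lemma y0_cimg: "y0 \<in> cimg d" using d by (auto simp: cimg_def)

lemma S_open: "openin (top_of_set H) S"
  by (rule chart_dom_open[OF A sm c(1) d(1)])

lemma F_cimg: "z \<in> S \<Longrightarrow> F z \<in> cimg d"
  using cinv_chart[OF A c(1)] by (auto simp: cimg_def)

lemma F_x0: "F x0 = y0"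
  using cinv_chart[OF A c] by simp

lemma dF_chart: "dF = chart_deriv c d f p"
  by (rule mdiff_eq_chart_deriv)

lemma dF_linear: "linear dF"
  unfolding dF_chart by (rule linear_chart_deriv[OF sm c(1) d(1) c(2) d(2)])

lemma F_derivative: "(F has_derivative dF) (at x0 within S)"
  unfolding dF_chart by (rule has_derivative_chart_deriv[OF sm c(1) d(1) c(2) d(2)])

lemma G_y0: "metric_in B gB d y0 u v = gp u v"
  by (rule metric_in_chart_at[OF model_UNIV B fp])

lemma gp_bilinear: "bilinear gp" and gp_sym: "gp u v = gp v u" and gp_pos: "u \<noteq> 0 \<Longrightarrow> 0 < gp u u"
  using gB fp by (auto simp: riemannian_metric_def)

lemmas gp_simps = bilinear_ladd[OF gp_bilinear] bilinear_radd[OF gp_bilinear]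
  bilinear_lmul[OF gp_bilinear] bilinear_rmul[OF gp_bilinear]
  bilinear_lneg[OF gp_bilinear] bilinear_rneg[OF gp_bilinear]
  bilinear_lsub[OF gp_bilinear] bilinear_rsub[OF gp_bilinear]

abbreviation "Nh \<equiv> (\<lambda>q. vec_in B d (f q) (N q)) \<circ> cinv c"
abbreviation "dN \<equiv> frechet_derivative Nh (at x0 within S)"

lemma Nh_derivative: "(Nh has_derivative dN) (at x0 within S)"
proof -
  have eq: "{q \<in> carrier A \<inter> fst c. f q \<in> fst d} = {x \<in> fst c. f x \<in> fst d}"
    using c by (auto simp: carrier_def)
  have "smooth_on S Nh"
    using N c d unfolding unit_normal_def smooth_field_along_def eq[symmetric] by blast
  then show ?thesis
    using smooth_on_differentiable x0_S frechet_derivative_works by blast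
qed

lemma Nh_x0: "Nh x0 = N p"
  using chart_change_self[OF model_UNIV B d] cinv_chart[OF A c] by (simp add: vec_in_def)

lemma cov_eq: "cov v = dN v + \<Gamma> (dF v) (N p)"
proof -
  have eq: "{q \<in> carrier A \<inter> fst c. f q \<in> fst d} = {x \<in> fst c. f x \<in> fst d}"
    using c by (auto simp: carrier_def)
  show ?thesis unfolding cov_deriv_def Let_def eq by (rule refl)
qed

lemma cov_linear: "linear cov"
proof -
  have "linear (\<lambda>v. \<Gamma> (dF v) (N p))"
    using linear_compose[OF dF_linear christoffel_linear[OF B gB d(1) y0_cimg]] by (simp add: o_def)
  then have "linear (\<lambda>v. dN v + \<Gamma> (dF v) (N p))"
    using has_derivative_linear[OF Nh_derivative] by (rule linear_compose_add[rotated])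
  moreover have "cov = (\<lambda>v. dN v + \<Gamma> (dF v) (N p))" by (rule ext) (rule cov_eq)
  ultimately show ?thesis by (simp only:)
qed

abbreviation "DG \<equiv> metric_deriv B gB d y0"

text \<open>Differentiates an identity for the inner product of two fields along \<open>f\<close>.
  It is applied to the length of \<open>N\<close>, to the orthogonality of \<open>N\<close> and
  tangent vectors, and to the induced metric; \<open>U\<close> is where a local extension of
  \<open>F\<close> is available.\<close>

lemma metric_along:
  assumes U: "open U" "x0 \<in> U"
    and a: "(a has_derivative a') (at x0 within S \<inter> U)" and b: "(b has_derivative b') (at x0 within S \<inter> U)"
    and k: "\<And>z. z \<in> S \<Longrightarrow> z \<in> U \<Longrightarrow> metric_in B gB d (F z) (a z) (b z) = k z"
    and k': "(k has_derivative k') (at x0 within S \<inter> U)"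
  shows "DG (dF v) (a x0) (b x0) + gp (a' v) (b x0) + gp (a x0) (b' v) = k' v"
proof -
  have x: "x0 \<in> S \<inter> U" using x0_S U by auto
  have op: "openin (top_of_set H) (S \<inter> U)"
    using S_open U by (auto intro: openin_Int_open)
  have "((\<lambda>z. metric_in B gB d (F z) (a z) (b z)) has_derivative
    (\<lambda>h. DG (dF h) (a x0) (b x0) + metric_in B gB d (F x0) (a' h) (b x0) +
      metric_in B gB d (F x0) (a x0) (b' h))) (at x0 within S \<inter> U)"
  proof (rule has_derivative_metric[OF _ x _ _ _ a b])
    show "bilinear (metric_in B gB d (F z))" if "z \<in> S \<inter> U" for z
      using metric_in_bilinear[OF B gB d(1) F_cimg] that by blast
    show "((\<lambda>y. metric_in B gB d y u v) has_derivative (\<lambda>h. DG h u v)) (at (F x0))" for u v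
      unfolding F_x0 by (rule has_derivative_metric_deriv[OF B gB d(1) y0_cimg])
    show "bilinear (DG h)" for h by (rule metric_deriv_bilinear[OF B gB d(1) y0_cimg])
    show "(F has_derivative dF) (at x0 within S \<inter> U)"
      using F_derivative by (rule has_derivative_subset) auto
  qed
  moreover have "((\<lambda>z. metric_in B gB d (F z) (a z) (b z)) has_derivative k') (at x0 within S \<inter> U)"
    by (rule has_derivative_transform[OF x _ k']) (use k in auto)
  ultimately have "(\<lambda>h. DG (dF h) (a x0) (b x0) + metric_in B gB d (F x0) (a' h) (b x0) +
      metric_in B gB d (F x0) (a x0) (b' h)) = k'"
    by (rule has_derivative_unique_model[OF H op x])
  from fun_cong[OF this, of v] show ?thesis by (simp only: F_x0 G_y0)
qed

lemma \<Gamma>_metric: "gp (\<Gamma> u v) w + gp v (\<Gamma> u w) = DG u v w"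
  using christoffel_metric[OF B gB d(1) y0_cimg, of u v w] by (simp add: G_y0)

text \<open>Half the derivative of \<open>\<langle>N, N\<rangle> = 1\<close>, with the derivative of
  the metric absorbed by the Christoffel terms.\<close>

lemma cov_normal: "gp (cov v) (N p) = 0"
proof -
  have dN: "(Nh has_derivative dN) (at x0 within S \<inter> UNIV)" using Nh_derivative by simp
  have "DG (dF v) (Nh x0) (Nh x0) + gp (dN v) (Nh x0) + gp (Nh x0) (dN v) = 0"
  proof (rule metric_along[OF _ _ dN dN, of "\<lambda>_. 1" "\<lambda>_. 0"])
    fix z assume "z \<in> S"
    then obtain q where q: "q \<in> fst c" "f q \<in> fst d" "z = snd c q" by auto
    show "metric_in B gB d (F z) (Nh z) (Nh z) = 1"
      using unit_normal_metric_in(2)[OF H model_UNIV A B sm N c(1) d(1) q(1,2)] cinv_chart[OF A c(1) q(1)] q(3)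
      by simp
  qed auto
  then show ?thesis
    unfolding Nh_x0 cov_eq gp_simps
    using \<Gamma>_metric[of "dF v" "N p" "N p"] gp_sym[of "N p" "dN v"] gp_sym[of "N p" "\<Gamma> (dF v) (N p)"]
    by linarith
qed

text \<open>Near a boundary point \<open>F\<close> is defined on one side only, so its second derivative is that of a
  smooth extension \<open>h\<close>.  The values of \<open>h\<close> outside \<open>S\<close> do not matter, since \<open>S\<close> determines first
  derivatives.\<close>

definition second_jet :: "(real^'n \<Rightarrow> real^'m) \<Rightarrow> (real^'n \<Rightarrow> real^'n \<Rightarrow> real^'m) \<Rightarrow>
    (real^'n \<Rightarrow> real^'n \<Rightarrow> real^'n \<Rightarrow> real^'m) \<Rightarrow> (real^'n) set \<Rightarrow> bool" where
  "second_jet h h' h'' U \<longleftrightarrow> open U \<and> x0 \<in> U \<and> (\<forall>y. y \<in> S \<longrightarrow> y \<in> U \<longrightarrow> h y = F y) \<and>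
    (\<forall>y\<in>U. (h has_derivative h' y) (at y)) \<and>
    (\<forall>y\<in>U. \<forall>u. ((\<lambda>y. h' y u) has_derivative h'' y u) (at y))"

lemma second_jet_exists: obtains h h' h'' U where "second_jet h h' h'' U"
proof (rule smooth_on_C2[OF smooth_map_chart[OF sm c(1) d(1)] x0_S])
  fix U h h' h''
  assume *: "open U" "x0 \<in> U" "\<And>y. y \<in> S \<Longrightarrow> y \<in> U \<Longrightarrow> h y = F y"
    "\<And>y. y \<in> U \<Longrightarrow> (h has_derivative h' y) (at y)"
    "\<And>y u. y \<in> U \<Longrightarrow> ((\<lambda>y. h' y u) has_derivative h'' y u) (at y)"
  show thesis
  proof (rule that)
    show "second_jet h h' h'' U"
      unfolding second_jet_def by (intro conjI allI ballI impI *)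
  qed
qed

context
  fixes h h' h'' U assumes jet: "second_jet h h' h'' U"
begin

lemma jet_deriv: "q \<in> fst c \<Longrightarrow> f q \<in> fst d \<Longrightarrow> snd c q \<in> U \<Longrightarrow> h' (snd c q) = chart_deriv c d f q"
  using jet by (intro chart_deriv_extension[OF H A sm c(1) d(1), where h = h and U = U]) (auto simp: second_jet_def)

lemma jet_x0: "h' x0 = dF"
  using jet_deriv[OF c(2) d(2)] jet by (simp add: second_jet_def dF_chart)

lemma jet_sym: "h'' x0 u v = h'' x0 v u"
  by (rule symmetric_second_derivative[of U x0 h h']) (use jet in \<open>auto simp: second_jet_def\<close>)

text \<open>The Weingarten equation, by differentiating the orthogonality of \<open>N\<close> and
  the coordinate field \<open>h' y u\<close> in direction \<open>v\<close>. The sum of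
  \<open>h''\<close> and the Christoffel term is the ambient covariant derivative of that
  field.\<close>

lemma cov_tangent: "gp (cov v) (dF u) = - gp (N p) (h'' x0 u v + \<Gamma> (dF v) (dF u))"
proof -
  have U: "open U" "x0 \<in> U" using jet by (auto simp: second_jet_def)
  have dN: "(Nh has_derivative dN) (at x0 within S \<inter> U)"
    using Nh_derivative by (rule has_derivative_subset) auto
  have d2: "((\<lambda>y. h' y u) has_derivative h'' x0 u) (at x0 within S \<inter> U)"
    using jet by (auto simp: second_jet_def intro: has_derivative_at_withinI)
  have "DG (dF v) (Nh x0) (h' x0 u) + gp (dN v) (h' x0 u) + gp (Nh x0) (h'' x0 u v) = 0"
  proof (rule metric_along[OF U dN d2, of "\<lambda>_. 0" "\<lambda>_. 0"])
    fix z assume z: "z \<in> S" "z \<in> U"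
    then obtain q where q: "q \<in> fst c" "f q \<in> fst d" "z = snd c q" by auto
    show "metric_in B gB d (F z) (Nh z) (h' z u) = 0"
      using unit_normal_metric_in(1)[OF H model_UNIV A B sm N c(1) d(1) q(1,2)] cinv_chart[OF A c(1) q(1)]
        q(3) jet_deriv[OF q(1,2)] z
      by simp
  qed auto
  then show ?thesis
    unfolding Nh_x0 cov_eq gp_simps jet_x0
    using \<Gamma>_metric[of "dF v" "N p" "dF u"] by linarith
qed

end

text \<open>The orthogonal complement of \<open>N p\<close> is a proper subspace containing the
  range of \<open>dF\<close>, and in codimension one the dimensions leave room only for
  equality.\<close>

lemma normal_space: "gp (N p) w = 0 \<Longrightarrow> w \<in> range dF"
proof -
  let ?K = "{w. gp (N p) w = 0}"
  have NN: "gp (N p) (N p) = 1" "\<And>v. gp (N p) (dF v) = 0"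
    using N p by (auto simp: unit_normal_def)
  have sub: "subspace ?K"
    by (auto simp: subspace_def gp_simps bilinear_rzero[OF gp_bilinear])
  have "N p \<notin> ?K" using NN(1) by simp
  then have "?K \<noteq> UNIV" by blast
  then have "span ?K \<noteq> UNIV" using sub span_eq_iff[of ?K] by metis
  then have "dim ?K < CARD('m)"
    using dim_eq_full[of ?K] dim_subset_UNIV[of ?K] by (simp add: order_less_le)
  moreover have "dim (range dF) = CARD('n)"
    using dim_image_eq[OF dF_linear, of UNIV] dF_inj by simp
  ultimately have "range dF = ?K"
    using NN dim by (intro subspace_dim_equal linear_subspace_image dF_linear sub) auto
  then show "gp (N p) w = 0 \<Longrightarrow> w \<in> range dF" by auto
qed

abbreviation "shape \<equiv> shape_op A B gB f N p"

text \<open>The definite description in \<open>shape_op\<close> is justified: the covariant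
  derivative of \<open>N\<close> is tangent, since it is normal to \<open>N\<close>, and
  \<open>dF\<close> is injective.\<close>

lemma shape: "dF (shape v) = - cov v"
proof -
  have "gp (N p) (- cov v) = 0"
    using cov_normal[of v] gp_sym[of "N p" "cov v"] by (simp add: gp_simps)
  then obtain w where w: "dF w = - cov v" using normal_space by (metis rangeE)
  then have "\<exists>!w. dF w = - cov v" using dF_inj by (metis injD)
  then show ?thesis unfolding shape_op_def by (rule theI')
qed

lemma shape_linear: "linear shape"
proof (rule linearI)
  show "shape (u + v) = shape u + shape v" for u v
    by (rule injD[OF dF_inj])
       (simp add: shape linear_add[OF dF_linear] linear_add[OF cov_linear])
  show "shape (r *\<^sub>R v) = r *\<^sub>R shape v" for r v
    by (rule injD[OF dF_inj])
       (simp add: shape linear_scale[OF dF_linear] linear_scale[OF cov_linear])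
qed

lemma shape_second_jet:
  assumes "second_jet h h' h'' U"
  shows "gA p (shape v) u = gp (N p) (h'' x0 v u + \<Gamma> (dF v) (dF u))"
  unfolding dF_iso[symmetric] shape
  using cov_tangent[OF assms, of v u] jet_sym[OF assms, of u v] by (simp add: gp_simps)

text \<open>Mixed second derivatives commute and the ambient connection has no torsion.\<close>

lemma shape_symmetric: "gA p (shape v) u = gA p v (shape u)"
proof -
  obtain h h' h'' U where jet: "second_jet h h' h'' U" by (rule second_jet_exists)
  show ?thesis
    using shape_second_jet[OF jet, of v u] shape_second_jet[OF jet, of u v] jet_sym[OF jet, of v u]
      christoffel_sym[OF B gB d(1) y0_cimg, of "dF v" "dF u"] gA p
    by (simp add: riemannian_metric_def)
qed

text \<open>The Gauss formula: the induced connection is the tangential part of the ambient one. The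
  derivative \<open>*\<close> of the induced metric is taken for the three orders of
  \<open>u\<close>, \<open>v\<close>, \<open>w\<close> that occur in the Koszul formula, and the
  terms with \<open>h''\<close> combine by symmetry.\<close>

lemma levi_civita_induced:
  assumes jet: "second_jet h h' h'' U" and UNIV: "H = UNIV"
  shows "gA p (christoffel A gA c x0 u v) w = gp (h'' x0 u v + \<Gamma> (dF u) (dF v)) (dF w)"
proof -
  have A': "smooth_atlas UNIV A" using A UNIV by simp
  have x0: "x0 \<in> cimg c" using c by (auto simp: cimg_def)
  have U: "open U" "x0 \<in> U" using jet by (auto simp: second_jet_def)
  have d2: "((\<lambda>y. h' y u) has_derivative h'' x0 u) (at x0 within S \<inter> U)" for u
    using jet by (auto simp: second_jet_def intro: has_derivative_at_withinI)
  have *: "DG (dF u) (dF v) (dF w) + gp (h'' x0 v u) (dF w) + gp (dF v) (h'' x0 w u) =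
      metric_deriv A gA c x0 u v w" for u v w
  proof -
    have "DG (dF u) (h' x0 v) (h' x0 w) + gp (h'' x0 v u) (h' x0 w) + gp (h' x0 v) (h'' x0 w u) =
      metric_deriv A gA c x0 u v w"
    proof (rule metric_along[OF U d2 d2])
      fix z assume z: "z \<in> S" "z \<in> U"
      then obtain q where q: "q \<in> fst c" "f q \<in> fst d" "z = snd c q" by auto
      show "metric_in B gB d (F z) (h' z v) (h' z w) = metric_in A gA c z v w"
        using isometric_metric_in[OF H model_UNIV A B iso c(1) d(1) q(1,2)]
          cinv_chart[OF A c(1) q(1)] jet_deriv[OF jet q(1,2)] z q(3) by simp
    qed (rule has_derivative_at_withinI[OF has_derivative_metric_deriv[OF A' gA c(1) x0]])
    then show ?thesis by (simp add: jet_x0[OF jet])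
  qed
  note K = christoffel_koszul(1)[OF A' gA c(1) x0, of u v w]
    christoffel_koszul(1)[OF B gB d(1) y0_cimg, of "dF u" "dF v" "dF w"]
  then have K: "2 * gA p (christoffel A gA c x0 u v) w = metric_deriv A gA c x0 u v w +
      metric_deriv A gA c x0 v u w - metric_deriv A gA c x0 w u v"
    "2 * gp (\<Gamma> (dF u) (dF v)) (dF w) = DG (dF u) (dF v) (dF w) + DG (dF v) (dF u) (dF w) -
      DG (dF w) (dF u) (dF v)"
    by (simp_all add: G_y0 metric_in_chart_at[OF H A p])
  show ?thesis
    unfolding gp_simps
    using K *[of u v w] *[of v u w] *[of w u v] gp_sym[of "dF u" "h'' x0 w v"] gp_sym[of "dF v" "h'' x0 w u"]
      gp_sym[of "dF u" "h'' x0 v w"]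
    unfolding jet_sym[OF jet, of v u] jet_sym[OF jet, of w u] jet_sym[OF jet, of w v] by linarith
qed

end

section \<open>Boundary points and boundary curves\<close>

text \<open>If a boundary point had positive boundary coordinate in the chart \<open>c\<close>, the boundary
  coordinate of a second chart, expressed in \<open>c\<close>, would have an interior minimum there, and the
  chart change would be singular.\<close>

lemma boundary_coordinate:
  fixes A :: "('x, 'n::finite) atlas"
  assumes A: "smooth_atlas half_space A" and p: "p \<in> boundary A" and c: "c \<in> A" "p \<in> fst c"
  shows "snd c p $ bdy_index = 0"
proof (rule ccontr)
  assume nz: "snd c p $ bdy_index \<noteq> 0"
  obtain c' where c': "c' \<in> A" "p \<in> fst c'" "snd c' p $ bdy_index = 0"
    using p by (auto simp: boundary_def)
  note H = model_half_space
  have half: "snd e q $ bdy_index \<ge> 0" if "e \<in> A" "q \<in> fst e" for e q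
  proof -
    have "cimg e \<subseteq> half_space"
      using A that(1) openin_imp_subset by (auto simp: smooth_atlas_def)
    then show ?thesis using that by (auto simp: cimg_def half_space_def)
  qed
  let ?L = "chart_change c c' p" and ?W = "snd c ` {x \<in> fst c. id x \<in> fst c'}"
  note sm = smooth_map_on_id[OF A]
  obtain T where T: "open T" "?W = half_space \<inter> T"
    using chart_dom_open[OF A sm c(1) c'(1)] by (auto simp: openin_open)
  define V where "V = T \<inter> {x. 0 < x $ bdy_index}"
  have "open {x::real^'n. 0 < x $ bdy_index}"
    by (intro open_Collect_less continuous_intros)
  then have V: "open V" "V \<subseteq> ?W" "snd c p \<in> V"
    using T half[OF c] nz c c' by (auto simp: V_def half_space_def)
  have "((snd c' \<circ> id \<circ> cinv c) has_derivative ?L) (at (snd c p) within V)"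
    unfolding chart_change_eq_chart_deriv
    by (rule has_derivative_subset[OF has_derivative_chart_deriv[OF sm]]) (use c c' V in auto)
  then have "((snd c' \<circ> id \<circ> cinv c) has_derivative ?L) (at (snd c p))"
    using V by (simp add: at_within_open[of _ V])
  then have D: "((\<lambda>x. (snd c' \<circ> id \<circ> cinv c) x $ bdy_index) has_derivative (\<lambda>h. ?L h $ bdy_index)) (at (snd c p))"
    by (rule bounded_linear.has_derivative[OF bounded_linear_vec_nth])
  have "(snd c' \<circ> id \<circ> cinv c) (snd c p) $ bdy_index \<le> (snd c' \<circ> id \<circ> cinv c) x $ bdy_index"
    if "x \<in> V" for x
  proof -
    obtain q where "q \<in> fst c" "q \<in> fst c'" "x = snd c q" using subsetD[OF V(2) \<open>x \<in> V\<close>] by auto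
    then show ?thesis using c' half[OF c'(1)] cinv_chart[OF A c] cinv_chart[OF A c(1)] by simp
  qed
  then have "(\<lambda>h. ?L h $ bdy_index) = (\<lambda>h. 0)"
    by (intro differential_zero_maxmin[OF V(3,1) D]) blast
  then have "?L (chart_change c' c p (axis bdy_index 1)) $ bdy_index = 0" by (rule fun_cong)
  then show False
    using chart_change_inverse[OF H A c'(1) c(1) c'(2) c(2)] by simp
qed

text \<open>The curve is a straight segment in the chart at \<open>p\<close>, on which the boundary
  coordinate stays 0. This bounds the tangent space of the boundary from below, as needed for
  counting its basis vectors.\<close>

lemma tangent_to_boundary:
  fixes A :: "('x, 'n::finite) atlas"
  assumes A: "smooth_atlas half_space A" and p: "p \<in> boundary A" and v: "v $ bdy_index = 0"
  shows "v \<in> tangent_to A (boundary A) p"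
proof -
  have pc: "p \<in> carrier A" using p by (auto simp: boundary_def carrier_def)
  define c where "c = chart_at A p"
  have c: "c \<in> A" "p \<in> fst c" using pc by (auto simp: c_def chart_at_in in_chart_at)
  define x where "x = snd c p"
  have x0: "x $ bdy_index = 0" using boundary_coordinate[OF A p c] by (simp add: x_def)
  have "openin (top_of_set half_space) (cimg c)" using A c by (simp add: smooth_atlas_def)
  moreover have "x \<in> cimg c" using c by (auto simp: x_def cimg_def)
  ultimately obtain r where r: "r > 0" "ball x r \<inter> half_space \<subseteq> cimg c"
    by (meson openin_contains_ball)
  define \<epsilon> where "\<epsilon> = r / (norm v + 1)"
  have np: "norm v + 1 > 0" by (smt (verit) norm_ge_zero)
  have \<epsilon>: "\<epsilon> > 0" using r np by (simp add: \<epsilon>_def)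
  define \<gamma> where "\<gamma> t = cinv c (x + t *\<^sub>R v)" for t
  have img: "x + t *\<^sub>R v \<in> cimg c" if "t \<in> {-\<epsilon><..<\<epsilon>}" for t
  proof -
    have "\<bar>t\<bar> < \<epsilon>" using that by auto
    then have "\<bar>t\<bar> * (norm v + 1) < r" using np by (simp add: \<epsilon>_def pos_less_divide_eq)
    then have "norm (t *\<^sub>R v) < r" by (simp add: algebra_simps)
    then have "x + t *\<^sub>R v \<in> ball x r" by (simp add: dist_norm)
    moreover have "x + t *\<^sub>R v \<in> half_space" using x0 v by (simp add: half_space_def)
    ultimately show ?thesis using r by blast
  qed
  have \<gamma>: "\<gamma> t \<in> fst c" "snd c (\<gamma> t) = x + t *\<^sub>R v" if "t \<in> {-\<epsilon><..<\<epsilon>}" for t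
    using img[OF that] inv_into_into[of "x + t *\<^sub>R v" "snd c" "fst c"]
      f_inv_into_f[of "x + t *\<^sub>R v" "snd c" "fst c"] by (auto simp: \<gamma>_def cinv_def cimg_def)
  have "velocity A \<gamma> \<epsilon> p v"
    unfolding velocity_def Let_def c_def[symmetric]
  proof (intro conjI)
    show "\<gamma> 0 = p" using cinv_chart[OF A c] by (simp add: \<gamma>_def x_def)
    show "\<gamma> ` {-\<epsilon><..<\<epsilon>} \<subseteq> fst c" using \<gamma> by auto
    show "smooth_on {-\<epsilon><..<\<epsilon>} (snd c \<circ> \<gamma>)"
      unfolding smooth_on_def
    proof (intro ballI exI conjI allI)
      show "Ck_on k UNIV (\<lambda>t. x + t *\<^sub>R v)" for k by (rule Ck_on_line)
    qed (use \<gamma> in auto)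
    have "((\<lambda>t. x + t *\<^sub>R v) has_vector_derivative v) (at 0)"
      by (auto intro!: derivative_eq_intros)
    then show "((snd c \<circ> \<gamma>) has_vector_derivative v) (at 0)"
      by (rule has_vector_derivative_transform_within_open[of _ _ _ "{-\<epsilon><..<\<epsilon>}"]) (use \<gamma> \<epsilon> in auto)
  qed (rule \<epsilon>)
  moreover have "\<gamma> ` {-\<epsilon><..<\<epsilon>} \<subseteq> boundary A"
    using \<gamma> c x0 v by (auto simp: boundary_def intro!: bexI[of _ c])
  ultimately show ?thesis unfolding tangent_to_def by blast
qed

lemma orthonormal_independent:
  fixes B :: "real^'n::finite \<Rightarrow> real^'n \<Rightarrow> real"
  assumes B: "bilinear B"
    and on: "\<And>i j. i < length ws \<Longrightarrow> j < length ws \<Longrightarrow> B (ws ! i) (ws ! j) = (if i = j then 1 else 0)"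
  shows "independent (set ws)" and "distinct ws" and "length ws \<le> CARD('n)"
proof -
  show dist: "distinct ws"
    unfolding distinct_conv_nth
  proof (intro allI impI notI)
    fix i j assume "i < length ws" "j < length ws" "i \<noteq> j" "ws ! i = ws ! j"
    then show False using on[of i j] on[of i i] by simp
  qed
  have on': "B x y = (if x = y then 1 else 0)" if "x \<in> set ws" "y \<in> set ws" for x y
    using that on dist unfolding in_set_conv_nth by (auto simp: nth_eq_iff_index_eq)
  show ind: "independent (set ws)"
  proof (rule independent_if_scalars_zero)
    fix f x assume 0: "(\<Sum>y\<in>set ws. f y *\<^sub>R y) = 0" and x: "x \<in> set ws"
    interpret linear "\<lambda>y. B y x" using B by (simp add: bilinear_def)
    have "(\<Sum>y\<in>set ws. f y * B y x) = 0"
      using arg_cong[OF 0, of "\<lambda>y. B y x"] by (simp add: sum scale zero)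
    also have "(\<Sum>y\<in>set ws. f y * B y x) = (\<Sum>y\<in>set ws. if y = x then f y else 0)"
      by (rule sum.cong) (use on' x in auto)
    finally show "f x = 0" using x by simp
  qed simp
  show "length ws \<le> CARD('n)"
    using independent_bound[OF ind] distinct_card[OF dist] by simp
qed

text \<open>The length of \<open>es\<close> is not part of \<open>orthonormal_basis\<close>. A
  coordinate hyperplane inside the span of \<open>es\<close> bounds it from below; the independence
  of \<open>es\<close> together with \<nu> bounds it from above.\<close>

lemma conormal_frame_length:
  fixes A :: "('x, 'n::finite) atlas"
  assumes A: "smooth_atlas half_space A" and p: "p \<in> boundary A" and B: "bilinear B"
    and es: "orthonormal_basis B (tangent_to A (boundary A) p) es"
    and \<nu>: "\<And>i j. i \<le> length es \<Longrightarrow> j \<le> length es \<Longrightarrow>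
      B ((es @ [\<nu>]) ! i) ((es @ [\<nu>]) ! j) = (if i = j then 1 else 0)"
  shows "CARD('n) = Suc (length es)"
proof (rule antisym)
  have "{v::real^'n. v $ bdy_index = 0} = {v. axis bdy_index 1 \<bullet> v = 0}"
    by (simp add: inner_axis')
  then have "dim {v::real^'n. v $ bdy_index = 0} = CARD('n) - 1"
    using dim_hyperplane[of "axis bdy_index 1 :: real^'n"] by (simp add: axis_eq_0_iff)
  moreover have "{v::real^'n. v $ bdy_index = 0} \<subseteq> span (set es)"
    using es tangent_to_boundary[OF A p] by (auto simp: orthonormal_basis_def)
  then have "dim {v::real^'n. v $ bdy_index = 0} \<le> card (set es)"
    by (intro dim_le_card) auto
  ultimately show "CARD('n) \<le> Suc (length es)" using card_length[of es] by linarith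
  show "Suc (length es) \<le> CARD('n)"
    using orthonormal_independent(3)[OF B, of "es @ [\<nu>]"] \<nu> by (simp add: less_Suc_eq_le)
qed

lemma curve_jet:
  assumes "Ck_on (Suc (Suc 0)) J x"
  obtains x' x'' where "\<And>s. s \<in> J \<Longrightarrow> (x has_vector_derivative x' s) (at s)"
    "\<And>s. s \<in> J \<Longrightarrow> (x' has_vector_derivative x'' s) (at s)"
proof -
  have lin: "f' h = h *\<^sub>R f' 1" if "(f has_derivative f') (at s)" for f :: "real \<Rightarrow> 'a" and f' h s
    using linear_scale[OF has_derivative_linear[OF that], of h 1] by simp
  obtain f' where f': "\<And>s. s \<in> J \<Longrightarrow> (x has_derivative f' s) (at s)" "Ck_on (Suc 0) J (\<lambda>s. f' s 1)"
    using assms unfolding Ck_on.simps(2)[of "Suc 0"] by blast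
  then obtain f'' where f'': "\<And>s. s \<in> J \<Longrightarrow> ((\<lambda>s. f' s 1) has_derivative f'' s) (at s)"
    unfolding Ck_on.simps by blast
  show thesis
  proof (rule that)
    show "(x has_vector_derivative f' s 1) (at s)" if "s \<in> J" for s
      unfolding has_vector_derivative_def using f'(1)[OF that] lin[OF f'(1)[OF that]]
      by (metis (no_types, lifting) ext)
    show "((\<lambda>s. f' s 1) has_vector_derivative f'' s 1) (at s)" if "s \<in> J" for s
      unfolding has_vector_derivative_def using f''[OF that] lin[OF f''[OF that]]
      by (metis (no_types, lifting) ext)
  qed
qed

section \<open>Images of boundary curves\<close>

text \<open>Smoothness of \<open>f\<close> on \<open>S\<close> provides only a local extension
  \<open>h2\<close> of its coordinate expression, and that of \<gamma> only a local extension
  \<open>h1\<close>. The composite of the extensions is smooth and represents the image curve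
  wherever both are valid.\<close>

lemma pushed_curve_smooth:
  assumes A: "smooth_atlas H A" and f: "smooth_map_on A S P f"
    and vel: "velocity A \<gamma> \<epsilon> p v" and \<gamma>S: "\<gamma> ` {-\<epsilon><..<\<epsilon>} \<subseteq> S" and pc: "p \<in> carrier A"
    and t: "t \<in> {-\<epsilon><..<\<epsilon>}" and d: "d \<in> P" "f (\<gamma> t) \<in> fst d"
  obtains J where "open J" "t \<in> J" "J \<subseteq> {-\<epsilon><..<\<epsilon>}" "\<And>s. s \<in> J \<Longrightarrow> f (\<gamma> s) \<in> fst d"
    "\<And>k. Ck_on k J (\<lambda>s. snd d (f (\<gamma> s)))"
proof -
  define c where "c = chart_at A p"
  have c: "c \<in> A" "p \<in> fst c" using pc by (auto simp: c_def chart_at_in in_chart_at)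
  let ?I = "{-\<epsilon><..<\<epsilon>}"
  have \<gamma>c: "\<gamma> s \<in> fst c" if "s \<in> ?I" for s
    using vel that by (auto simp: velocity_def Let_def c_def)
  have sm: "smooth_on ?I (snd c \<circ> \<gamma>)"
    using vel by (simp add: velocity_def Let_def c_def)
  define X where "X = {q \<in> S \<inter> fst c. f q \<in> fst d}"
  have "openin (subtopology (mtop A) S) X" and smX: "smooth_on (snd c ` X) (snd d \<circ> f \<circ> cinv c)"
    using f c(1) d(1) unfolding smooth_map_on_def X_def by blast+
  then obtain T where T: "openin (mtop A) T" "X = T \<inter> S"
    by (auto simp: openin_subtopology)
  have "openin (top_of_set (cimg c)) (snd c ` (T \<inter> fst c))"
    using T(1) c(1) by (simp add: openin_mtop[OF A])
  then obtain V where V: "open V" "snd c ` (T \<inter> fst c) = cimg c \<inter> V"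
    by (auto simp: openin_open)
  obtain U1 h1 where 1: "open U1" "t \<in> U1" "\<And>k. Ck_on k U1 h1"
    "\<And>s. s \<in> ?I \<Longrightarrow> s \<in> U1 \<Longrightarrow> h1 s = (snd c \<circ> \<gamma>) s"
    by (rule smooth_onD[OF sm t]) blast
  have tX: "\<gamma> t \<in> X" using \<gamma>S \<gamma>c[OF t] t d by (auto simp: X_def)
  then have "snd c (\<gamma> t) \<in> snd c ` X" by blast
  from smooth_onD[OF smX this] obtain U2 h2 where 2: "open U2" "snd c (\<gamma> t) \<in> U2" "\<And>k. Ck_on k U2 h2"
    "\<And>y. y \<in> snd c ` X \<Longrightarrow> y \<in> U2 \<Longrightarrow> h2 y = (snd d \<circ> f \<circ> cinv c) y"
    by blast
  \<comment> \<open>Besides the domain of \<open>h1\<close>, two conditions are imposed: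
    \<open>V\<close> keeps the image of \<gamma> under \<open>f\<close> in the domain of
    \<open>d\<close>, and \<open>U2\<close> keeps \<open>h2\<close> applicable.\<close>
  define J where "J = (?I \<inter> U1) \<inter> h1 -` (V \<inter> U2)"
  have "continuous_on U1 h1" using 1(3)[of 0] by simp
  then have "continuous_on (?I \<inter> U1) h1" by (rule continuous_on_subset) auto
  then have oJ: "open J"
    unfolding J_def using 1(1) 2(1) V(1) by (intro continuous_open_preimage) auto
  have tJ: "t \<in> J"
    using t 1(2) 1(4)[OF t 1(2)] 2(2) V(2) tX T(2) \<gamma>c[OF t] by (auto simp: J_def)
  have J: "\<gamma> s \<in> X \<and> snd c (\<gamma> s) \<in> U2 \<and> h1 s = snd c (\<gamma> s)" if "s \<in> J" for s
  proof -
    have s: "s \<in> ?I" "s \<in> U1" "h1 s \<in> V" "h1 s \<in> U2" using that by (auto simp: J_def)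
    have h1: "h1 s = snd c (\<gamma> s)" using 1(4)[OF s(1,2)] by simp
    have "snd c (\<gamma> s) \<in> snd c ` (T \<inter> fst c)"
      unfolding V(2) using s \<gamma>c[OF s(1)] h1 by (auto simp: cimg_def)
    moreover have "inj_on (snd c) (fst c)" using A c by (simp add: smooth_atlas_def)
    ultimately have "\<gamma> s \<in> T" using \<gamma>c[OF s(1)] by (auto dest: inj_onD)
    then show ?thesis using T(2) \<gamma>S s h1 by auto
  qed
  have "Ck_on k J (\<lambda>s. snd d (f (\<gamma> s)))" for k
  proof (rule Ck_on_cong[OF oJ])
    show "Ck_on k J (\<lambda>s. h2 (h1 s))"
      by (rule Ck_on_compose[OF _ Ck_on_subset[OF 1(3)] 2(3)]) (use J in \<open>auto simp: J_def\<close>)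
    show "h2 (h1 s) = snd d (f (\<gamma> s))" if "s \<in> J" for s
      using J[OF that] 2(4)[of "h1 s"] cinv_chart[OF A c(1), of "\<gamma> s"] by (auto simp: X_def)
  qed
  moreover have "J \<subseteq> ?I" by (auto simp: J_def)
  moreover have "f (\<gamma> s) \<in> fst d" if "s \<in> J" for s
    using J[OF that] by (simp add: X_def)
  ultimately show thesis using oJ tJ by (intro that)
qed

text \<open>\<open>tangent_to\<close> asks for a curve that starts at parameter 0 and for its
  velocity in the chart selected at its base point. The curve is therefore shifted by
  \<open>t\<close>, and its velocity is carried from \<open>d\<close> to that chart.\<close>

lemma pushed_curve_tangent:
  assumes A: "smooth_atlas H A" and f: "smooth_map_on A S P f" and P: "smooth_atlas UNIV P"
    and vel: "velocity A \<gamma> \<epsilon> p v" and \<gamma>S: "\<gamma> ` {-\<epsilon><..<\<epsilon>} \<subseteq> S" and pc: "p \<in> carrier A"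
    and t: "t \<in> {-\<epsilon><..<\<epsilon>}" and d: "d \<in> P" "f (\<gamma> t) \<in> fst d"
    and x': "((\<lambda>s. snd d (f (\<gamma> s))) has_vector_derivative x') (at t)"
  shows "chart_change d (chart_at P (f (\<gamma> t))) (f (\<gamma> t)) x' \<in> tangent_to P (f ` S) (f (\<gamma> t))"
proof -
  let ?q = "f (\<gamma> t)"
  define e where "e = chart_at P ?q"
  have e: "e \<in> P" "?q \<in> fst e"
    using in_carrier[OF d] by (auto simp: e_def chart_at_in in_chart_at)
  obtain J where J: "open J" "t \<in> J" "J \<subseteq> {-\<epsilon><..<\<epsilon>}" "\<And>s. s \<in> J \<Longrightarrow> f (\<gamma> s) \<in> fst e"
    "\<And>k. Ck_on k J (\<lambda>s. snd e (f (\<gamma> s)))"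
    by (rule pushed_curve_smooth[OF A f vel \<gamma>S pc t e]) blast
  obtain K where K: "open K" "t \<in> K" "\<And>s. s \<in> K \<Longrightarrow> f (\<gamma> s) \<in> fst d"
    by (rule pushed_curve_smooth[OF A f vel \<gamma>S pc t d]) blast
  obtain \<delta> where \<delta>: "\<delta> > 0" "ball t \<delta> \<subseteq> J" using J openE by blast
  have inJ: "t + s \<in> J" if "s \<in> {-\<delta><..<\<delta>}" for s
    using that \<delta> by (intro subsetD[OF \<delta>(2)]) (auto simp: dist_real_def)
  define w where "w = chart_change d e ?q x'"
  have D: "((\<lambda>s. snd e (f (\<gamma> s))) has_vector_derivative w) (at t)"
  proof -
    let ?W = "snd d ` {x \<in> fst d. id x \<in> fst e}"
    note sm = smooth_map_on_id[OF P]
    have W: "open ?W" "snd d ?q \<in> ?W"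
      using chart_dom_open[OF P sm d(1) e(1)] d e by auto
    have "((snd e \<circ> id \<circ> cinv d) has_derivative chart_change d e ?q) (at (snd d ?q))"
      using has_derivative_chart_deriv[OF sm d(1) e(1) d(2)] e
      unfolding chart_change_eq_chart_deriv at_within_open[OF W(2,1)] by simp
    from diff_chain_at[OF x'[unfolded has_vector_derivative_def] this]
    have "((\<lambda>s. snd e (cinv d (snd d (f (\<gamma> s))))) has_derivative (\<lambda>h. chart_change d e ?q (h *\<^sub>R x'))) (at t)"
      by (simp add: o_def)
    moreover have "(\<lambda>h. chart_change d e ?q (h *\<^sub>R x')) = (\<lambda>h. h *\<^sub>R w)"
      using linear_scale[OF linear_chart_change[OF P d(1) e(1) d(2) e(2)]] by (simp add: w_def)
    ultimately have "((\<lambda>s. snd e (cinv d (snd d (f (\<gamma> s))))) has_vector_derivative w) (at t)"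
      by (simp add: has_vector_derivative_def)
    then show ?thesis
      by (rule has_vector_derivative_transform_within_open[OF _ K(1,2)])
         (use K cinv_chart[OF P d(1)] in simp)
  qed
  have "velocity P (\<lambda>s. f (\<gamma> (t + s))) \<delta> ?q w"
    unfolding velocity_def Let_def e_def[symmetric]
  proof (intro conjI)
    show "(\<lambda>s. f (\<gamma> (t + s))) ` {-\<delta><..<\<delta>} \<subseteq> fst e" using inJ J(4) by auto
    have shift: "Ck_on k {-\<delta><..<\<delta>} (\<lambda>s. snd e (f (\<gamma> (t + s))))" for k
      by (rule Ck_on_compose[of "\<lambda>s. t + s" _ J k "\<lambda>s. snd e (f (\<gamma> s))"])
         (use inJ J(5) Ck_on_line[of k _ t "1::real"] in auto)
    show "smooth_on {-\<delta><..<\<delta>} (snd e \<circ> (\<lambda>s. f (\<gamma> (t + s))))"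
      unfolding smooth_on_def o_def
      by (intro ballI exI[of _ "{-\<delta><..<\<delta>}"] exI[of _ "\<lambda>s. snd e (f (\<gamma> (t + s)))"])
         (use shift in auto)
    have "((\<lambda>s. t + s) has_vector_derivative 1) (at (0::real))"
      by (auto intro!: derivative_eq_intros)
    from vector_diff_chain_at[OF this, of "\<lambda>s. snd e (f (\<gamma> s))" w] D
    show "((snd e \<circ> (\<lambda>s. f (\<gamma> (t + s)))) has_vector_derivative w) (at 0)"
      by (simp add: o_def)
  qed (use \<delta> in auto)
  moreover have "(\<lambda>s. f (\<gamma> (t + s))) ` {-\<delta><..<\<delta>} \<subseteq> f ` S"
    using inJ J(3) \<gamma>S by blast
  ultimately show ?thesis
    unfolding tangent_to_def w_def e_def by blast
qed

section \<open>The shape operator of \<Sigma> in P\<close>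

text \<open>A derivative within \<Sigma> is determined only on tangent vectors. \<open>D\<close> is
  the one selected in \<open>cov_deriv\<close>; it is the same for all \<open>v\<close>, which makes
  the shape operator linear on the whole space.\<close>

lemma shape_op_sub_chart:
  assumes P: "smooth_atlas UNIV P" and \<eta>: "unit_normal_sub P gP \<Sigma> \<eta>"
    and q: "q \<in> \<Sigma>" "q \<in> carrier P" and d: "d = chart_at P q"
  obtains D where
    "((\<lambda>q. vec_in P d q (\<eta> q)) \<circ> cinv d has_derivative D) (at (snd d q) within snd d ` (\<Sigma> \<inter> fst d))"
    "\<And>v. shape_op_sub P gP \<Sigma> \<eta> q v = - (D v + christoffel P gP d (snd d q) v (\<eta> q))"
proof -
  have dP: "d \<in> P" "q \<in> fst d" using q by (auto simp: d chart_at_in in_chart_at)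
  have eq: "{x \<in> \<Sigma> \<inter> fst d. id x \<in> fst d} = \<Sigma> \<inter> fst d" by auto
  let ?h = "(\<lambda>q. vec_in P d q (\<eta> q)) \<circ> cinv d"
  let ?D = "frechet_derivative ?h (at (snd d q) within snd d ` (\<Sigma> \<inter> fst d))"
  have "smooth_on (snd d ` {x \<in> \<Sigma> \<inter> fst d. id x \<in> fst d}) ((\<lambda>q. vec_in P d (id q) (\<eta> q)) \<circ> cinv d)"
    using \<eta> dP(1) unfolding unit_normal_sub_def smooth_field_along_def by blast
  then have "smooth_on (snd d ` (\<Sigma> \<inter> fst d)) ?h" unfolding eq by simp
  then have D: "(?h has_derivative ?D) (at (snd d q) within snd d ` (\<Sigma> \<inter> fst d))"
    using smooth_on_differentiable dP q frechet_derivative_works by blast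
  have "mdiff P P id q v = v" for v
    using chart_change_self[OF model_UNIV P dP]
    by (simp add: mdiff_eq_chart_deriv chart_change_eq_chart_deriv d)
  then have "shape_op_sub P gP \<Sigma> \<eta> q v = - (?D v + christoffel P gP d (snd d q) v (\<eta> q))" for v
    unfolding shape_op_sub_def cov_deriv_def Let_def d[symmetric] id_apply
    by (simp add: d[symmetric] Int_def)
  with D show thesis by (rule that)
qed

lemma shape_op_sub_linear:
  assumes P: "smooth_atlas UNIV P" and gP: "riemannian_metric P gP"
    and \<eta>: "unit_normal_sub P gP \<Sigma> \<eta>" and q: "q \<in> \<Sigma>" "q \<in> carrier P"
  shows "linear (shape_op_sub P gP \<Sigma> \<eta> q)"
proof -
  let ?d = "chart_at P q"
  obtain D where D:
    "((\<lambda>q. vec_in P ?d q (\<eta> q)) \<circ> cinv ?d has_derivative D) (at (snd ?d q) within snd ?d ` (\<Sigma> \<inter> fst ?d))"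
    "\<And>v. shape_op_sub P gP \<Sigma> \<eta> q v = - (D v + christoffel P gP ?d (snd ?d q) v (\<eta> q))"
    by (rule shape_op_sub_chart[OF P \<eta> q refl]) blast
  have "snd ?d q \<in> cimg ?d" using q by (auto simp: cimg_def in_chart_at)
  from christoffel_linear[OF P gP chart_at_in[OF q(2)] this]
  have "linear (\<lambda>v. - (D v + christoffel P gP ?d (snd ?d q) v (\<eta> q)))"
    using has_derivative_linear[OF D(1)] by (intro linear_compose_neg linear_compose_add)
  moreover have "shape_op_sub P gP \<Sigma> \<eta> q = (\<lambda>v. - (D v + christoffel P gP ?d (snd ?d q) v (\<eta> q)))"
    by (rule ext) (rule D(2))
  ultimately show ?thesis by (simp only:)
qed

text \<open>The derivative at 0 of the vanishing product of \<eta> and the velocity: the quadratic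
  form of the shape operator is the \<eta>-component of the covariant acceleration.\<close>

lemma shape_op_sub_curve:
  assumes P: "smooth_atlas UNIV P" and gP: "riemannian_metric P gP"
    and \<eta>: "unit_normal_sub P gP \<Sigma> \<eta>" and q: "\<gamma> 0 = q" "q \<in> carrier P"
    and d: "d = chart_at P q"
    and J: "open J" "0 \<in> J" and \<gamma>: "\<And>s. s \<in> J \<Longrightarrow> \<gamma> s \<in> \<Sigma>" "\<And>s. s \<in> J \<Longrightarrow> \<gamma> s \<in> fst d"
    and x': "\<And>s. s \<in> J \<Longrightarrow> ((\<lambda>s. snd d (\<gamma> s)) has_vector_derivative x' s) (at s)"
    and x'': "(x' has_vector_derivative x'') (at 0)"
    and tan: "\<And>s. s \<in> J \<Longrightarrow> chart_change d (chart_at P (\<gamma> s)) (\<gamma> s) (x' s) \<in> tangent_to P \<Sigma> (\<gamma> s)"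
  shows "gP q (shape_op_sub P gP \<Sigma> \<eta> q (x' 0)) (x' 0) =
    gP q (\<eta> q) (x'' + christoffel P gP d (snd d q) (x' 0) (x' 0))"
proof -
  have q\<Sigma>: "q \<in> \<Sigma>" using \<gamma>(1)[OF J(2)] q by simp
  have dP: "d \<in> P" "q \<in> fst d" using q by (auto simp: d chart_at_in in_chart_at)
  have y0: "snd d q \<in> cimg d" using dP by (auto simp: cimg_def)
  obtain D where D:
    "((\<lambda>q. vec_in P d q (\<eta> q)) \<circ> cinv d has_derivative D) (at (snd d q) within snd d ` (\<Sigma> \<inter> fst d))"
    "\<And>v. shape_op_sub P gP \<Sigma> \<eta> q v = - (D v + christoffel P gP d (snd d q) v (\<eta> q))"
    by (rule shape_op_sub_chart[OF P \<eta> q\<Sigma> q(2) d]) blast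
  let ?x = "\<lambda>s. snd d (\<gamma> s)" and ?e = "\<lambda>q. vec_in P d q (\<eta> q)"
  have dx: "(?x has_derivative (\<lambda>h. h *\<^sub>R x' 0)) (at 0 within J)"
    using x'[OF J(2)] unfolding has_vector_derivative_def by (rule has_derivative_at_withinI)
  \<comment> \<open>The curve runs inside \<Sigma>, so a derivative of \<eta> within \<Sigma>
    suffices for the chain rule.\<close>
  have "((?e \<circ> cinv d) has_derivative D) (at (?x 0) within ?x ` J)"
    using D(1) unfolding q(1)[symmetric] by (rule has_derivative_subset) (use \<gamma> in auto)
  from diff_chain_within[OF dx this]
  have "((?e \<circ> cinv d) \<circ> ?x has_derivative D \<circ> (\<lambda>h. h *\<^sub>R x' 0)) (at 0 within J)" .
  then have de: "((\<lambda>s. ?e (\<gamma> s)) has_derivative D \<circ> (\<lambda>h. h *\<^sub>R x' 0)) (at 0 within J)"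
    by (rule has_derivative_transform[OF J(2), rotated]) (use \<gamma>(2) cinv_chart[OF P dP(1)] in simp)
  have dx': "(x' has_derivative (\<lambda>h. h *\<^sub>R x'')) (at 0 within J)"
    using x'' unfolding has_vector_derivative_def by (rule has_derivative_at_withinI)
  let ?G = "metric_in P gP d" and ?DG = "metric_deriv P gP d (snd d q)"
  have "((\<lambda>s. ?G (?x s) (?e (\<gamma> s)) (x' s)) has_derivative
     (\<lambda>h. ?DG (h *\<^sub>R x' 0) (?e (\<gamma> 0)) (x' 0) + ?G (?x 0) ((D \<circ> (\<lambda>h. h *\<^sub>R x' 0)) h) (x' 0) +
       ?G (?x 0) (?e (\<gamma> 0)) (h *\<^sub>R x''))) (at 0 within J)"
  proof (rule has_derivative_metric[OF _ J(2) _ _ dx de dx'])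
    show "bilinear (?G (?x s))" if "s \<in> J" for s
      by (rule metric_in_bilinear[OF P gP dP(1)]) (use \<gamma>(2)[OF that] in \<open>auto simp: cimg_def\<close>)
    show "((\<lambda>y. ?G y u v) has_derivative (\<lambda>h. ?DG h u v)) (at (?x 0))" for u v
      unfolding q(1) by (rule has_derivative_metric_deriv[OF P gP dP(1) y0])
    show "bilinear (?DG h)" for h by (rule metric_deriv_bilinear[OF P gP dP(1) y0])
  qed
  moreover have "?G (?x s) (?e (\<gamma> s)) (x' s) = 0" if s: "s \<in> J" for s
    using \<eta> tan[OF s] \<gamma>(1)[OF s] metric_in_vec_in(1)[OF model_UNIV P dP(1) \<gamma>(2)[OF s], of gP "\<eta> (\<gamma> s)" "x' s"]
    by (simp add: unit_normal_sub_def)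
  then have "((\<lambda>s. ?G (?x s) (?e (\<gamma> s)) (x' s)) has_derivative (\<lambda>h. 0)) (at 0 within J)"
    by (intro has_derivative_transform[OF J(2) _ has_derivative_const]) simp
  ultimately have "(\<lambda>h. ?DG (h *\<^sub>R x' 0) (?e (\<gamma> 0)) (x' 0) + ?G (?x 0) ((D \<circ> (\<lambda>h. h *\<^sub>R x' 0)) h) (x' 0) +
       ?G (?x 0) (?e (\<gamma> 0)) (h *\<^sub>R x'')) = (\<lambda>h. 0)"
    using has_derivative_unique by (simp only: at_within_open[OF J(2,1)]) blast
  from fun_cong[OF this, of 1]
  have "?DG (x' 0) (?e q) (x' 0) + ?G (snd d q) (D (x' 0)) (x' 0) + ?G (snd d q) (?e q) x'' = 0"
    using q by simp
  moreover have "?e q = \<eta> q"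
    using chart_change_self[OF model_UNIV P dP] by (simp add: vec_in_def d)
  moreover have "?G (snd d q) u v = gP q u v" for u v
    unfolding d by (rule metric_in_chart_at[OF model_UNIV P q(2)])
  moreover note christoffel_metric[OF P gP dP(1) y0, of "x' 0" "\<eta> q" "x' 0"]
  moreover have "bilinear (gP q)" using gP q by (simp add: riemannian_metric_def)
  note bil = bilinear_lneg[OF this] bilinear_lsub[OF this] bilinear_ladd[OF this] bilinear_radd[OF this]
  ultimately show ?thesis by (simp add: D(2) bil)
qed

section \<open>Ambient acceleration of a curve seen in M and in P\<close>

text \<open>The second order chain rule through the extension \<open>h\<close>. Since
  \<open>h'\<close> is differentiable only for each fixed direction, the velocity
  \<open>h' (z s) (z' s)\<close> is expanded in the basis before it is differentiated.\<close>

lemma (in hypersurface) jet_curve: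
  assumes jet: "second_jet h h' h'' U"
    and J: "open J" "0 \<in> J" and z: "\<And>s. s \<in> J \<Longrightarrow> z s \<in> S" "z 0 = x0"
    and z': "\<And>s. s \<in> J \<Longrightarrow> (z has_vector_derivative z' s) (at s)"
    and z'': "(z' has_vector_derivative z'') (at 0)"
  obtains K w' where "open K" "0 \<in> K" "K \<subseteq> J"
    "\<And>s. s \<in> K \<Longrightarrow> ((\<lambda>s. F (z s)) has_vector_derivative w' s) (at s)"
    "w' 0 = dF (z' 0)"
    "(w' has_vector_derivative h'' x0 (z' 0) (z' 0) + dF z'') (at 0)"
proof -
  have U: "open U" "x0 \<in> U" "\<And>y. y \<in> S \<Longrightarrow> y \<in> U \<Longrightarrow> h y = F y"
    "\<And>y. y \<in> U \<Longrightarrow> (h has_derivative h' y) (at y)"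
    "\<And>y u. y \<in> U \<Longrightarrow> ((\<lambda>y. h' y u) has_derivative h'' y u) (at y)"
    using jet unfolding second_jet_def by blast+
  have cont: "continuous_on J z"
    using z' has_vector_derivative_continuous by (blast intro: continuous_at_imp_continuous_on)
  define K where "K = J \<inter> z -` U"
  have K: "open K" "0 \<in> K" "K \<subseteq> J"
    using continuous_open_preimage[OF cont J(1) U(1)] J z U(2) by (auto simp: K_def)
  define w' where "w' s = h' (z s) (z' s)" for s
  have d1: "((\<lambda>s. F (z s)) has_vector_derivative w' s) (at s)" if s: "s \<in> K" for s
  proof -
    have zs: "z s \<in> U" "s \<in> J" using s by (auto simp: K_def)
    have "((\<lambda>s. h (z s)) has_derivative (\<lambda>r. h' (z s) (r *\<^sub>R z' s))) (at s)"
      using has_derivative_compose[OF z'[OF zs(2), unfolded has_vector_derivative_def] U(4)[OF zs(1)]] .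
    then have "((\<lambda>s. h (z s)) has_vector_derivative w' s) (at s)"
      using linear_scale[OF has_derivative_linear[OF U(4)[OF zs(1)]]]
      by (simp add: has_vector_derivative_def w'_def)
    then show ?thesis
      by (rule has_vector_derivative_transform_within_open[OF _ K(1) s])
         (use U(3) z(1) K(3) in \<open>auto simp: K_def\<close>)
  qed
  have expand: "h' (z s) v = (\<Sum>b\<in>Basis. (v \<bullet> b) *\<^sub>R h' (z s) b)" if "s \<in> K" for s v
  proof -
    interpret linear "h' (z s)" using has_derivative_linear[OF U(4)] that by (auto simp: K_def)
    show ?thesis by (subst (1) euclidean_representation[of v, symmetric]) (simp only: sum scale)
  qed
  have "((\<lambda>s. \<Sum>b\<in>Basis. (z' s \<bullet> b) *\<^sub>R h' (z s) b) has_derivative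
      (\<lambda>r. \<Sum>b\<in>Basis. (z' 0 \<bullet> b) *\<^sub>R h'' x0 b (r *\<^sub>R z' 0) + ((r *\<^sub>R z'') \<bullet> b) *\<^sub>R h' (z 0) b)) (at 0)"
  proof (intro has_derivative_sum has_derivative_scaleR)
    fix b :: "real^'n"
    show "((\<lambda>s. z' s \<bullet> b) has_derivative (\<lambda>r. (r *\<^sub>R z'') \<bullet> b)) (at 0)"
      using z'' unfolding has_vector_derivative_def by (rule has_derivative_inner_left)
    show "((\<lambda>s. h' (z s) b) has_derivative (\<lambda>r. h'' x0 b (r *\<^sub>R z' 0))) (at 0)"
      using has_derivative_compose[OF z'[OF J(2), unfolded has_vector_derivative_def], of "\<lambda>y. h' y b" "h'' x0 b"]
        U(5)[OF U(2)] z(2) by simp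
  qed
  moreover have "(\<Sum>b\<in>Basis. (z' 0 \<bullet> b) *\<^sub>R h'' x0 b (r *\<^sub>R z' 0) + ((r *\<^sub>R z'') \<bullet> b) *\<^sub>R h' (z 0) b) =
      r *\<^sub>R (h'' x0 (z' 0) (z' 0) + dF z'')" for r
  proof -
    have lin: "linear (h'' x0 u)" for u using has_derivative_linear[OF U(5)[OF U(2)]] .
    have 1: "(\<Sum>b\<in>Basis. (z' 0 \<bullet> b) *\<^sub>R h'' x0 (z' 0) b) = h'' x0 (z' 0) (z' 0)"
      by (subst (4) euclidean_representation[of "z' 0", symmetric])
         (simp only: linear_sum[OF lin] linear_scale[OF lin])
    have 2: "(\<Sum>b\<in>Basis. (z'' \<bullet> b) *\<^sub>R h' (z 0) b) = dF z''"
      using expand[OF K(2), of z''] z(2) jet_x0[OF jet] by simp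
    have "(\<Sum>b\<in>Basis. (z' 0 \<bullet> b) *\<^sub>R h'' x0 b (r *\<^sub>R z' 0) + ((r *\<^sub>R z'') \<bullet> b) *\<^sub>R h' (z 0) b) =
      (\<Sum>b\<in>Basis. r *\<^sub>R ((z' 0 \<bullet> b) *\<^sub>R h'' x0 (z' 0) b + (z'' \<bullet> b) *\<^sub>R h' (z 0) b))"
      by (intro sum.cong refl)
         (simp add: linear_scale[OF lin] jet_sym[OF jet, of _ "z' 0"] scaleR_add_right mult.commute)
    also have "\<dots> = r *\<^sub>R ((\<Sum>b\<in>Basis. (z' 0 \<bullet> b) *\<^sub>R h'' x0 (z' 0) b) + (\<Sum>b\<in>Basis. (z'' \<bullet> b) *\<^sub>R h' (z 0) b))"
      by (simp only: scaleR_sum_right sum.distrib scaleR_add_right)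
    finally show ?thesis unfolding 1 2 .
  qed
  ultimately have "((\<lambda>s. \<Sum>b\<in>Basis. (z' s \<bullet> b) *\<^sub>R h' (z s) b) has_vector_derivative
      (h'' x0 (z' 0) (z' 0) + dF z'')) (at 0)"
    by (simp add: has_vector_derivative_def)
  then have "(w' has_vector_derivative h'' x0 (z' 0) (z' 0) + dF z'') (at 0)"
    by (rule has_vector_derivative_transform_within_open[OF _ K(1,2)])
       (use expand in \<open>simp add: w'_def\<close>)
  moreover have "w' 0 = dF (z' 0)" by (simp add: w'_def z(2) jet_x0[OF jet])
  ultimately show thesis using that[OF K d1] by blast
qed

lemma second_derivative_unique:
  fixes w :: "real \<Rightarrow> 'a::real_normed_vector"
  assumes "open K" "t \<in> K" "\<And>s. s \<in> K \<Longrightarrow> (w has_vector_derivative a s) (at s)"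
    and "open L" "t \<in> L" "\<And>s. s \<in> L \<Longrightarrow> (w has_vector_derivative b s) (at s)"
    and a: "(a has_vector_derivative a') (at t)" and b: "(b has_vector_derivative b') (at t)"
  shows "a t = b t" "a' = b'"
proof -
  have eq: "a s = b s" if "s \<in> K \<inter> L" for s
    using vector_derivative_unique_at[of w "a s" s "b s"] assms that by blast
  then show "a t = b t" using assms by blast
  have "(b has_vector_derivative a') (at t)"
    by (rule has_vector_derivative_transform_within_open[OF a, of "K \<inter> L"]) (use assms eq in auto)
  then show "a' = b'" using b by (rule vector_derivative_unique_at)
qed

text \<open>\<open>P\<close> is immersed by \<open>id\<close> at the point \<open>\<psi> p\<close>,
  so both hypersurfaces use the same ambient chart there and second derivatives can be compared as
  vectors.\<close>

locale totally_geodesic_boundary =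
  m: hypersurface half_space M gM Q g \<psi> N p + s: hypersurface UNIV P gP Q g id \<xi> "\<psi> p"
  for M :: "('y, 'n::finite) atlas" and gM and Q :: "('x, 'k::finite) atlas" and g and \<psi> and N and p
    and P :: "('x, 'n) atlas" and gP and \<xi> +
  fixes \<Sigma> :: "'x set" and \<eta> :: "'x \<Rightarrow> real^'n"
  assumes p_bd: "p \<in> boundary M"
    and tot_geod: "totally_geodesic P gP Q g id \<xi>"
    and \<eta>: "unit_normal_sub P gP \<Sigma> \<eta>"
    and bdry: "smooth_map_on M (boundary M) P \<psi>" and onto: "\<psi> ` boundary M = \<Sigma>"
begin

text \<open>A curve in \<open>\<Sigma>\<close> with velocity \<open>e\<close> has the same ambient acceleration whether it is seen in
  \<open>M\<close> or in \<open>P\<close>; pairing the acceleration with the normals gives the quadratic forms of the three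
  shape operators, and the one with respect to \<open>\<xi>\<close> vanishes.\<close>

lemma shape_boundary_tangent:
  assumes e: "e \<in> tangent_to M (boundary M) p"
    and N: "N p = \<alpha> *\<^sub>R mdiff P Q id (\<psi> p) (\<eta> (\<psi> p)) + \<beta> *\<^sub>R \<xi> (\<psi> p)"
    and e': "mdiff P Q id (\<psi> p) e' = mdiff M Q \<psi> p e"
  shows "gM p (m.shape e) e = \<alpha> * gP (\<psi> p) (shape_op_sub P gP \<Sigma> \<eta> (\<psi> p) e') e'"
proof -
  obtain \<gamma> \<epsilon> where vel: "velocity M \<gamma> \<epsilon> p e" and \<gamma>b: "\<gamma> ` {-\<epsilon><..<\<epsilon>} \<subseteq> boundary M"
    using e by (auto simp: tangent_to_def)
  let ?I = "{-\<epsilon><..<\<epsilon>}"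
  have \<epsilon>: "0 \<in> ?I" and \<gamma>0: "\<gamma> 0 = p" and \<gamma>c: "\<And>s. s \<in> ?I \<Longrightarrow> \<gamma> s \<in> fst m.c"
    and sm: "smooth_on ?I (snd m.c \<circ> \<gamma>)" and v0: "((snd m.c \<circ> \<gamma>) has_vector_derivative e) (at 0)"
    using vel by (auto simp: velocity_def Let_def)
  let ?z = "\<lambda>s. snd m.c (\<gamma> s)" and ?x = "\<lambda>s. snd s.c (\<psi> (\<gamma> s))"
  obtain U1 h1 where 1: "open U1" "0 \<in> U1" "\<And>k. Ck_on k U1 h1"
    "\<And>s. s \<in> ?I \<Longrightarrow> s \<in> U1 \<Longrightarrow> h1 s = (snd m.c \<circ> \<gamma>) s"
    by (rule smooth_onD[OF sm \<epsilon>]) blast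
  define J1 where "J1 = ?I \<inter> U1"
  have J1: "open J1" "0 \<in> J1" "J1 \<subseteq> ?I" using 1 \<epsilon> by (auto simp: J1_def)
  have "Ck_on (Suc (Suc 0)) J1 ?z"
    by (rule Ck_on_cong[OF J1(1) _ Ck_on_subset[OF 1(3)]]) (use 1(4) in \<open>auto simp: J1_def\<close>)
  from curve_jet[OF this] obtain z' z'' where z': "\<And>s. s \<in> J1 \<Longrightarrow> (?z has_vector_derivative z' s) (at s)"
    "\<And>s. s \<in> J1 \<Longrightarrow> (z' has_vector_derivative z'' s) (at s)" by blast
  have z0: "z' 0 = e"
    using vector_derivative_unique_at[OF z'(1)[OF J1(2)], of e] v0 by (simp add: o_def)
  have d0: "\<psi> (\<gamma> 0) \<in> fst s.c" using s.c \<gamma>0 by simp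
  obtain J2 where J2: "open J2" "0 \<in> J2" "J2 \<subseteq> ?I" "\<And>s. s \<in> J2 \<Longrightarrow> \<psi> (\<gamma> s) \<in> fst s.c"
    "\<And>k. Ck_on k J2 ?x"
    by (rule pushed_curve_smooth[OF m.A bdry vel \<gamma>b m.p \<epsilon> s.c(1) d0]) blast
  from curve_jet[OF J2(5)] obtain x' x'' where x': "\<And>s. s \<in> J2 \<Longrightarrow> (?x has_vector_derivative x' s) (at s)"
    "\<And>s. s \<in> J2 \<Longrightarrow> (x' has_vector_derivative x'' s) (at s)" by blast
  \<comment> \<open>\<open>J2\<close> keeps the image curve in the chart of \<open>P\<close>; the
    set \<open>T\<close> will keep it in the ambient chart too.\<close>
  obtain T where T: "open T" "m.S = half_space \<inter> T"
    using m.S_open by (auto simp: openin_open)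
  have "continuous_on J1 ?z"
    using z'(1) has_vector_derivative_continuous by (blast intro: continuous_at_imp_continuous_on)
  from continuous_open_preimage[OF this J1(1) T(1)] have "open (J1 \<inter> ?z -` T)" .
  define J where "J = (J1 \<inter> ?z -` T) \<inter> J2"
  have J: "open J" "0 \<in> J" "J \<subseteq> J1" "J \<subseteq> J2"
    using \<open>open (J1 \<inter> ?z -` T)\<close> J1 J2 T(2) m.x0_S \<gamma>0 by (auto simp: J_def)
  have zS: "?z s \<in> m.S" if "s \<in> J" for s
  proof -
    have "?z s \<in> cimg m.c" using that \<gamma>c J1 J by (auto simp: cimg_def)
    moreover have "cimg m.c \<subseteq> half_space"
      using m.A m.c openin_imp_subset by (auto simp: smooth_atlas_def)
    ultimately show ?thesis unfolding T(2) using that by (auto simp: J_def)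
  qed
  have \<gamma>d: "\<psi> (\<gamma> s) \<in> fst m.d" if "s \<in> J" for s
  proof -
    obtain q where q: "q \<in> fst m.c" "\<psi> q \<in> fst m.d" "?z s = snd m.c q"
      using zS[OF \<open>s \<in> J\<close>] by blast
    have "\<gamma> s \<in> fst m.c" using that \<gamma>c J1 J by blast
    then have "\<gamma> s = q" using q m.A m.c by (metis cinv_chart)
    then show ?thesis using q by simp
  qed
  have xS: "?x s \<in> s.S" if "s \<in> J" for s
    using J2(4) J(4) \<gamma>d[OF that] that by auto
  have FF: "m.F (?z s) = snd m.d (\<psi> (\<gamma> s))" "s.F (?x s) = snd m.d (\<psi> (\<gamma> s))" if "s \<in> J" for s
    using that cinv_chart[OF m.A m.c(1)] cinv_chart[OF s.A s.c(1)] \<gamma>c J1 J J2 by auto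
  have zJ: "?z 0 = m.x0" "\<And>s. s \<in> J \<Longrightarrow> (?z has_vector_derivative z' s) (at s)"
    "(z' has_vector_derivative z'' 0) (at 0)"
    using z' J J1(2) by (auto simp: \<gamma>0)
  have xJ: "?x 0 = s.x0" "\<And>s. s \<in> J \<Longrightarrow> (?x has_vector_derivative x' s) (at s)"
    "(x' has_vector_derivative x'' 0) (at 0)"
    using x' J J2(2) by (auto simp: \<gamma>0)
  obtain h h' h'' U where mj: "m.second_jet h h' h'' U" by (rule m.second_jet_exists)
  obtain k k' k'' V where sj: "s.second_jet k k' k'' V" by (rule s.second_jet_exists)
  obtain K w where K: "open K" "0 \<in> K" "K \<subseteq> J"
    "\<And>s. s \<in> K \<Longrightarrow> ((\<lambda>s. m.F (?z s)) has_vector_derivative w s) (at s)"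
    "w 0 = m.dF (z' 0)" "(w has_vector_derivative h'' m.x0 (z' 0) (z' 0) + m.dF (z'' 0)) (at 0)"
    by (rule m.jet_curve[where z = ?z and z' = z' and z'' = "z'' 0", OF mj J(1,2) zS zJ])
       (assumption, assumption, rule that)
  obtain L y where L: "open L" "0 \<in> L" "L \<subseteq> J"
    "\<And>s. s \<in> L \<Longrightarrow> ((\<lambda>s. s.F (?x s)) has_vector_derivative y s) (at s)"
    "y 0 = s.dF (x' 0)" "(y has_vector_derivative k'' s.x0 (x' 0) (x' 0) + s.dF (x'' 0)) (at 0)"
    by (rule s.jet_curve[where z = ?x and z' = x' and z'' = "x'' 0", OF sj J(1,2) xS xJ])
       (assumption, assumption, rule that)
  have K4: "((\<lambda>s. snd m.d (\<psi> (\<gamma> s))) has_vector_derivative w s) (at s)" if "s \<in> K" for s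
    by (rule has_vector_derivative_transform_within_open[OF K(4) K(1)]) (use that FF(1) K(3) in blast)+
  have L4: "((\<lambda>s. snd m.d (\<psi> (\<gamma> s))) has_vector_derivative y s) (at s)" if "s \<in> L" for s
    by (rule has_vector_derivative_transform_within_open[OF L(4) L(1)]) (use that FF(2) L(3) in blast)+
  \<comment> \<open>Both expressions describe one curve in the ambient chart. Equal velocities
    identify \<open>x' 0\<close> with \<open>e'\<close>, because the differential of the inclusion
    of \<open>P\<close> is injective; equal second derivatives give the comparison.\<close>
  note eq = second_derivative_unique[OF K(1,2) K4 L(1,2) L4 K(6) L(6)]
  have "s.dF (x' 0) = s.dF e'" using eq(1) K(5) L(5) z0 e' by simp
  then have x0: "x' 0 = e'" using s.dF_inj by (metis injD)
  have eq2: "h'' m.x0 e e + m.dF (z'' 0) = k'' s.x0 e' e' + s.dF (x'' 0)"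
    using eq(2) by (simp only: z0 x0)
  let ?gp = "g (\<psi> p)"
  have Nn: "?gp (N p) (m.dF v) = 0" for v
    using m.N m.p by (simp add: unit_normal_def)
  have \<xi>n: "?gp (\<xi> (\<psi> p)) (s.dF v) = 0" for v
    using s.N s.p by (simp add: unit_normal_def)
  \<comment> \<open>The ambient covariant acceleration of the curve at 0, written through
    \<open>P\<close>. Written through \<open>M\<close> it contains \<open>m.dF (z'' 0)\<close>,
    which is invisible to \<open>N\<close>.\<close>
  let ?W = "k'' s.x0 e' e' + s.dF (x'' 0) + m.\<Gamma> (s.dF e') (s.dF e')"
  have "gM p (m.shape e) e = ?gp (N p) (h'' m.x0 e e + m.\<Gamma> (m.dF e) (m.dF e))"
    by (rule m.shape_second_jet[OF mj])
  also have "\<dots> = ?gp (N p) (h'' m.x0 e e + m.dF (z'' 0) + m.\<Gamma> (m.dF e) (m.dF e))"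
    by (simp add: m.gp_simps Nn)
  also have "\<dots> = ?gp (N p) ?W" unfolding eq2 e' ..
  also have "\<dots> = \<alpha> * ?gp (s.dF (\<eta> (\<psi> p))) ?W + \<beta> * ?gp (\<xi> (\<psi> p)) ?W"
    unfolding N m.gp_simps by (simp add: algebra_simps)
  also have "?gp (\<xi> (\<psi> p)) ?W = ?gp (\<xi> (\<psi> p)) (k'' s.x0 e' e' + m.\<Gamma> (s.dF e') (s.dF e'))"
    by (simp add: m.gp_simps \<xi>n)
  also have "\<dots> = gP (\<psi> p) (s.shape e') e'"
    using s.shape_second_jet[OF sj, of e' e'] by simp
  also have "\<dots> = 0"
    using tot_geod s.p by (simp add: totally_geodesic_def second_fundamental_form_def)
  also have "?gp (s.dF (\<eta> (\<psi> p))) ?W =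
      ?gp (k'' s.x0 e' e' + m.\<Gamma> (s.dF e') (s.dF e')) (s.dF (\<eta> (\<psi> p))) +
      ?gp (s.dF (x'' 0)) (s.dF (\<eta> (\<psi> p)))"
    by (subst m.gp_sym) (simp add: m.gp_simps)
  \<comment> \<open>The vector \<eta> is tangent to \<open>P\<close>, so the Gauss formula reduces
    its component of the acceleration to one computed inside \<open>P\<close>.\<close>
  also have "\<dots> = gP (\<psi> p) (christoffel P gP s.c s.x0 e' e') (\<eta> (\<psi> p)) + gP (\<psi> p) (x'' 0) (\<eta> (\<psi> p))"
    using s.levi_civita_induced[OF sj refl, of e' e' "\<eta> (\<psi> p)"] s.dF_iso[of "x'' 0" "\<eta> (\<psi> p)"] by simp
  also have "\<dots> = gP (\<psi> p) (\<eta> (\<psi> p)) (x'' 0 + christoffel P gP s.c s.x0 e' e')"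
  proof -
    have "bilinear (gP (\<psi> p))" "\<And>u v. gP (\<psi> p) u v = gP (\<psi> p) v u"
      using s.gA s.p by (auto simp: riemannian_metric_def)
    then show ?thesis by (metis add.commute bilinear_radd)
  qed
  also have "\<dots> = gP (\<psi> p) (shape_op_sub P gP \<Sigma> \<eta> (\<psi> p) e') e'"
    unfolding x0[symmetric]
  proof (rule shape_op_sub_curve[OF s.A s.gA \<eta> _ s.p refl J2(1,2) _ J2(4) x'(1) x'(2)[OF J2(2)], symmetric])
    show "\<psi> (\<gamma> 0) = \<psi> p" by (simp add: \<gamma>0)
    show "\<psi> (\<gamma> s) \<in> \<Sigma>" if "s \<in> J2" for s
      using that J2(3) \<gamma>b onto by blast
    show "chart_change s.c (chart_at P (\<psi> (\<gamma> s))) (\<psi> (\<gamma> s)) (x' s) \<in> tangent_to P \<Sigma> (\<psi> (\<gamma> s))"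
      if "s \<in> J2" for s
      using pushed_curve_tangent[OF m.A bdry s.A vel \<gamma>b m.p _ s.c(1) J2(4)[OF that] x'(1)[OF that]]
        that J2(3) onto by blast
  qed
  finally show ?thesis by simp
qed

end

section \<open>Orthonormal frames along the boundary\<close>

text \<open>The difference of the two sides is orthogonal to every \<open>ws ! i\<close>. These
  vectors span the space by their number, so the difference is orthogonal to itself.\<close>

lemma orthonormal_expansion:
  fixes B :: "real^'n::finite \<Rightarrow> real^'n \<Rightarrow> real"
  assumes B: "bilinear B" and pos: "\<And>u. u \<noteq> 0 \<Longrightarrow> 0 < B u u"
    and len: "length ws = CARD('n)"
    and on: "\<And>i j. i < length ws \<Longrightarrow> j < length ws \<Longrightarrow> B (ws ! i) (ws ! j) = (if i = j then 1 else 0)"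
  shows "v = (\<Sum>i<length ws. B v (ws ! i) *\<^sub>R ws ! i)"
proof -
  note li = orthonormal_independent[OF B on]
  let ?r = "v - (\<Sum>i<length ws. B v (ws ! i) *\<^sub>R ws ! i)"
  have orth: "B ?r (ws ! j) = 0" if j: "j < length ws" for j
  proof -
    interpret linear "\<lambda>u. B u (ws ! j)" using B by (simp add: bilinear_def)
    have "(\<Sum>i<length ws. B v (ws ! i) * B (ws ! i) (ws ! j)) = (\<Sum>i<length ws. if i = j then B v (ws ! i) else 0)"
      by (rule sum.cong) (use on j in auto)
    then show ?thesis using j by (simp add: diff sum scale)
  qed
  have "card (set ws) = dim (UNIV :: (real^'n) set)"
    using distinct_card[OF li(2)] len by simp
  then have "UNIV \<subseteq> span (set ws)"
    using li(1) by (intro card_ge_dim_independent) auto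
  moreover have "subspace {w. B ?r w = 0}"
    by (auto simp: subspace_def bilinear_radd[OF B] bilinear_rmul[OF B] bilinear_rzero[OF B])
  then have "span (set ws) \<subseteq> {w. B ?r w = 0}"
    by (intro span_minimal) (use orth in \<open>auto simp: in_set_conv_nth\<close>)
  ultimately have "B ?r ?r = 0" by blast
  then have "?r = 0" using pos[of ?r] by (metis less_irrefl)
  then show ?thesis by simp
qed

lemma orthonormal_frame:
  assumes sym: "\<And>u v. B u v = B v u"
    and es: "\<And>i j. i < length es \<Longrightarrow> j < length es \<Longrightarrow> B (es ! i) (es ! j) = (if i = j then 1 else (0::real))"
    and u: "B u u = 1" "\<And>i. i < length es \<Longrightarrow> B u (es ! i) = 0"
    and w: "B w w = 1" "\<And>i. i < length es \<Longrightarrow> B w (es ! i) = 0"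
    and uw: "B u w = 0"
    and i: "i < Suc (Suc (length es))" and j: "j < Suc (Suc (length es))"
  shows "B ((u # es @ [w]) ! i) ((u # es @ [w]) ! j) = (if i = j then 1 else 0)"
proof -
  have cases: "m = 0 \<or> (\<exists>l<length es. m = Suc l) \<or> m = Suc (length es)"
    if "m < Suc (Suc (length es))" for m
    using that by (cases m) (auto simp: less_Suc_eq)
  have "B (es ! i) u = 0" "B (es ! i) w = 0" if "i < length es" for i
    using u(2)[OF that] w(2)[OF that] sym[of u "es ! i"] sym[of w "es ! i"] by simp_all
  moreover have "B w u = 0" using uw sym[of u w] by simp
  ultimately show ?thesis
    using cases[OF i] cases[OF j]
    by (elim disjE exE conjE) (simp_all add: nth_append es u w uw)
qed

text \<open>The two frames differ by a rotation of the plane orthogonal to \<open>es\<close>.\<close>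

lemma rotated_frames:
  fixes g :: "('x, 'k::finite) metric" and es :: "(real^'k) list"
  assumes B: "bilinear (g q)" and sym: "\<And>u v. g q u v = g q v u"
    and pos: "\<And>u. u \<noteq> 0 \<Longrightarrow> 0 < g q u u"
    and k: "CARD('k) = Suc (Suc (length es))"
    and es: "\<And>i j. i < length es \<Longrightarrow> j < length es \<Longrightarrow> g q (es ! i) (es ! j) = (if i = j then 1 else 0)"
    and u: "g q u u = 1" "\<And>i. i < length es \<Longrightarrow> g q u (es ! i) = 0"
    and w: "g q w w = 1" "\<And>i. i < length es \<Longrightarrow> g q w (es ! i) = 0"
    and uw: "g q u w = 0"
    and u': "g q u' u' = 1" "\<And>i. i < length es \<Longrightarrow> g q u' (es ! i) = 0"
    and w': "g q w' w' = 1" "\<And>i. i < length es \<Longrightarrow> g q w' (es ! i) = 0"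
    and uw': "g q u' w' = 0"
    and orient: "oriented_det g q (u # es @ [w]) = 1 \<longleftrightarrow> oriented_det g q (u' # es @ [w']) = 1"
  shows "g q w u' = - g q w' u" and "w = g q w u' *\<^sub>R u' + g q w w' *\<^sub>R w'"
proof -
  let ?l = "u # es @ [w]" and ?l' = "u' # es @ [w']" and ?n = "Suc (Suc (length es))"
  let ?a = "g q u' u" and ?b = "g q u' w" and ?c = "g q w' u" and ?d = "g q w' w"
  have on: "g q (?l ! i) (?l ! j) = (if i = j then 1 else 0)" if "i < ?n" "j < ?n" for i j
    by (rule orthonormal_frame[of "g q", OF sym es u w uw that])
  have on': "g q (?l' ! i) (?l' ! j) = (if i = j then 1 else 0)" if "i < ?n" "j < ?n" for i j
    by (rule orthonormal_frame[of "g q", OF sym es u' w' uw' that])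
  have split: "(\<Sum>i<?n. f i) = f 0 + (\<Sum>i<length es. f (Suc i)) + f (Suc (length es))" for f :: "nat \<Rightarrow> real^'k"
    unfolding sum.lessThan_Suc[of f "Suc (length es)"] sum.lessThan_Suc_shift[of f "length es"] ..
  have frame_expansion: "v = g q v y *\<^sub>R y + (\<Sum>i<length es. g q v (es ! i) *\<^sub>R es ! i) + g q v z *\<^sub>R z"
    if on: "\<And>i j. i < ?n \<Longrightarrow> j < ?n \<Longrightarrow>
      g q ((y # es @ [z]) ! i) ((y # es @ [z]) ! j) = (if i = j then 1 else 0)" for v y z
  proof -
    have len: "length (y # es @ [z]) = ?n" by simp
    have "v = (\<Sum>i<length (y # es @ [z]). g q v ((y # es @ [z]) ! i) *\<^sub>R (y # es @ [z]) ! i)"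
    proof (rule orthonormal_expansion[OF B])
      show "0 < g q u u" if "u \<noteq> 0" for u using that by (rule pos)
    qed (simp_all only: len k on)
    also have "\<dots> = g q v y *\<^sub>R y + (\<Sum>i<length es. g q v (es ! i) *\<^sub>R es ! i) + g q v z *\<^sub>R z"
      unfolding len split by (simp add: nth_append)
    finally show ?thesis .
  qed
  note expand = frame_expansion[of u w, OF on] and expand' = frame_expansion[of u' w', OF on']
  show ww: "w = g q w u' *\<^sub>R u' + g q w w' *\<^sub>R w'"
    using expand'[of w] w by simp
  have eu: "u' = ?a *\<^sub>R u + ?b *\<^sub>R w" and ew: "w' = ?c *\<^sub>R u + ?d *\<^sub>R w"
    using expand[of u'] expand[of w'] u' w' by simp_all
  note bil = bilinear_ladd[OF B] bilinear_radd[OF B] bilinear_lmul[OF B] bilinear_rmul[OF B]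
  have ab: "?a\<^sup>2 + ?b\<^sup>2 = 1"
  proof -
    have "g q u' u' = ?a * g q u' u + ?b * g q u' w" by (subst (2) eu) (simp add: bil)
    then show ?thesis using u' by (simp add: power2_eq_square)
  qed
  have cd: "?c\<^sup>2 + ?d\<^sup>2 = 1"
  proof -
    have "g q w' w' = ?c * g q w' u + ?d * g q w' w" by (subst (2) ew) (simp add: bil)
    then show ?thesis using w' by (simp add: power2_eq_square)
  qed
  define idx where "idx = to_nat_on (UNIV :: 'k set)"
  have bij: "bij_betw idx UNIV {..<?n}"
    using to_nat_on_finite[of "UNIV :: 'k set"] by (simp add: idx_def k)
  have lt: "idx i < ?n" for i using bij by (auto simp: bij_betw_def)
  have inj: "idx i = idx j \<longleftrightarrow> i = j" for i j
    using bij by (auto simp: bij_betw_def inj_on_def)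
  obtain i0 i1 where i01: "idx i0 = 0" "idx i1 = Suc (length es)"
    by (metis UNIV_I bij bij_betw_iff_bijections lessI lessThan_iff zero_less_Suc)
  have ne: "i1 \<noteq> i0" using i01 by auto
  have mid: "\<exists>m<length es. idx i = Suc m" if "i \<noteq> i0" "i \<noteq> i1" for i
    using lt[of i] inj[of i i0] inj[of i i1] that i01 by (cases "idx i") auto
  \<comment> \<open>The second frame expressed in the first. The vectors \<open>es\<close> are
    common to both, so only the block of \<open>i0\<close> and \<open>i1\<close> differs from the
    identity and the determinant is that of this 2 by 2 block.\<close>
  define R where "R = (\<chi> i j. g q (?l' ! idx i) (?l ! idx j))"
  have Rmid: "R $ i $ j = (if i = j then 1 else 0)" if "i \<noteq> i0" "i \<noteq> i1" for i j
  proof -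
    obtain m where m: "m < length es" "idx i = Suc m" using mid[OF \<open>i \<noteq> i0\<close> \<open>i \<noteq> i1\<close>] by blast
    then have "R $ i $ j = g q (?l ! idx i) (?l ! idx j)" by (simp add: R_def nth_append)
    then show ?thesis using on[OF lt lt, of i j] inj by simp
  qed
  have R1: "R $ i1 $ j = 0" if "j \<noteq> i0" "j \<noteq> i1" for j
  proof -
    obtain m where m: "m < length es" "idx j = Suc m" using mid[OF \<open>j \<noteq> i0\<close> \<open>j \<noteq> i1\<close>] by blast
    then show ?thesis by (simp add: R_def i01 nth_append w')
  qed
  have Rv: "R $ i0 $ i0 = ?a" "R $ i0 $ i1 = ?b" "R $ i1 $ i0 = ?c" "R $ i1 $ i1 = ?d"
    by (simp_all add: R_def i01 nth_append)
  have "det R = R $ i0 $ i0 * (\<Prod>i\<in>UNIV - {i0}. R $ i $ i) -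
    (\<Sum>k\<in>UNIV - {i0}. R $ k $ i0 * R $ i0 $ k * (\<Prod>i\<in>UNIV - {i0, k}. R $ i $ i))"
    by (rule det_bordered_diagonal) (metis R1 Rmid)
  also have "(\<Prod>i\<in>UNIV - {i0}. R $ i $ i) = R $ i1 $ i1 * (\<Prod>i\<in>UNIV - {i0} - {i1}. R $ i $ i)"
    using ne by (intro prod.remove) auto
  also have "(\<Prod>i\<in>UNIV - {i0} - {i1}. R $ i $ i) = 1"
    by (rule prod.neutral) (auto simp: Rmid)
  also have "(\<Sum>k\<in>UNIV - {i0}. R $ k $ i0 * R $ i0 $ k * (\<Prod>i\<in>UNIV - {i0, k}. R $ i $ i)) =
      R $ i1 $ i0 * R $ i0 $ i1 * (\<Prod>i\<in>UNIV - {i0, i1}. R $ i $ i) +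
      (\<Sum>k\<in>UNIV - {i0} - {i1}. R $ k $ i0 * R $ i0 $ k * (\<Prod>i\<in>UNIV - {i0, k}. R $ i $ i))"
    using ne by (intro sum.remove) auto
  also have "(\<Sum>k\<in>UNIV - {i0} - {i1}. R $ k $ i0 * R $ i0 $ k * (\<Prod>i\<in>UNIV - {i0, k}. R $ i $ i)) = 0"
    by (rule sum.neutral) (auto simp: Rmid)
  also have "(\<Prod>i\<in>UNIV - {i0, i1}. R $ i $ i) = 1"
    by (rule prod.neutral) (auto simp: Rmid)
  finally have detR: "det R = ?a * ?d - ?b * ?c" by (simp add: Rv mult.commute)
  let ?G = "det (\<chi> i j. g q (axis i 1) (axis j 1))"
  let ?D = "det (\<chi> i. ?l ! idx i)" and ?D' = "det (\<chi> i. ?l' ! idx i)"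
  have sq: "?G * ?D\<^sup>2 = 1" "?G * ?D'\<^sup>2 = 1"
    by (rule det_orthonormal_squared[OF B]; use on[OF lt lt] on'[OF lt lt] inj in simp)+
  have G: "?G > 0" using sq(1) by (metis mult_le_0_iff not_le zero_le_power2 zero_less_one)
  have od: "oriented_det g q ?l = sqrt ?G * ?D" "oriented_det g q ?l' = sqrt ?G * ?D'"
    by (simp_all add: oriented_det_def idx_def)
  have od2: "(oriented_det g q ?l)\<^sup>2 = 1" "(oriented_det g q ?l')\<^sup>2 = 1"
    unfolding od using sq G by (simp_all add: power_mult_distrib)
  have "?a * ?d - ?b * ?c = ?D' * ?G * ?D"
    unfolding detR[symmetric] R_def by (rule det_bilinear[OF B])
  also have "\<dots> = oriented_det g q ?l * oriented_det g q ?l'"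
  proof -
    have "?D' * ?G * ?D = ?D' * (sqrt ?G * sqrt ?G) * ?D" using G by simp
    then show ?thesis unfolding od by (simp only: mult_ac)
  qed
  \<comment> \<open>Two numbers with square 1, one of which is 1 exactly when the other is, have
    product 1.\<close>
  also have "\<dots> = 1"
    using od2 orient by (auto simp: power2_eq_1_iff)
  finally have "?a * ?d - ?b * ?c = 1" .
  \<comment> \<open>The left side expands to the two unit lengths minus twice the determinant
    \<open>?a * ?d - ?b * ?c\<close>, that is, to \<open>1 + 1 - 2\<close>.\<close>
  then have "(?a - ?d)\<^sup>2 + (?b + ?c)\<^sup>2 = 0"
    using ab cd by (simp add: power2_eq_square algebra_simps)
  then have "?b + ?c = 0" by (metis sum_power2_eq_zero_iff)
  then show "g q w u' = - g q w' u" using sym[of w u'] by simp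
qed

section \<open>The boundary formulas for the curvatures and the Newton transformations\<close>

theorem corollary6p1:
  fixes Q :: "('x, 'k::finite) atlas" and g :: "('x, 'k) metric"
    and P :: "('x, 'n::finite) atlas" and gP :: "('x, 'n) metric"
    and M :: "('y, 'n) atlas" and gM :: "('y, 'n) metric"
    and \<Sigma> \<Sigma>\<^sub>0 D :: "'x set"
    and \<psi> :: "'y \<Rightarrow> 'x"
    and N :: "'y \<Rightarrow> real^'k" and \<nu> :: "'y \<Rightarrow> real^'n"
    and p :: 'y and es es' :: "(real^'n) list" and \<tau> :: "real list"
    and \<xi> :: "'x \<Rightarrow> real^'k" and \<eta> :: "'x \<Rightarrow> real^'n"
  assumes dim: "CARD('k) = CARD('n) + 1"
    (* the ambient oriented Riemannian manifold *)
    and Q: "manifold UNIV Q" "connected_space (mtop Q)" "oriented_atlas Q" "riemannian_metric Q g"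
    (* the totally geodesic hypersurface P, contained in Q, with unit normal \<xi> *)
    and P: "manifold UNIV P" "connected_space (mtop P)" "riemannian_metric P gP"
      "carrier P \<subseteq> carrier Q" "isometric_immersion P gP Q g id"
    and \<xi>: "unit_normal P Q g id \<xi>"
    and tot_geod: "totally_geodesic P gP Q g id \<xi>"
    (* the submanifold \<Sigma> of P with unit normal \<eta> *)
    and \<Sigma>: "embedded_submanifold P (CARD('n) - 1) \<Sigma>" "compactin (mtop P) \<Sigma>"
    and \<eta>: "unit_normal_sub P gP \<Sigma> \<eta>"
    (* the hypersurface M with boundary \<Sigma>, unit normal N and outward conormal \<nu> *)
    and M: "manifold half_space M" "connected_space (mtop M)" "riemannian_metric M gM"
      "isometric_immersion M gM Q g \<psi>"
    and bdry: "diffeo_on M (boundary M) P \<Sigma> \<psi>"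
    and N: "unit_normal M Q g \<psi> N"
    and \<nu>: "outward_unit_conormal M gM \<nu>"
    (* orientation conventions *)
    and \<Sigma>\<^sub>0: "\<Sigma>\<^sub>0 \<in> connected_components_of (subtopology (mtop P) \<Sigma>)"
    and D: "openin (mtop P) D" "connectedin (mtop P) D" "mtop P frontier_of D = \<Sigma>\<^sub>0"
    and outward: "\<And>q. q \<in> \<Sigma>\<^sub>0 \<Longrightarrow> points_outward P D q (\<eta> q)"
    and orient: "\<And>p es. p \<in> boundary M \<Longrightarrow>
       orthonormal_basis (gM p) (tangent_to M (boundary M) p) es \<Longrightarrow>
       oriented_det g (\<psi> p)
         (mdiff M Q \<psi> p (\<nu> p) # map (mdiff M Q \<psi> p) es @ [N p]) = 1 \<longleftrightarrow>
       oriented_det g (\<psi> p)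
         (mdiff P Q id (\<psi> p) (\<eta> (\<psi> p)) # map (mdiff M Q \<psi> p) es @ [\<xi> (\<psi> p)]) = 1"
    (* principal curvatures and directions of \<Sigma> at a boundary point p *)
    and p: "p \<in> boundary M"
    and es: "orthonormal_basis (gM p) (tangent_to M (boundary M) p) es"
    (* es' are the vectors of es, regarded as tangent vectors of \<Sigma> in P *)
    and es': "length es' = length es"
      "\<And>i. i < length es \<Longrightarrow> es' ! i \<in> tangent_to P \<Sigma> (\<psi> p)"
      "\<And>i. i < length es \<Longrightarrow> mdiff P Q id (\<psi> p) (es' ! i) = mdiff M Q \<psi> p (es ! i)"
    and \<tau>: "length \<tau> = length es"
      "\<And>i. i < length es \<Longrightarrow> shape_op_sub P gP \<Sigma> \<eta> (\<psi> p) (es' ! i) = \<tau> ! i *\<^sub>R es' ! i"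
  shows "let n = CARD('n);
         A = shape_op M Q g \<psi> N p;
         S = (\<lambda>r. sym_curvature r A);
         s = (\<lambda>r. esym r \<tau>);
         c = g (\<psi> p) (\<xi> (\<psi> p)) (mdiff M Q \<psi> p (\<nu> p));
         a = gM p (A (\<nu> p)) (\<nu> p);
         b = (\<lambda>i. gM p (A (\<nu> p)) (es ! i))
     in
       S 1 = - s 1 * c + a \<and>
       S 2 = s 2 * c ^ 2 - s 1 * c * a - (\<Sum>i<n - 1. b i ^ 2) \<and>
       (\<forall>r. 3 \<le> r \<and> r \<le> n \<longrightarrow>
          S r = (-1) ^ r * s r * c ^ r + (-1) ^ (r - 1) * s (r - 1) * c ^ (r - 1) * a
                - (-1) ^ (r - 2) * c ^ (r - 2) * (\<Sum>i<n - 1. esym (r - 2) (omit i \<tau>) * b i ^ 2)) \<and>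
       (\<forall>r. 1 \<le> r \<and> r \<le> n \<longrightarrow>
          gM p (newton r A (\<nu> p)) (\<nu> p) = (-1) ^ r * s r * c ^ r)"
proof -
  have atlases: "smooth_atlas half_space M" "smooth_atlas UNIV P" "smooth_atlas UNIV Q"
    using M(1) P(1) Q(1) by (auto simp: manifold_def)
  have pM: "p \<in> carrier M" using p by (auto simp: boundary_def carrier_def)
  have onto: "\<psi> ` boundary M = \<Sigma>" using bdry by (simp add: diffeo_on_def bij_betw_def)
  have q: "\<psi> p \<in> \<Sigma>" using onto p by blast
  have qP: "\<psi> p \<in> carrier P" using q \<Sigma>(1) by (auto simp: embedded_submanifold_def)
  interpret totally_geodesic_boundary M gM Q g \<psi> N p P gP \<xi> \<Sigma> \<eta>
  proof
    show "smooth_map_on M (boundary M) P \<psi>" using bdry by (simp add: diffeo_on_def)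
  qed (use assms atlases pM qP onto model_half_space model_UNIV in auto)
  let ?A = "shape_op M Q g \<psi> N p" and ?T = "shape_op_sub P gP \<Sigma> \<eta> (\<psi> p)"
  let ?i = "mdiff P Q id (\<psi> p)" and ?j = "mdiff M Q \<psi> p"
  let ?B = "gM p" and ?m = "length es"
  define c where "c = g (\<psi> p) (\<xi> (\<psi> p)) (?j (\<nu> p))"
  define a where "a = ?B (?A (\<nu> p)) (\<nu> p)"
  define b where "b i = ?B (?A (\<nu> p)) (es ! i)" for i
  have B: "bilinear ?B" "\<And>u v. ?B u v = ?B v u" "\<And>u. u \<noteq> 0 \<Longrightarrow> 0 < ?B u u"
    using M(3) pM by (auto simp: riemannian_metric_def)
  have G: "bilinear (g (\<psi> p))" "\<And>u v. g (\<psi> p) u v = g (\<psi> p) v u" "\<And>u. u \<noteq> 0 \<Longrightarrow> 0 < g (\<psi> p) u u"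
    using m.gp_bilinear m.gp_sym m.gp_pos by auto
  have on: "?B (es ! i) (es ! j) = (if i = j then 1 else 0)" if "i < ?m" "j < ?m" for i j
    using es that by (simp add: orthonormal_basis_def)
  have span: "span (set es) = tangent_to M (boundary M) p"
    using es by (simp add: orthonormal_basis_def)
  have tan: "es ! i \<in> tangent_to M (boundary M) p" if "i < ?m" for i
    unfolding span[symmetric] using that by (simp add: span_base)
  have \<nu>: "?B (\<nu> p) (\<nu> p) = 1" "\<And>i. i < ?m \<Longrightarrow> ?B (\<nu> p) (es ! i) = 0"
    using \<nu> p tan by (auto simp: outward_unit_conormal_def)
  have frame: "?B ((es @ [\<nu> p]) ! i) ((es @ [\<nu> p]) ! j) = (if i = j then 1 else 0)"
    if "i \<le> ?m" "j \<le> ?m" for i j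
    using that on \<nu> B(2)[of "es ! i" "\<nu> p"] by (auto simp: nth_append le_less)
  have n: "CARD('n) = Suc ?m"
    by (rule conormal_frame_length[OF atlases(1) p B(1) es frame])
  have iso_i: "g (\<psi> p) (?i u) (?i v) = gP (\<psi> p) u v" for u v using s.dF_iso by simp
  have iso_j: "g (\<psi> p) (?j u) (?j v) = ?B u v" for u v by (rule m.dF_iso)
  have N1: "g (\<psi> p) (N p) (N p) = 1" "\<And>v. g (\<psi> p) (N p) (?j v) = 0"
    using N pM by (auto simp: unit_normal_def)
  have \<xi>1: "g (\<psi> p) (\<xi> (\<psi> p)) (\<xi> (\<psi> p)) = 1" "\<And>v. g (\<psi> p) (\<xi> (\<psi> p)) (?i v) = 0"
    using \<xi> qP by (auto simp: unit_normal_def)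
  have \<eta>1: "gP (\<psi> p) (\<eta> (\<psi> p)) (\<eta> (\<psi> p)) = 1" "\<And>i. i < ?m \<Longrightarrow> gP (\<psi> p) (\<eta> (\<psi> p)) (es' ! i) = 0"
    using \<eta> q es'(2) by (auto simp: unit_normal_sub_def)
  have rot: "g (\<psi> p) (N p) (?i (\<eta> (\<psi> p))) = - c"
    "N p = g (\<psi> p) (N p) (?i (\<eta> (\<psi> p))) *\<^sub>R ?i (\<eta> (\<psi> p)) +
      g (\<psi> p) (N p) (\<xi> (\<psi> p)) *\<^sub>R \<xi> (\<psi> p)"
  proof -
    let ?es = "map ?j es" and ?g = "g (\<psi> p)"
    have 0: "CARD('k) = Suc (Suc (length ?es))" using dim n by simp
    have j: "?es ! i = ?i (es' ! i)" if "i < ?m" for i using es'(3) that by simp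
    have 1: "?g (?es ! i) (?es ! k) = (if i = k then 1 else 0)" if "i < length ?es" "k < length ?es" for i k
      using that on by (simp add: iso_j)
    have 2: "?g (?j (\<nu> p)) (?j (\<nu> p)) = 1" using \<nu>(1) by (simp add: iso_j)
    have 3: "?g (?j (\<nu> p)) (?es ! i) = 0" if "i < length ?es" for i
      using that \<nu>(2) by (simp add: iso_j)
    have 4: "?g (N p) (?es ! i) = 0" if "i < length ?es" for i
      using that N1(2) by simp
    have 5: "?g (?j (\<nu> p)) (N p) = 0" using N1(2) G(2) by metis
    have 6: "?g (?i (\<eta> (\<psi> p))) (?i (\<eta> (\<psi> p))) = 1" using \<eta>1(1) by (simp only: iso_i)
    have 7: "?g (?i (\<eta> (\<psi> p))) (?es ! i) = 0" if "i < length ?es" for i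
      using that \<eta>1(2) j by (simp only: iso_i length_map)
    have 8: "?g (\<xi> (\<psi> p)) (?es ! i) = 0" if "i < length ?es" for i
      using that \<xi>1(2) j by (simp only: length_map)
    have 9: "?g (?i (\<eta> (\<psi> p))) (\<xi> (\<psi> p)) = 0" using \<xi>1(2) G(2) by metis
    note rf = rotated_frames[OF G 0 1 2 3 N1(1) 4 5 6 7 \<xi>1(1) 8 9 orient[OF p es]]
    show "?g (N p) (?i (\<eta> (\<psi> p))) = - c"
      unfolding c_def by (rule rf(1))
    show "N p = ?g (N p) (?i (\<eta> (\<psi> p))) *\<^sub>R ?i (\<eta> (\<psi> p)) + ?g (N p) (\<xi> (\<psi> p)) *\<^sub>R \<xi> (\<psi> p)"
      by (rule rf(2))
  qed
  have II: "?B (?A e) e = - c * gP (\<psi> p) (?T e') e'"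
    if "e \<in> tangent_to M (boundary M) p" "?i e' = ?j e" for e e'
    using shape_boundary_tangent[OF that(1) rot(2) that(2)] rot(1) by simp
  note bil = bilinear_ladd[OF B(1)] bilinear_radd[OF B(1)] bilinear_lmul[OF B(1)] bilinear_rmul[OF B(1)]
  have BP: "bilinear (gP (\<psi> p))" using P(3) qP by (simp add: riemannian_metric_def)
  have T: "linear ?T" by (rule shape_op_sub_linear[OF atlases(2) P(3) \<eta> q qP])
  have onP: "gP (\<psi> p) (es' ! i) (es' ! j) = (if i = j then 1 else 0)" if "i < ?m" "j < ?m" for i j
    using on[OF that] es'(3) that by (simp add: iso_j flip: iso_i)
  have Aee: "?B (?A (es ! i)) (es ! i) = - c * \<tau> ! i" if "i < ?m" for i
    using II[OF tan es'(3)] \<tau>(2) onP that by (simp add: bilinear_lmul[OF BP])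
  \<comment> \<open>The sum of two basis vectors is again tangent to the boundary. Its value under
    the quadratic form exceeds the two diagonal values by twice the mixed entry, whereas on the side
    of \<Sigma> the values \<open>\<tau> ! i\<close> and \<open>\<tau> ! j\<close> simply
    add.\<close>
  have Aij: "?B (?A (es ! i)) (es ! j) = 0" if ij: "i < ?m" "j < ?m" "i \<noteq> j" for i j
  proof -
    have "es ! i + es ! j \<in> tangent_to M (boundary M) p"
      using tan ij unfolding span[symmetric] by (intro span_add) auto
    moreover have "?i (es' ! i + es' ! j) = ?j (es ! i + es ! j)"
      using es'(3) ij linear_add[OF m.dF_linear] linear_add[OF s.dF_linear] by simp
    ultimately have "?B (?A (es ! i + es ! j)) (es ! i + es ! j) =
        - c * gP (\<psi> p) (?T (es' ! i + es' ! j)) (es' ! i + es' ! j)"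
      by (rule II)
    also have "gP (\<psi> p) (?T (es' ! i + es' ! j)) (es' ! i + es' ! j) = \<tau> ! i + \<tau> ! j"
      using \<tau>(2) ij onP by (simp add: linear_add[OF T] bilinear_lmul[OF BP] bilinear_ladd[OF BP] bilinear_radd[OF BP])
    finally have "2 * ?B (?A (es ! i)) (es ! j) = 0"
      using Aee ij m.shape_symmetric[of "es ! j" "es ! i"] B(2)[of "es ! j"]
      by (simp add: linear_add[OF m.shape_linear] bil algebra_simps)
    then show ?thesis by simp
  qed
  have expand: "v = (\<Sum>i<?m. ?B v (es ! i) *\<^sub>R es ! i) + ?B v (\<nu> p) *\<^sub>R \<nu> p" for v
    using orthonormal_expansion[OF B(1,3), of "es @ [\<nu> p]" v] frame n
    by (simp add: nth_append)
  have A\<nu>: "?A (\<nu> p) = a *\<^sub>R \<nu> p + (\<Sum>i<?m. b i *\<^sub>R es ! i)"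
    using expand[of "?A (\<nu> p)"] by (simp add: a_def b_def add.commute)
  \<comment> \<open>The \<nu>-component is again \<open>b i\<close> by symmetry of the shape
    operator, so the border is the same in row and column.\<close>
  have Ae: "?A (es ! i) = map ((*) (- c)) \<tau> ! i *\<^sub>R es ! i + b i *\<^sub>R \<nu> p" if i: "i < ?m" for i
  proof -
    have "(\<Sum>k<?m. ?B (?A (es ! i)) (es ! k) *\<^sub>R es ! k) = (\<Sum>k<?m. if k = i then (- c * \<tau> ! i) *\<^sub>R es ! i else 0)"
      by (rule sum.cong) (use Aee Aij i in auto)
    moreover have "?B (?A (es ! i)) (\<nu> p) = b i"
      using m.shape_symmetric[of "es ! i" "\<nu> p"] B(2) by (simp add: b_def)
    ultimately show ?thesis
      using expand[of "?A (es ! i)"] i \<tau>(1) by simp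
  qed
  have len: "length (map ((*) (- c)) \<tau>) = ?m" using \<tau>(1) by simp
  note curv = bordered_diagonal_curvatures[where b = b, OF B(1) m.shape_linear n len frame Ae A\<nu>]
  \<comment> \<open>Homogeneity of \<open>esym\<close> extracts the powers of \<open>- c\<close>
    from the diagonal entries \<open>- c * \<tau> ! i\<close>.\<close>
  have S: "sym_curvature (Suc (Suc r)) ?A = (- c) ^ Suc (Suc r) * esym (Suc (Suc r)) \<tau> +
      (- c) ^ Suc r * esym (Suc r) \<tau> * a - (- c) ^ r * (\<Sum>i<?m. esym r (omit i \<tau>) * (b i)\<^sup>2)" for r
    using curv(2)[of r] unfolding omit_map esym_scale by (simp add: \<tau>(1) sum_distrib_left mult_ac)
  have S1: "sym_curvature 1 ?A = - esym 1 \<tau> * c + a"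
    using curv(1) unfolding esym_scale by simp
  have neg: "(- c) ^ r = (- 1) ^ r * c ^ r" for r by (rule power_minus)
  have S2: "sym_curvature 2 ?A = esym 2 \<tau> * c ^ 2 - esym 1 \<tau> * c * a - (\<Sum>i<?m. (b i)\<^sup>2)"
    using S[of 0] by (simp add: numeral_2_eq_2)
  \<comment> \<open>For \<open>r = CARD('n)\<close> the convention that the top symmetric function
    is 0 holds by itself: \<tau> has one entry fewer, so \<open>esym r \<tau>\<close> is an empty
    sum.\<close>
  have Sr: "sym_curvature r ?A = (- 1) ^ r * esym r \<tau> * c ^ r + (- 1) ^ (r - 1) * esym (r - 1) \<tau> * c ^ (r - 1) * a -
      (- 1) ^ (r - 2) * c ^ (r - 2) * (\<Sum>i<?m. esym (r - 2) (omit i \<tau>) * (b i)\<^sup>2)" if "3 \<le> r" for r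
  proof -
    define k where "k = r - 2"
    have k: "r = Suc (Suc k)" using that by (simp add: k_def)
    have "r - 1 = Suc k" "r - 2 = k" using k by auto
    then show ?thesis using S[of k] k unfolding neg by (simp add: mult_ac)
  qed
  have newt: "?B (newton r ?A (\<nu> p)) (\<nu> p) = (- 1) ^ r * esym r \<tau> * c ^ r" if "1 \<le> r" for r
  proof -
    obtain k where k: "r = Suc k" using \<open>1 \<le> r\<close> by (cases r) auto
    show ?thesis using curv(3)[of k] unfolding k esym_scale neg by (simp add: mult_ac del: newton.simps)
  qed
  have "CARD('n) - 1 = ?m" using n by simp
  then show ?thesis
    using S1 S2 Sr newt unfolding Let_def c_def[symmetric] a_def[symmetric] b_def[symmetric] by simp
qed

end
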